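(* Let $G_0$ be a $3$-connected combinatorial graph and let $G$ be a quantum graph with underlying combinatorial graph $G_0$. Then the length of each edge of $G$ can be recovered from the Bloch spectrum, i.e. $G$ can be reconstructed metrically. That is: if $G$ and $G'$ are quantum graphs that both have underlying combinatorial graph $G_0$ and are Bloch isospectral, then there is an isomorphism between the underlying combinatorial graphs of $G$ and $G'$ that preserves the lengths of all edges.
   Context: Quantum graphs. A quantum graph $G$ is a finite connected graph (loops and multiple edges allowed, no vertices of degree $2$) with vertex set $V$ and edge set $E$, in which every edge $e$ has a length $L_e>0$ and is identified with the interval $[0,L_e]$. For a vertex $v$, $e\sim v$ ranges over the edges adjacent to $v$ (a loop at $v$ is counted once for each of its two ends), and $\nu_{v,e}$ is the outward unit normal of $e$ at $v$. A $0$-form is a continuous function $f$ on $G$ that is $C^\infty$ on each closed edge and satisfies $\sum_{e\sim v}\nu_{v,e}(f|_e)=0$ at every vertex $v$ (Kirchhoff condition). A $1$-form $\alpha$ consists of a smooth $1$-form $\alpha_e$ on each closed edge such that $\sum_{e\sim v}\alpha_e(\nu_{v,e})=0$ at every $v$. $H^1_{dR}(G,\mathbb{R})$ is the space of real $1$-forms modulo $d$ of real $0$-forms, and $H^1_{dR}(G,\mathbb{Z})$ is the subgroup of classes whose integrals over all closed walks are integers. Bloch spectrum. For a real $1$-form $\alpha$ put $d_\alpha f=df+2\pi i f\alpha$ and $\Delta_\alpha=d_\alpha^*d_\alpha$; explicitly, if $\alpha=a\,dx$ in the arc length coordinate on an edge, then $\Delta_\alpha f=-\left(\frac{d}{dx}+2\pi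 i a\right)^2 f$ on that edge. Its domain consists of the continuous $f$ that lie in the $L^2$-Sobolev space of order $2$ on each edge and satisfy the Kirchhoff condition at each vertex. $\mathrm{Spec}_\alpha(G)$ is the spectrum of $\Delta_\alpha$, with multiplicities; it depends only on the coset of $[\alpha]$ in the torus $H^1_{dR}(G,\mathbb{R})/H^1_{dR}(G,\mathbb{Z})$. The Bloch spectrum of $G$ is the map $[\alpha]\mapsto \mathrm{Spec}_\alpha(G)$ on this torus, where the torus is known only as an abstract Lie group. Two quantum graphs $G,G'$ are Bloch isospectral if there is a Lie group isomorphism $\Phi: H^1_{dR}(G,\mathbb{R})/H^1_{dR}(G,\mathbb{Z})\to H^1_{dR}(G',\mathbb{R})/H^1_{dR}(G',\mathbb{Z})$ with $\mathrm{Spec}_\alpha(G)=\mathrm{Spec}_{\Phi(\alpha)}(G')$ for all $[\alpha]$. A graph is $k$-connected if $|V|>k$ and $G\setminus X$ is connected for every set of vertices $X$ with $|X|<k$, where $G\setminus X$ is the subgraph with vertex set $V\setminus X$ and all edges of $G$ between these vertices. *)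

theory Defs
  imports
    "HOL-Analysis.Analysis"
    "HOL-Algebra.Coset"
    "HOL-Library.Function_Algebras"
    "Graph_Theory.Digraph_Component"
begin

section \<open>Combinatorial graphs\<close>

text \<open>
  A finite graph with loops and multiple edges is represented by a \<^typ>\<open>('v, 'e) pre_digraph\<close>:
  every arc is one undirected edge together with an auxiliary direction from its tail to its head.
  Isomorphisms of combinatorial graphs ignore the direction.
\<close>

definition graph_iso ::
    "('v, 'e) pre_digraph \<Rightarrow> ('w, 'f) pre_digraph \<Rightarrow> ('v \<Rightarrow> 'w) \<Rightarrow> ('e \<Rightarrow> 'f) \<Rightarrow> bool" where
  "graph_iso G H f g \<longleftrightarrow>
     bij_betw f (verts G) (verts H) \<and> bij_betw g (arcs G) (arcs H) \<and>
     (\<forall>e\<in>arcs G. {tail H (g e), head H (g e)} = {f (tail G e), f (head G e)})"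

definition graph_isomorphic :: "('v, 'e) pre_digraph \<Rightarrow> ('w, 'f) pre_digraph \<Rightarrow> bool" where
  "graph_isomorphic G H \<longleftrightarrow> (\<exists>f g. graph_iso G H f g)"

text \<open>
  \<^const>\<open>Digraph_Component.connected\<close> is connectedness of the underlying undirected graph; it
  includes that the graph has a vertex.
\<close>

definition k_connected :: "nat \<Rightarrow> ('v, 'e) pre_digraph \<Rightarrow> bool" where
  "k_connected k G \<longleftrightarrow>
     card (verts G) > k \<and>
     (\<forall>X \<subseteq> verts G. card X < k \<longrightarrow> Digraph_Component.connected (G \<restriction> (verts G - X)))"


section \<open>Quantum graphs and differential forms\<close>

text \<open>The edge \<open>e\<close> is identified with \<open>{0..L e}\<close>, where \<open>0\<close> is its tail and \<open>L e\<close> its head.\<close>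

locale quantum_graph = fin_digraph G
  for G :: "('v, 'e) pre_digraph" and L :: "'e \<Rightarrow> real" +
  assumes connected: "Digraph_Component.connected G"
    and degree_ne_2: "v \<in> verts G \<Longrightarrow> in_degree G v + out_degree G v \<noteq> 2"
    and length_pos: "e \<in> arcs G \<Longrightarrow> L e > 0"

text \<open>
  A function on the metric graph is a family \<open>f\<close> where \<open>f e\<close> is its restriction to the edge \<open>e\<close>;
  a 1-form is the family of its coefficients in the arc length coordinates, i.e.\ \<open>\<alpha> e\<close> stands
  for \<open>\<alpha> e x dx\<close>. Only the values \<open>f e x\<close> with \<open>e \<in> arcs G\<close> and \<open>x \<in> {0..L e}\<close> matter.
\<close>

definition smooth_upto :: "real \<Rightarrow> (real \<Rightarrow> 'a::real_normed_vector) \<Rightarrow> bool" where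
  "smooth_upto l u \<longleftrightarrow>
     (\<exists>D. D 0 = u \<and>
       (\<forall>n. \<forall>x\<in>{0..l}. (D n has_vector_derivative D (Suc n) x) (at x within {0..l})))"

definition edge_deriv ::
    "('e \<Rightarrow> real) \<Rightarrow> ('e \<Rightarrow> real \<Rightarrow> 'a::real_normed_vector) \<Rightarrow> 'e \<Rightarrow> real \<Rightarrow> 'a" where
  "edge_deriv L f e x = vector_derivative (f e) (at x within {0..L e})"

text \<open>
  The sum over the edge ends at \<open>v\<close> of the coefficients \<open>u\<close>, evaluated on the outward unit normals:
  the normal is \<open>d/dx\<close> at the head of an edge and \<open>-d/dx\<close> at its tail.
\<close>

definition normal_sum ::
    "('v, 'e) pre_digraph \<Rightarrow> ('e \<Rightarrow> real) \<Rightarrow> ('e \<Rightarrow> real \<Rightarrow> 'a::real_normed_vector) \<Rightarrow> 'v \<Rightarrow> 'a" where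
  "normal_sum G L u v = (\<Sum>e\<in>in_arcs G v. u e (L e)) - (\<Sum>e\<in>out_arcs G v. u e 0)"

definition kirchhoff ::
    "('v, 'e) pre_digraph \<Rightarrow> ('e \<Rightarrow> real) \<Rightarrow> ('e \<Rightarrow> real \<Rightarrow> 'a::real_normed_vector) \<Rightarrow> bool" where
  "kirchhoff G L f \<longleftrightarrow> (\<forall>v\<in>verts G. normal_sum G L (edge_deriv L f) v = 0)"

definition continuous_on_graph ::
    "('v, 'e) pre_digraph \<Rightarrow> ('e \<Rightarrow> real) \<Rightarrow> ('e \<Rightarrow> real \<Rightarrow> 'a::real_normed_vector) \<Rightarrow> bool" where
  "continuous_on_graph G L f \<longleftrightarrow>
     (\<forall>e\<in>arcs G. continuous_on {0..L e} (f e)) \<and>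
     (\<exists>\<phi>. \<forall>e\<in>arcs G. f e 0 = \<phi> (tail G e) \<and> f e (L e) = \<phi> (head G e))"

definition zero_form :: "('v, 'e) pre_digraph \<Rightarrow> ('e \<Rightarrow> real) \<Rightarrow> ('e \<Rightarrow> real \<Rightarrow> real) \<Rightarrow> bool" where
  "zero_form G L f \<longleftrightarrow>
     continuous_on_graph G L f \<and> (\<forall>e\<in>arcs G. smooth_upto (L e) (f e)) \<and> kirchhoff G L f"

definition one_form :: "('v, 'e) pre_digraph \<Rightarrow> ('e \<Rightarrow> real) \<Rightarrow> ('e \<Rightarrow> real \<Rightarrow> real) \<Rightarrow> bool" where
  "one_form G L \<alpha> \<longleftrightarrow>
     (\<forall>e\<in>arcs G. smooth_upto (L e) (\<alpha> e)) \<and> (\<forall>v\<in>verts G. normal_sum G L \<alpha> v = 0)"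


section \<open>De Rham cohomology and the torus\<close>

definition one_forms ::
    "('v, 'e) pre_digraph \<Rightarrow> ('e \<Rightarrow> real) \<Rightarrow> ('e \<Rightarrow> real \<Rightarrow> real) monoid" where
  "one_forms G L = \<lparr>carrier = {\<alpha>. one_form G L \<alpha>}, mult = (+), one = 0\<rparr>"

definition exact_forms ::
    "('v, 'e) pre_digraph \<Rightarrow> ('e \<Rightarrow> real) \<Rightarrow> ('e \<Rightarrow> real \<Rightarrow> real) set" where
  "exact_forms G L =
     {\<alpha>. one_form G L \<alpha> \<and>
         (\<exists>f. zero_form G L f \<and> (\<forall>e\<in>arcs G. \<forall>x\<in>{0..L e}. \<alpha> e x = edge_deriv L f e x))}"

definition H1 :: "('v, 'e) pre_digraph \<Rightarrow> ('e \<Rightarrow> real) \<Rightarrow> ('e \<Rightarrow> real \<Rightarrow> real) set monoid" where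
  "H1 G L = one_forms G L Mod exact_forms G L"

definition H1_class ::
    "('v, 'e) pre_digraph \<Rightarrow> ('e \<Rightarrow> real) \<Rightarrow> ('e \<Rightarrow> real \<Rightarrow> real) \<Rightarrow> ('e \<Rightarrow> real \<Rightarrow> real) set" where
  "H1_class G L \<alpha> = exact_forms G L #>\<^bsub>one_forms G L\<^esub> \<alpha>"

text \<open>
  A step of a walk is an edge with a flag, \<open>True\<close> if it is traversed from tail to head. Arc walks of
  the digraph itself would not do, since they follow the auxiliary directions.
\<close>

fun walk :: "('v, 'e) pre_digraph \<Rightarrow> 'v \<Rightarrow> ('e \<times> bool) list \<Rightarrow> 'v \<Rightarrow> bool" where
  "walk G u [] v \<longleftrightarrow> u \<in> verts G \<and> u = v"
| "walk G u ((e, fwd) # w) v \<longleftrightarrow>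
     e \<in> arcs G \<and> u = (if fwd then tail G e else head G e) \<and>
     walk G (if fwd then head G e else tail G e) w v"

definition walk_integral :: "('e \<Rightarrow> real) \<Rightarrow> ('e \<Rightarrow> real \<Rightarrow> real) \<Rightarrow> ('e \<times> bool) list \<Rightarrow> real" where
  "walk_integral L \<alpha> w =
     (\<Sum>(e, fwd)\<leftarrow>w. if fwd then integral {0..L e} (\<alpha> e) else - integral {0..L e} (\<alpha> e))"

definition H1_int ::
    "('v, 'e) pre_digraph \<Rightarrow> ('e \<Rightarrow> real) \<Rightarrow> ('e \<Rightarrow> real \<Rightarrow> real) set set" where
  "H1_int G L =
     {c \<in> carrier (H1 G L). \<forall>\<alpha>\<in>c. \<forall>v w. walk G v w v \<longrightarrow> walk_integral L \<alpha> w \<in> \<int>}"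

definition torus ::
    "('v, 'e) pre_digraph \<Rightarrow> ('e \<Rightarrow> real) \<Rightarrow> ('e \<Rightarrow> real \<Rightarrow> real) set set monoid" where
  "torus G L = H1 G L Mod H1_int G L"

definition torus_class ::
    "('v, 'e) pre_digraph \<Rightarrow> ('e \<Rightarrow> real) \<Rightarrow> ('e \<Rightarrow> real \<Rightarrow> real) \<Rightarrow> ('e \<Rightarrow> real \<Rightarrow> real) set set" where
  "torus_class G L \<alpha> = H1_int G L #>\<^bsub>H1 G L\<^esub> H1_class G L \<alpha>"

text \<open>
  The vector space topology of the finite-dimensional space \<open>H1 G L\<close> is the coarsest one for which
  all linear functionals are continuous; the torus carries the quotient topology.
\<close>

definition H1_functional ::
    "('v, 'e) pre_digraph \<Rightarrow> ('e \<Rightarrow> real) \<Rightarrow> (('e \<Rightarrow> real \<Rightarrow> real) set \<Rightarrow> real) \<Rightarrow> bool" where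
  "H1_functional G L \<phi> \<longleftrightarrow>
     (\<forall>\<alpha> \<beta>. one_form G L \<alpha> \<longrightarrow> one_form G L \<beta> \<longrightarrow>
        \<phi> (H1_class G L (\<alpha> + \<beta>)) = \<phi> (H1_class G L \<alpha>) + \<phi> (H1_class G L \<beta>)) \<and>
     (\<forall>r \<alpha>. one_form G L \<alpha> \<longrightarrow>
        \<phi> (H1_class G L (\<lambda>e x. r * \<alpha> e x)) = r * \<phi> (H1_class G L \<alpha>))"

definition H1_topology ::
    "('v, 'e) pre_digraph \<Rightarrow> ('e \<Rightarrow> real) \<Rightarrow> ('e \<Rightarrow> real \<Rightarrow> real) set topology" where
  "H1_topology G L =
     topology_generated_by
       {{c \<in> carrier (H1 G L). \<phi> c \<in> U} |\<phi> U. H1_functional G L \<phi> \<and> open U}"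

definition torus_topology ::
    "('v, 'e) pre_digraph \<Rightarrow> ('e \<Rightarrow> real) \<Rightarrow> ('e \<Rightarrow> real \<Rightarrow> real) set set topology" where
  "torus_topology G L =
     topology (\<lambda>U. U \<subseteq> carrier (torus G L) \<and>
       openin (H1_topology G L) {c \<in> topspace (H1_topology G L). H1_int G L #>\<^bsub>H1 G L\<^esub> c \<in> U})"

lemma openin_torus_topology:
  "openin (torus_topology G L) U \<longleftrightarrow>
     U \<subseteq> carrier (torus G L) \<and>
     openin (H1_topology G L) {c \<in> topspace (H1_topology G L). H1_int G L #>\<^bsub>H1 G L\<^esub> c \<in> U}"
proof -
  let ?X = "H1_topology G L" and ?\<pi> = "\<lambda>c. H1_int G L #>\<^bsub>H1 G L\<^esub> c"
  let ?P = "\<lambda>U. U \<subseteq> carrier (torus G L) \<and> openin ?X {c \<in> topspace ?X. ?\<pi> c \<in> U}"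
  have "istopology ?P"
    unfolding istopology_def
  proof (intro conjI allI impI; (elim conjE)?)
    fix S T assume "openin ?X {c \<in> topspace ?X. ?\<pi> c \<in> S}" "openin ?X {c \<in> topspace ?X. ?\<pi> c \<in> T}"
    then have "openin ?X ({c \<in> topspace ?X. ?\<pi> c \<in> S} \<inter> {c \<in> topspace ?X. ?\<pi> c \<in> T})"
      by (rule openin_Int)
    also have "{c \<in> topspace ?X. ?\<pi> c \<in> S} \<inter> {c \<in> topspace ?X. ?\<pi> c \<in> T} =
        {c \<in> topspace ?X. ?\<pi> c \<in> S \<inter> T}" by auto
    finally show "openin ?X {c \<in> topspace ?X. ?\<pi> c \<in> S \<inter> T}" .
  next
    fix \<K> assume K: "\<forall>K\<in>\<K>. ?P K"
    then have "openin ?X (\<Union>K\<in>\<K>. {c \<in> topspace ?X. ?\<pi> c \<in> K})" by auto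
    also have "(\<Union>K\<in>\<K>. {c \<in> topspace ?X. ?\<pi> c \<in> K}) = {c \<in> topspace ?X. ?\<pi> c \<in> \<Union>\<K>}" by auto
    finally show "openin ?X {c \<in> topspace ?X. ?\<pi> c \<in> \<Union>\<K>}" .
    from K show "\<Union>\<K> \<subseteq> carrier (torus G L)" by auto
  qed auto
  then show ?thesis by (simp add: torus_topology_def topology_inverse')
qed

lemma topspace_H1_topology: "topspace (H1_topology G L) = carrier (H1 G L)"
proof -
  have "H1_functional G L (\<lambda>_. 0)" by (simp add: H1_functional_def)
  then have "carrier (H1 G L) \<in> {{c \<in> carrier (H1 G L). \<phi> c \<in> U} |\<phi> U. H1_functional G L \<phi> \<and> open U}"
    by (intro CollectI exI[of _ "\<lambda>_. 0"] exI[of _ UNIV]) auto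
  then show ?thesis by (auto simp: H1_topology_def)
qed


section \<open>The operators and their spectra\<close>

definition L2_upto :: "real \<Rightarrow> (real \<Rightarrow> complex) \<Rightarrow> bool" where
  "L2_upto l u \<longleftrightarrow>
     u \<in> borel_measurable (lebesgue_on {0..l}) \<and> (\<lambda>x. (cmod (u x))\<^sup>2) integrable_on {0..l}"

text \<open>
  \<open>f\<close> is the continuous representative of an element of the Sobolev space of order 1 on \<open>[0, l]\<close>, and
  \<open>g\<close> represents its derivative in \<open>L\<^sup>2\<close>. Hence \<open>g\<close> is determined only almost everywhere.
\<close>

definition sobolev_deriv :: "real \<Rightarrow> (real \<Rightarrow> complex) \<Rightarrow> (real \<Rightarrow> complex) \<Rightarrow> bool" where
  "sobolev_deriv l f g \<longleftrightarrow> L2_upto l g \<and> (\<forall>x\<in>{0..l}. f x = f 0 + integral {0..x} g)"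

definition sobolev2 :: "real \<Rightarrow> (real \<Rightarrow> complex) \<Rightarrow> bool" where
  "sobolev2 l f \<longleftrightarrow> (\<exists>f1 f2. sobolev_deriv l f f1 \<and> sobolev_deriv l f1 f2)"

definition bloch_domain ::
    "('v, 'e) pre_digraph \<Rightarrow> ('e \<Rightarrow> real) \<Rightarrow> ('e \<Rightarrow> real \<Rightarrow> complex) \<Rightarrow> bool" where
  "bloch_domain G L f \<longleftrightarrow>
     continuous_on_graph G L f \<and> (\<forall>e\<in>arcs G. sobolev2 (L e) (f e)) \<and> kirchhoff G L f"

text \<open>\<open>u = (d/dx + 2 \<pi> i a) f\<close> on \<open>[0, l]\<close>\<close>

definition cov_deriv ::
    "real \<Rightarrow> (real \<Rightarrow> real) \<Rightarrow> (real \<Rightarrow> complex) \<Rightarrow> (real \<Rightarrow> complex) \<Rightarrow> bool" where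
  "cov_deriv l a f u \<longleftrightarrow>
     sobolev_deriv l f (\<lambda>x. u x - 2 * complex_of_real pi * \<i> * complex_of_real (a x) * f x)"

text \<open>
  The graph of the operator: \<open>f\<close> is in the domain and \<open>h\<close> represents \<open>\<Delta>\<^sub>\<alpha> f = - (d/dx + 2 \<pi> i \<alpha>)\<^sup>2 f\<close>
  in \<open>L\<^sup>2\<close>. It is closed under changing \<open>h\<close> on null sets.
\<close>

definition bloch_laplacian ::
    "('v, 'e) pre_digraph \<Rightarrow> ('e \<Rightarrow> real) \<Rightarrow> ('e \<Rightarrow> real \<Rightarrow> real) \<Rightarrow>
     ('e \<Rightarrow> real \<Rightarrow> complex) \<Rightarrow> ('e \<Rightarrow> real \<Rightarrow> complex) \<Rightarrow> bool" where
  "bloch_laplacian G L \<alpha> f h \<longleftrightarrow>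
     bloch_domain G L f \<and>
     (\<forall>e\<in>arcs G. \<exists>u. cov_deriv (L e) (\<alpha> e) (f e) u \<and> cov_deriv (L e) (\<alpha> e) u (\<lambda>x. - h e x))"

definition L2_norm ::
    "('v, 'e) pre_digraph \<Rightarrow> ('e \<Rightarrow> real) \<Rightarrow> ('e \<Rightarrow> real \<Rightarrow> complex) \<Rightarrow> real" where
  "L2_norm G L f = sqrt (\<Sum>e\<in>arcs G. integral {0..L e} (\<lambda>x. (cmod (f e x))\<^sup>2))"

text \<open>
  \<open>z\<close> is in the resolvent set iff \<open>\<Delta>\<^sub>\<alpha> - z\<close> maps its domain onto \<open>L\<^sup>2\<close> and is injective with bounded
  inverse; injectivity is part of the norm estimate. In both clauses \<open>g = (\<Delta>\<^sub>\<alpha> - z) f\<close>.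
\<close>

definition resolvent_set ::
    "('v, 'e) pre_digraph \<Rightarrow> ('e \<Rightarrow> real) \<Rightarrow> ('e \<Rightarrow> real \<Rightarrow> real) \<Rightarrow> complex set" where
  "resolvent_set G L \<alpha> =
     {z. (\<forall>g. (\<forall>e\<in>arcs G. L2_upto (L e) (g e)) \<longrightarrow>
              (\<exists>f. bloch_laplacian G L \<alpha> f (\<lambda>e x. g e x + z * f e x))) \<and>
         (\<exists>C. \<forall>f g. bloch_laplacian G L \<alpha> f (\<lambda>e x. g e x + z * f e x) \<longrightarrow>
              L2_norm G L f \<le> C * L2_norm G L g)}"

text \<open>
  Functions in an eigenspace are normalised to vanish where their values carry no meaning, so that
  the eigenspace is a complex vector space of the correct dimension.
\<close>

definition eigenspace ::
    "('v, 'e) pre_digraph \<Rightarrow> ('e \<Rightarrow> real) \<Rightarrow> ('e \<Rightarrow> real \<Rightarrow> real) \<Rightarrow> complex \<Rightarrow>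
     ('e \<Rightarrow> real \<Rightarrow> complex) set" where
  "eigenspace G L \<alpha> z =
     {f. bloch_laplacian G L \<alpha> f (\<lambda>e x. z * f e x) \<and>
         (\<forall>e x. \<not> (e \<in> arcs G \<and> x \<in> {0..L e}) \<longrightarrow> f e x = 0)}"

global_interpretation edge_fun:
  vector_space "\<lambda>(c::complex) (f :: 'e \<Rightarrow> real \<Rightarrow> complex) e x. c * f e x"
  by unfold_locales (auto simp: fun_eq_iff algebra_simps)

text \<open>The spectrum with multiplicities, as the set of pairs of a spectral value and its multiplicity.\<close>

definition Spec ::
    "('v, 'e) pre_digraph \<Rightarrow> ('e \<Rightarrow> real) \<Rightarrow> ('e \<Rightarrow> real \<Rightarrow> real) \<Rightarrow> (complex \<times> nat) set" where
  "Spec G L \<alpha> = {(z, edge_fun.dim (eigenspace G L \<alpha> z)) |z. z \<in> - resolvent_set G L \<alpha>}"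


section \<open>Bloch isospectrality\<close>

text \<open>
  An isomorphism of Lie groups is the same as an isomorphism of topological groups, because
  continuous homomorphisms between Lie groups are smooth.
\<close>

definition lie_torus_iso ::
    "('v, 'e) pre_digraph \<Rightarrow> ('e \<Rightarrow> real) \<Rightarrow> ('w, 'f) pre_digraph \<Rightarrow> ('f \<Rightarrow> real) \<Rightarrow>
     (('e \<Rightarrow> real \<Rightarrow> real) set set \<Rightarrow> ('f \<Rightarrow> real \<Rightarrow> real) set set) \<Rightarrow> bool" where
  "lie_torus_iso G L G' L' \<Phi> \<longleftrightarrow>
     \<Phi> \<in> iso (torus G L) (torus G' L') \<and>
     homeomorphic_map (torus_topology G L) (torus_topology G' L') \<Phi>"

definition bloch_isospectral ::
    "('v, 'e) pre_digraph \<Rightarrow> ('e \<Rightarrow> real) \<Rightarrow> ('w, 'f) pre_digraph \<Rightarrow> ('f \<Rightarrow> real) \<Rightarrow> bool" where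
  "bloch_isospectral G L G' L' \<longleftrightarrow>
     (\<exists>\<Phi>. lie_torus_iso G L G' L' \<Phi> \<and>
       (\<forall>\<alpha> \<alpha>'. one_form G L \<alpha> \<longrightarrow> one_form G' L' \<alpha>' \<longrightarrow>
          torus_class G' L' \<alpha>' = \<Phi> (torus_class G L \<alpha>) \<longrightarrow> Spec G L \<alpha> = Spec G' L' \<alpha>'))"

end

theory Submission
  imports
    Defs
    "HOL-Complex_Analysis.Complex_Analysis"
    "HOL-Real_Asymp.Real_Asymp"
    "Jordan_Normal_Form.Determinant"
begin

text \<open>
  The eigenfunctions of the Laplacian of a form \<open>\<alpha>\<close> for the eigenvalue \<open>k\<^sup>2 \<noteq> 0\<close> are plane waves on every
  edge. The conditions at the vertices turn into a finite system: the amplitudes of the waves that leave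
  along the directed edges (bonds) form a fixed vector of \<open>S D(k)\<close>, where \<open>S\<close> is the unitary scattering
  matrix of the vertices and \<open>D(k)\<close> holds the phases collected along the bonds. So the multiplicity of
  \<open>k\<^sup>2\<close> is the order of the zero \<open>k\<close> of the secular determinant \<open>det (I - S D(k))\<close>. This determinant
  is a finite sum of exponentials in \<open>k\<close> with constant term 1, and such a sum is determined by its zeros
  away from 0 (\<open>expsum_determined_by_zeros\<close>). Hence the spectrum for \<open>\<alpha>\<close> determines the coefficient of
  every exponential (\<open>Spec_determines_amplitudes\<close>).

  Expanding the determinant over sets of bonds shows that the coefficient of \<open>exp (i l k)\<close> is a sum over
  integer flows \<open>h\<close> of a number \<open>amp G L h l\<close> times a character of \<open>\<alpha>\<close>, which depends on \<open>h\<close> and the class of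
  \<open>\<alpha>\<close> only. When \<open>\<alpha>\<close> varies over the torus, linear independence of characters separates the flows. An
  isomorphism of tori that respects the spectra therefore matches the flows \<open>h\<close> of \<open>G\<close> with flows of \<open>G'\<close>
  of the same amplitudes. The amplitude \<open>amp G L h l\<close> vanishes for \<open>l\<close> below the length
  \<open>\<Sum>e. L e * \<bar>h e\<bar>\<close>, and for a simple cycle it does not vanish at that length. As every flow is a sum of
  simple cycles without cancellation, the matching is an isomorphism of the lattices of flows that preserves
  this norm (\<open>isospectral_imp_flow_isometry\<close>).

  The norm has a kink exactly where a coordinate of the flow vanishes, and the size of the kink is the length
  of the edge. In a 3-connected graph any two edges are separated by flows, so the kinks single out the
  edges: the isometry is induced by a bijection \<open>g\<close> of the edges, up to signs, and \<open>g\<close> preserves the lengths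
  (\<open>flow_isometry_edge_bijection\<close>). Since \<open>g\<close> also preserves the supports of flows, Whitney's argument
  applies: in a 3-connected graph the stars of vertices are visible in the supports, so \<open>g\<close> maps
  stars to stars and induces a bijection of the vertices (\<open>vertex_bijection\<close>).

  Supports of flows do not show where a loop is attached. The amplitudes do: at minimal
  length the amplitude of a flow vanishes if two bonds of the flow leave the same vertex, but it does not
  vanish for a loop together with a simple cycle that misses the vertex of the loop. So a loop at \<open>v\<close> cannot be
  mapped to a loop at the image of another vertex.
\<close>

section \<open>Characters and sums of exponentials\<close>

text \<open>
  Artin's argument: in the relation put \<open>x + y\<close> for \<open>y\<close> and subtract \<open>\<kappa> j x\<close> times the relation. The term of \<open>j\<close>
  disappears, and the shorter relation has the coefficients \<open>c i * (\<kappa> i x - \<kappa> j x)\<close>. It suffices that \<open>X\<close> is closed under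
  addition; this is applied to a half plane and to a set of pairs of forms.
\<close>

lemma characters_independent:
  fixes X :: "'a::plus set" and \<kappa> :: "'i \<Rightarrow> 'a \<Rightarrow> complex"
  assumes "finite I"
    and closed: "\<And>x y. x \<in> X \<Longrightarrow> y \<in> X \<Longrightarrow> x + y \<in> X"
    and mult: "\<And>i x y. i \<in> I \<Longrightarrow> x \<in> X \<Longrightarrow> y \<in> X \<Longrightarrow> \<kappa> i (x + y) = \<kappa> i x * \<kappa> i y"
    and nz: "\<And>i. i \<in> I \<Longrightarrow> \<exists>x\<in>X. \<kappa> i x \<noteq> 0"
    and dist: "\<And>i j. i \<in> I \<Longrightarrow> j \<in> I \<Longrightarrow> i \<noteq> j \<Longrightarrow> \<exists>x\<in>X. \<kappa> i x \<noteq> \<kappa> j x"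
    and zero: "\<And>x. x \<in> X \<Longrightarrow> (\<Sum>i\<in>I. c i * \<kappa> i x) = 0"
  shows "\<forall>i\<in>I. c i = 0"
  using assms
proof (induction I arbitrary: c rule: finite_induct)
  case empty
  then show ?case by simp
next
  case (insert j I)
  have *: "(\<Sum>i\<in>I. c i * (\<kappa> i x - \<kappa> j x) * \<kappa> i y) = 0" if x: "x \<in> X" and y: "y \<in> X" for x y
  proof -
    have "(\<Sum>i\<in>insert j I. c i * \<kappa> i (x + y)) = 0" using insert.prems(1,5) x y by blast
    moreover have "(\<Sum>i\<in>insert j I. c i * \<kappa> i (x + y)) = (\<Sum>i\<in>insert j I. c i * \<kappa> i x * \<kappa> i y)"
      using insert.prems(2) x y by (intro sum.cong) auto
    moreover have "\<kappa> j x * (\<Sum>i\<in>insert j I. c i * \<kappa> i y) = 0" using insert.prems(5) y by simp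
    ultimately have "(\<Sum>i\<in>insert j I. c i * \<kappa> i x * \<kappa> i y) - \<kappa> j x * (\<Sum>i\<in>insert j I. c i * \<kappa> i y) = 0"
      by simp
    then show ?thesis using insert.hyps
      by (simp add: sum_distrib_left sum_subtractf[symmetric] algebra_simps)
  qed
  have "c i = 0" if i: "i \<in> I" for i
  proof -
    obtain x where x: "x \<in> X" "\<kappa> i x \<noteq> \<kappa> j x" using insert.prems(4)[of i j] i insert.hyps by auto
    have "\<forall>i\<in>I. c i * (\<kappa> i x - \<kappa> j x) = 0"
      using insert.prems *[OF x(1)] by (intro insert.IH) auto
    then show ?thesis using x i by auto
  qed
  moreover from this have "c j = 0"
  proof -
    obtain x where x: "x \<in> X" "\<kappa> j x \<noteq> 0" using insert.prems(3)[of j] by auto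
    have "(\<Sum>i\<in>I. c i * \<kappa> i x) = 0" using \<open>\<And>i. i \<in> I \<Longrightarrow> c i = 0\<close> by simp
    then show ?thesis using insert.prems(5)[OF x(1)] insert.hyps x by simp
  qed
  ultimately show ?case by auto
qed

text \<open>
  The characters of both sides are cut off outside \<open>X\<close>, so that agreement on \<open>X\<close> becomes equality of functions.
  Independence of the distinct functions that occur then compares coefficients.
\<close>

lemma characters_match:
  fixes X :: "'a::plus set" and \<kappa> :: "'i \<Rightarrow> 'a \<Rightarrow> complex" and \<psi> :: "'j \<Rightarrow> 'a \<Rightarrow> complex"
  assumes fin: "finite I" "finite J"
    and closed: "\<And>x y. x \<in> X \<Longrightarrow> y \<in> X \<Longrightarrow> x + y \<in> X" and ne: "X \<noteq> {}"
    and mult: "\<And>i x y. i \<in> I \<Longrightarrow> x \<in> X \<Longrightarrow> y \<in> X \<Longrightarrow> \<kappa> i (x + y) = \<kappa> i x * \<kappa> i y"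
      "\<And>j x y. j \<in> J \<Longrightarrow> x \<in> X \<Longrightarrow> y \<in> X \<Longrightarrow> \<psi> j (x + y) = \<psi> j x * \<psi> j y"
    and nz: "\<And>i x. \<kappa> i x \<noteq> 0" "\<And>j x. \<psi> j x \<noteq> 0"
    and dist: "\<And>i i'. i \<in> I \<Longrightarrow> i' \<in> I \<Longrightarrow> i \<noteq> i' \<Longrightarrow> \<exists>x\<in>X. \<kappa> i x \<noteq> \<kappa> i' x"
      "\<And>j j'. j \<in> J \<Longrightarrow> j' \<in> J \<Longrightarrow> j \<noteq> j' \<Longrightarrow> \<exists>x\<in>X. \<psi> j x \<noteq> \<psi> j' x"
    and eq: "\<And>x. x \<in> X \<Longrightarrow> (\<Sum>i\<in>I. c i * \<kappa> i x) = (\<Sum>j\<in>J. d j * \<psi> j x)"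
    and i: "i \<in> I" and ci: "c i \<noteq> 0"
  shows "\<exists>j\<in>J. (\<forall>x\<in>X. \<psi> j x = \<kappa> i x) \<and> d j = c i"
proof -
  define r where "r f = (\<lambda>x. if x \<in> X then f x else 0)" for f :: "'a \<Rightarrow> complex"
  let ?F = "(\<lambda>i. r (\<kappa> i)) ` I \<union> (\<lambda>j. r (\<psi> j)) ` J"
  define C where "C f = (\<Sum>i | i \<in> I \<and> r (\<kappa> i) = f. c i) - (\<Sum>j | j \<in> J \<and> r (\<psi> j) = f. d j)" for f
  have "\<forall>f\<in>?F. C f = 0"
  proof (rule characters_independent[where X = X and \<kappa> = "\<lambda>f. f"])
    fix x assume x: "x \<in> X"
    have 1: "(\<Sum>f\<in>?F. (\<Sum>i | i \<in> I \<and> r (\<kappa> i) = f. c i) * f x) = (\<Sum>i\<in>I. c i * \<kappa> i x)"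
    proof -
      have "(\<Sum>f\<in>?F. (\<Sum>i | i \<in> I \<and> r (\<kappa> i) = f. c i) * f x) =
          (\<Sum>f\<in>?F. (\<Sum>i | i \<in> I \<and> r (\<kappa> i) = f. c i * \<kappa> i x))"
        using x by (intro sum.cong refl) (auto simp: sum_distrib_right r_def intro!: sum.cong)
      also have "\<dots> = (\<Sum>i\<in>I. c i * \<kappa> i x)"
        using fin by (intro sum.group) auto
      finally show ?thesis .
    qed
    have 2: "(\<Sum>f\<in>?F. (\<Sum>j | j \<in> J \<and> r (\<psi> j) = f. d j) * f x) = (\<Sum>j\<in>J. d j * \<psi> j x)"
    proof -
      have "(\<Sum>f\<in>?F. (\<Sum>j | j \<in> J \<and> r (\<psi> j) = f. d j) * f x) =
          (\<Sum>f\<in>?F. (\<Sum>j | j \<in> J \<and> r (\<psi> j) = f. d j * \<psi> j x))"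
        using x by (intro sum.cong refl) (auto simp: sum_distrib_right r_def intro!: sum.cong)
      also have "\<dots> = (\<Sum>j\<in>J. d j * \<psi> j x)"
        using fin by (intro sum.group) auto
      finally show ?thesis .
    qed
    show "(\<Sum>f\<in>?F. C f * f x) = 0"
      using eq[OF x] 1 2 by (simp add: C_def left_diff_distrib sum_subtractf)
  next
    fix f assume "f \<in> ?F"
    then obtain i j where "f = r (\<kappa> i) \<or> f = r (\<psi> j)" by blast
    moreover obtain x where "x \<in> X" using ne by blast
    ultimately show "\<exists>x\<in>X. f x \<noteq> 0" using nz by (intro bexI[of _ x]) (auto simp: r_def)
  next
    fix f g assume fg: "f \<in> ?F" "g \<in> ?F" "f \<noteq> g"
    then obtain x where "f x \<noteq> g x" by auto
    moreover have "x \<in> X" using fg(1,2) \<open>f x \<noteq> g x\<close> by (auto simp: r_def split: if_splits)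
    ultimately show "\<exists>x\<in>X. f x \<noteq> g x" by auto
  qed (use fin closed mult in \<open>auto simp: r_def\<close>)
  then have C0: "C (r (\<kappa> i)) = 0" using i by auto
  have "i' = i" if "i' \<in> I" "r (\<kappa> i') = r (\<kappa> i)" for i'
  proof (rule ccontr)
    assume "i' \<noteq> i"
    from dist(1)[OF that(1) i this] obtain x where "x \<in> X" "\<kappa> i' x \<noteq> \<kappa> i x" by auto
    with fun_cong[OF that(2), of x] show False by (simp add: r_def)
  qed
  then have "{i' \<in> I. r (\<kappa> i') = r (\<kappa> i)} = {i}" using i by blast
  then have sd: "c i = (\<Sum>j | j \<in> J \<and> r (\<psi> j) = r (\<kappa> i). d j)"
    using C0 by (simp add: C_def)
  then have "{j \<in> J. r (\<psi> j) = r (\<kappa> i)} \<noteq> {}" using ci by force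
  then obtain j where j: "j \<in> J" "r (\<psi> j) = r (\<kappa> i)" by blast
  have J1: "{j' \<in> J. r (\<psi> j') = r (\<kappa> i)} = {j}"
  proof -
    have "j' = j" if "j' \<in> J" "r (\<psi> j') = r (\<kappa> i)" for j'
    proof (rule ccontr)
      assume "j' \<noteq> j"
      from dist(2)[OF that(1) j(1) this] obtain x where "x \<in> X" "\<psi> j' x \<noteq> \<psi> j x" by auto
      with fun_cong[OF trans[OF that(2) j(2)[symmetric]], of x] show False by (simp add: r_def)
    qed
    then show ?thesis using j by blast
  qed
  have "c i = sum d {j}" using sd unfolding J1 .
  then have "d j = c i" by simp
  moreover have "\<psi> j x = \<kappa> i x" if "x \<in> X" for x
    using fun_cong[OF j(2), of x] that by (simp add: r_def)
  ultimately show ?thesis using j(1) by blast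
qed

definition expsum :: "real set \<Rightarrow> (real \<Rightarrow> complex) \<Rightarrow> complex \<Rightarrow> complex" where
  "expsum T c k = (\<Sum>l\<in>T. c l * exp (\<i> * of_real l * k))"

lemma expsum_holomorphic [holomorphic_intros]: "expsum T c holomorphic_on A"
  unfolding expsum_def[abs_def] by (intro holomorphic_intros)

lemma expsum_shift:
  "expsum T c (of_real t + k) = expsum T (\<lambda>l. c l * exp (\<i> * of_real (l * t))) k"
  unfolding expsum_def by (intro sum.cong refl) (simp add: algebra_simps exp_add)

lemma norm_exp_i_times: "norm (exp (\<i> * of_real l * k)) = exp (- (l * Im k))"
  by (simp add: norm_exp_eq_Re)

text \<open>
  Far up in the upper half plane every exponential of positive frequency is small.
\<close>

lemma expsum_upper_limit:
  assumes "finite T" and "T \<subseteq> {0..}" and "0 \<in> T" and "e > 0"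
  shows "\<exists>Y. \<forall>k. Im k \<ge> Y \<longrightarrow> norm (expsum T c k - c 0) < e"
proof -
  have "((\<lambda>y. \<Sum>l\<in>T - {0}. norm (c l) * exp (- (l * y))) \<longlongrightarrow> (\<Sum>l\<in>T - {0}. norm (c l) * 0)) at_top"
  proof (intro tendsto_sum tendsto_mult tendsto_const)
    fix l assume "l \<in> T - {0}"
    then have "l > 0" using assms by fastforce
    then show "((\<lambda>y. exp (- (l * y))) \<longlongrightarrow> 0) at_top"
      by real_asymp
  qed
  then have "eventually (\<lambda>y. (\<Sum>l\<in>T - {0}. norm (c l) * exp (- (l * y))) < e) at_top"
    using assms(4) by (auto dest!: order_tendstoD(2))
  then obtain Y where Y: "\<And>y. y \<ge> Y \<Longrightarrow> (\<Sum>l\<in>T - {0}. norm (c l) * exp (- (l * y))) < e"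
    by (auto simp: eventually_at_top_linorder)
  have "norm (expsum T c k - c 0) < e" if "Im k \<ge> Y" for k
  proof -
    have "expsum T c k - c 0 = (\<Sum>l\<in>T - {0}. c l * exp (\<i> * of_real l * k))"
      unfolding expsum_def using assms by (subst sum.remove[of _ 0]) auto
    also have "norm \<dots> \<le> (\<Sum>l\<in>T - {0}. norm (c l) * exp (- (l * Im k)))"
      by (intro sum_norm_le) (simp add: norm_mult norm_exp_i_times)
    also have "\<dots> < e" using Y[OF that] .
    finally show ?thesis .
  qed
  then show ?thesis by auto
qed

lemma common_convergent_subsequence:
  fixes d :: "nat \<Rightarrow> 'i \<Rightarrow> complex"
  assumes "finite T" and "\<And>n l. l \<in> T \<Longrightarrow> norm (d n l) \<le> B l"
  shows "\<exists>\<sigma> e. strict_mono \<sigma> \<and> (\<forall>l\<in>T. (\<lambda>n. d (\<sigma> n) l) \<longlonglongrightarrow> e l)"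
  using assms
proof (induction T rule: finite_induct)
  case empty
  then show ?case by (auto intro!: exI[of _ "\<lambda>n. n"] simp: strict_mono_def)
next
  case (insert l T)
  then have "\<exists>\<sigma> e. strict_mono \<sigma> \<and> (\<forall>l\<in>T. (\<lambda>n. d (\<sigma> n) l) \<longlonglongrightarrow> e l)" by auto
  then obtain \<sigma> e where \<sigma>: "strict_mono \<sigma>" "\<And>l. l \<in> T \<Longrightarrow> (\<lambda>n. d (\<sigma> n) l) \<longlonglongrightarrow> e l" by blast
  have "bounded (range (\<lambda>n. d (\<sigma> n) l))"
    using insert.prems by (auto simp: bounded_iff)
  then obtain x \<tau> where \<tau>: "strict_mono \<tau>" "((\<lambda>n. d (\<sigma> n) l) \<circ> \<tau>) \<longlonglongrightarrow> x"
    using bounded_imp_convergent_subsequence by blast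
  have "(\<lambda>n. d ((\<sigma> \<circ> \<tau>) n) m) \<longlonglongrightarrow> (e(l := x)) m" if "m \<in> insert l T" for m
    using that \<tau> insert.hyps LIMSEQ_subseq_LIMSEQ[OF \<sigma>(2) \<tau>(1)] by (auto simp: o_def)
  then show ?case using strict_mono_o[OF \<sigma>(1) \<tau>(1)] by blast
qed

text \<open>
  A rectangle contains finitely many zeros, so almost every vertical segment misses them.
\<close>

lemma expsum_zero_free_vertical:
  assumes T: "finite T" "T \<subseteq> {0..}" "0 \<in> T" and c: "c 0 \<noteq> 0"
  shows "\<exists>r\<in>{0..1}. \<forall>y. \<bar>y\<bar> \<le> Y \<longrightarrow> expsum T c (Complex r y) \<noteq> 0"
proof -
  let ?K = "cbox (Complex 0 (-Y)) (Complex 1 Y)"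
  obtain Y0 where Y0: "\<And>k. Im k \<ge> Y0 \<Longrightarrow> norm (expsum T c k - c 0) < norm (c 0)"
    using expsum_upper_limit[OF T, of "norm (c 0)" c] c by auto
  have "expsum T c (Complex 0 Y0) \<noteq> 0" using Y0[of "Complex 0 Y0"] by auto
  moreover have "finite {z \<in> ?K. expsum T c z = 0}"
  proof (cases "expsum T c constant_on UNIV")
    case True
    then have "expsum T c z \<noteq> 0" for z
      using calculation unfolding constant_on_def by force
    then show ?thesis by simp
  next
    case False
    show ?thesis
      by (intro holomorphic_compact_finite_zeros[where S = UNIV] expsum_holomorphic False) auto
  qed
  ultimately have "finite (Re ` {z \<in> ?K. expsum T c z = 0})" by blast
  then have "infinite ({0..1} - Re ` {z \<in> ?K. expsum T c z = 0})"
    by (intro Diff_infinite_finite) (auto simp: infinite_Icc)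
  then obtain r where r: "r \<in> {0..1}" "r \<notin> Re ` {z \<in> ?K. expsum T c z = 0}"
    using infinite_imp_nonempty by blast
  have "expsum T c (Complex r y) \<noteq> 0" if "\<bar>y\<bar> \<le> Y" for y
  proof
    assume "expsum T c (Complex r y) = 0"
    then have "Complex r y \<in> {z \<in> ?K. expsum T c z = 0}"
      using r(1) that by (auto simp: in_cbox_complex_iff)
    then show False using r(2) by force
  qed
  then show ?thesis using r(1) by blast
qed

text \<open>
  A form of almost periodicity. A translation by \<open>t\<close> multiplies the coefficient of frequency \<open>l\<close> by
  \<open>exp (i l t)\<close> and keeps its modulus. If there were no uniform bound, then suitable translates would converge to a
  sum of exponentials with the same constant term that has a zero on each vertical segment over \<open>{0..1}\<close>, which the
  previous lemma excludes.
\<close>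

lemma expsum_lower_bound_vertical:
  assumes T: "finite T" "T \<subseteq> {0..}" "0 \<in> T" and c: "c 0 \<noteq> 0" and Y: "Y \<ge> 0"
  shows "\<exists>\<epsilon>>0. \<forall>t. \<exists>r\<in>{t..t+1}. \<forall>y. \<bar>y\<bar> \<le> Y \<longrightarrow> norm (expsum T c (Complex r y)) \<ge> \<epsilon>"
proof (rule ccontr)
  assume "\<not> ?thesis"
  then have neg: "\<exists>t. \<forall>r\<in>{t..t+1}. \<exists>y. \<bar>y\<bar> \<le> Y \<and> norm (expsum T c (Complex r y)) < \<epsilon>" if "\<epsilon> > 0" for \<epsilon>
    using that by (meson not_le)
  have "\<forall>n. \<exists>t. \<forall>r\<in>{t..t+1}. \<exists>y. \<bar>y\<bar> \<le> Y \<and> norm (expsum T c (Complex r y)) < 1 / Suc n"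
    using neg by simp
  then obtain t where t: "\<And>n r. r \<in> {t n..t n + 1} \<Longrightarrow>
      \<exists>y. \<bar>y\<bar> \<le> Y \<and> norm (expsum T c (Complex r y)) < 1 / Suc n" by metis
  define d where "d n l = c l * exp (\<i> * of_real (l * t n))" for n l
  have "norm (d n l) \<le> norm (c l)" for n l by (simp add: d_def norm_mult)
  then have "\<exists>\<sigma> e. strict_mono \<sigma> \<and> (\<forall>l\<in>T. (\<lambda>n. d (\<sigma> n) l) \<longlonglongrightarrow> e l)"
    by (intro common_convergent_subsequence[OF T(1), of d "\<lambda>l. norm (c l)"])
  then obtain \<sigma> e
    where \<sigma>: "strict_mono \<sigma>" and e: "\<And>l. l \<in> T \<Longrightarrow> (\<lambda>n. d (\<sigma> n) l) \<longlonglongrightarrow> e l" by blast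
  have "(\<lambda>n. d (\<sigma> n) 0) \<longlonglongrightarrow> c 0" by (simp add: d_def)
  from LIMSEQ_unique[OF this e[OF T(3)]] have "e 0 \<noteq> 0" using c by simp
  from expsum_zero_free_vertical[of T e Y, OF T this] obtain r where r: "r \<in> {0..1}"
    "\<And>y. \<bar>y\<bar> \<le> Y \<Longrightarrow> expsum T e (Complex r y) \<noteq> 0" by blast
  have "continuous_on {-Y..Y} (\<lambda>y. norm (expsum T e (Complex r y)))"
    unfolding expsum_def Complex_eq by (intro continuous_intros)
  then obtain y0 where y0: "y0 \<in> {-Y..Y}" "\<And>y. y \<in> {-Y..Y} \<Longrightarrow>
      norm (expsum T e (Complex r y0)) \<le> norm (expsum T e (Complex r y))"
    using continuous_attains_inf[of "{-Y..Y}" "\<lambda>y. norm (expsum T e (Complex r y))"] Y by fastforce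
  define m where "m = norm (expsum T e (Complex r y0))"
  have m: "m > 0" using r(2)[of y0] y0(1) by (simp add: m_def abs_le_iff)
  have bd: "norm (expsum T (d n) (Complex r y) - expsum T e (Complex r y)) \<le>
      (\<Sum>l\<in>T. norm (d n l - e l) * exp (l * Y))" if "\<bar>y\<bar> \<le> Y" for n y
  proof -
    have "expsum T (d n) (Complex r y) - expsum T e (Complex r y) =
        (\<Sum>l\<in>T. (d n l - e l) * exp (\<i> * of_real l * Complex r y))"
      by (simp add: expsum_def sum_subtractf left_diff_distrib)
    also have "norm \<dots> \<le> (\<Sum>l\<in>T. norm (d n l - e l) * exp (l * Y))"
    proof (intro sum_norm_le)
      fix l assume "l \<in> T"
      then have "l \<ge> 0" using T(2) by auto
      then have "l * (-y) \<le> l * Y" using that by (intro mult_left_mono) auto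
      then show "norm ((d n l - e l) * exp (\<i> * of_real l * Complex r y)) \<le> norm (d n l - e l) * exp (l * Y)"
        unfolding norm_mult norm_exp_i_times by (intro mult_left_mono) auto
    qed
    finally show ?thesis .
  qed
  have "(\<lambda>n. \<Sum>l\<in>T. norm (d (\<sigma> n) l - e l) * exp (l * Y)) \<longlonglongrightarrow> (\<Sum>l\<in>T. norm (e l - e l) * exp (l * Y))"
    by (intro tendsto_intros e)
  then have "(\<lambda>n. \<Sum>l\<in>T. norm (d (\<sigma> n) l - e l) * exp (l * Y)) \<longlonglongrightarrow> 0" by simp
  from order_tendstoD(2)[OF this, of "m/2"] m
  have ev1: "eventually (\<lambda>n. (\<Sum>l\<in>T. norm (d (\<sigma> n) l - e l) * exp (l * Y)) < m/2) sequentially" by simp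
  have "(\<lambda>n. 1 / real (Suc (\<sigma> n))) \<longlonglongrightarrow> 0"
    using LIMSEQ_subseq_LIMSEQ[OF LIMSEQ_inverse_real_of_nat \<sigma>] by (simp add: o_def divide_inverse)
  from order_tendstoD(2)[OF this, of "m/2"] m
  have ev2: "eventually (\<lambda>n. 1 / real (Suc (\<sigma> n)) < m/2) sequentially" by simp
  obtain n where n: "(\<Sum>l\<in>T. norm (d (\<sigma> n) l - e l) * exp (l * Y)) < m/2" "1 / real (Suc (\<sigma> n)) < m/2"
    using eventually_happens[OF eventually_conj[OF ev1 ev2]] by auto
  obtain y where y: "\<bar>y\<bar> \<le> Y" "norm (expsum T c (Complex (t (\<sigma> n) + r) y)) < 1 / Suc (\<sigma> n)"
    using t[of "t (\<sigma> n) + r" "\<sigma> n"] r(1) by auto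
  have eq1: "expsum T c (Complex (t (\<sigma> n) + r) y) = expsum T (d (\<sigma> n)) (Complex r y)"
    unfolding d_def using expsum_shift[of T c "t (\<sigma> n)" "Complex r y"]
    by (simp add: complex_eq_iff Complex_eq algebra_simps)
  have "m \<le> norm (expsum T e (Complex r y))" using y0(2)[of y] y(1) by (simp add: m_def abs_le_iff)
  moreover have "norm (expsum T e (Complex r y)) \<le> norm (expsum T (d (\<sigma> n)) (Complex r y)) +
      norm (expsum T (d (\<sigma> n)) (Complex r y) - expsum T e (Complex r y))"
    using norm_triangle_sub[of "expsum T e (Complex r y)" "expsum T (d (\<sigma> n)) (Complex r y)"]
    by (simp add: norm_minus_commute)
  ultimately show False using bd[OF y(1), of "\<sigma> n"] n y(2)[unfolded eq1] by linarith
qed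

text \<open>
  The order of a zero is witnessed by an entire cofactor. Order 0 means no zero, and the zero function
  has no order.
\<close>

definition has_order :: "(complex \<Rightarrow> complex) \<Rightarrow> complex \<Rightarrow> nat \<Rightarrow> bool" where
  "has_order P z n \<longleftrightarrow> (\<exists>g. g holomorphic_on UNIV \<and> g z \<noteq> 0 \<and> (\<forall>w. P w = (w - z) ^ n * g w))"

text \<open>
  Near \<open>z\<close> the quotient is that of the cofactors at \<open>z\<close>, which do not vanish there; the common value
  of the cofactors at \<open>z\<close> itself defines it at the zeros.
\<close>

lemma entire_quotient:
  assumes "\<And>z. \<exists>n. has_order P z n \<and> has_order Q z n"
  obtains R where "R holomorphic_on UNIV" "\<And>z. R z \<noteq> 0" "\<And>z. P z = R z * Q z"
proof -
  have "\<forall>z. \<exists>n g h. g holomorphic_on UNIV \<and> g z \<noteq> 0 \<and> (\<forall>w. P w = (w - z) ^ n * g w) \<and>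
      h holomorphic_on UNIV \<and> h z \<noteq> 0 \<and> (\<forall>w. Q w = (w - z) ^ n * h w)"
    using assms unfolding has_order_def by meson
  then obtain N g h where g: "\<And>z. g z holomorphic_on UNIV" "\<And>z. g z z \<noteq> 0" "\<And>z w. P w = (w - z) ^ N z * g z w"
    and h: "\<And>z. h z holomorphic_on UNIV" "\<And>z. h z z \<noteq> 0" "\<And>z w. Q w = (w - z) ^ N z * h z w" by metis
  define R where "R z = g z z / h z z" for z
  have RPQ: "R w = P w / Q w" if "Q w \<noteq> 0" for w
  proof -
    have "N w = 0" using that h(3)[of w w] by (cases "N w") auto
    then show ?thesis using g(3)[of w w] h(3)[of w w] by (simp add: R_def)
  qed
  have "R analytic_on {z}" for z
  proof -
    have "eventually (\<lambda>w. h z w \<noteq> 0) (nhds z)"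
    proof (rule tendsto_imp_eventually_ne)
      show "(h z \<longlongrightarrow> h z z) (nhds z)"
        using holomorphic_on_imp_continuous_on[OF h(1)[of z]]
        by (simp add: continuous_on_eq_continuous_at isCont_def tendsto_at_iff_tendsto_nhds)
    qed (use h(2) in auto)
    then have "eventually (\<lambda>w. R w = g z w / h z w) (nhds z)"
    proof (rule eventually_mono)
      fix w assume "h z w \<noteq> 0"
      then show "R w = g z w / h z w"
        using g(3)[of w z] h(3)[of w z] RPQ[of w] by (cases "w = z") (auto simp: R_def)
    qed
    moreover have "(\<lambda>w. g z w / h z w) analytic_on {z}"
      using g(1)[of z] h(1,2)[of z] by (intro analytic_on_divide) (auto simp: analytic_on_holomorphic)
    ultimately show ?thesis by (simp add: analytic_at_cong)
  qed
  then have "R holomorphic_on UNIV"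
    by (meson analytic_imp_holomorphic analytic_on_analytic_at)
  moreover have "R z \<noteq> 0" for z using g(2) h(2) by (simp add: R_def)
  moreover have "P z = R z * Q z" for z
    using g(3)[of z z] h(3)[of z z] h(2)[of z] by (cases "N z") (auto simp: R_def)
  ultimately show ?thesis using that by blast
qed

lemma has_order_times_power:
  assumes "has_order P z n" and "z \<noteq> 0"
  shows "has_order (\<lambda>w. w ^ b * P w) z n"
proof -
  obtain g where "g holomorphic_on UNIV" "g z \<noteq> 0" "\<And>w. P w = (w - z) ^ n * g w"
    using assms(1) by (auto simp: has_order_def)
  then show ?thesis using assms(2) unfolding has_order_def
    by (intro exI[of _ "\<lambda>w. w ^ b * g w"]) (auto intro!: holomorphic_intros)
qed

lemma has_order_times_power_0:
  assumes "has_order P 0 n"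
  shows "has_order (\<lambda>w. w ^ b * P w) 0 (b + n)"
  using assms unfolding has_order_def by (auto simp: power_add)

text \<open>
  By Liouville such a function is a polynomial, and a polynomial without zeros is constant.
\<close>

lemma zero_free_polynomial_growth_imp_constant:
  assumes R: "R holomorphic_on UNIV" "\<And>z. R z \<noteq> 0"
    and bd: "\<And>z. A \<le> norm z \<Longrightarrow> norm (R z) \<le> B * norm z ^ n"
  shows "\<exists>c. c \<noteq> 0 \<and> (\<forall>z. R z = c)"
proof -
  define a where "a k = (deriv ^^ k) R 0 / fact k" for k
  have R_eq: "R z = (\<Sum>k\<le>n. a k * z ^ k)" for z
    using Liouville_polynomial[OF R(1) bd, where \<xi> = z] by (simp add: a_def)
  have "a i = 0" if "i \<in> {1..n}" for i
    using fundamental_theorem_of_algebra[of a n] that R(2) R_eq by metis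
  then have "R z = a 0" for z
    unfolding R_eq by (subst sum.remove[of _ 0]) (auto intro!: sum.neutral)
  then show ?thesis using R(2) by metis
qed

text \<open>
  Along the positive imaginary axis the power is unbounded while both other factors tend to 1.
\<close>

lemma power_dominates_bounded:
  fixes P Q :: "complex \<Rightarrow> complex"
  assumes P: "((\<lambda>y. P (Complex 0 y)) \<longlongrightarrow> 1) at_top" and Q: "((\<lambda>y. Q (Complex 0 y)) \<longlongrightarrow> 1) at_top"
    and eq: "\<And>k. k \<noteq> 0 \<Longrightarrow> k ^ Suc m * P k = c * Q k"
  shows False
proof -
  have "((\<lambda>y. c * Q (Complex 0 y) / P (Complex 0 y)) \<longlongrightarrow> c * 1 / 1) at_top"
    by (intro tendsto_intros P Q) auto
  moreover have "eventually (\<lambda>y. P (Complex 0 y) \<noteq> 0) at_top"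
    using tendsto_imp_eventually_ne[OF P] by simp
  then have "eventually (\<lambda>y. c * Q (Complex 0 y) / P (Complex 0 y) = Complex 0 y ^ Suc m) at_top"
    using eventually_gt_at_top[of "0::real"]
  proof eventually_elim
    case (elim y)
    then have "Complex 0 y \<noteq> 0" by (simp add: complex_eq_iff)
    from eq[OF this] elim show ?case by (simp add: nonzero_divide_eq_eq del: power_Suc)
  qed
  ultimately have "((\<lambda>y. Complex 0 y ^ Suc m) \<longlongrightarrow> c) at_top"
    by (simp add: tendsto_cong)
  then have "((\<lambda>y. norm (Complex 0 y ^ Suc m)) \<longlongrightarrow> norm c) at_top" by (rule tendsto_norm)
  moreover have "filterlim (\<lambda>y. norm (Complex 0 y ^ Suc m)) at_top at_top"
  proof (rule filterlim_at_top_mono[OF filterlim_ident])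
    show "eventually (\<lambda>y. y \<le> norm (Complex 0 y ^ Suc m)) at_top"
      using eventually_ge_at_top[of "1::real"]
    proof eventually_elim
      case (elim y)
      then have "y ^ 1 \<le> y ^ Suc m" by (intro power_increasing) auto
      moreover have "norm (Complex 0 y) = y" using elim by (simp add: complex_norm)
      ultimately show ?case by (simp add: norm_power norm_mult)
    qed
  qed
  ultimately show False using not_tendsto_and_filterlim_at_infinity[of at_top]
    by (metis filterlim_at_top_imp_at_infinity trivial_limit_at_top_linorder)
qed

lemma expsum_tendsto_1:
  assumes "finite T" "T \<subseteq> {0..}" "0 \<in> T" "c 0 = 1"
  shows "((\<lambda>y. expsum T c (Complex 0 y)) \<longlongrightarrow> 1) at_top"
proof (rule tendstoI)
  fix e :: real assume "e > 0"
  from expsum_upper_limit[OF assms(1-3) this, of c] assms(4) obtain Y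
    where "\<And>k. Im k \<ge> Y \<Longrightarrow> norm (expsum T c k - 1) < e" by auto
  then show "eventually (\<lambda>y. dist (expsum T c (Complex 0 y)) 1 < e) at_top"
    by (auto simp: dist_norm eventually_at_top_linorder intro!: exI[of _ Y])
qed

text \<open>
  Far up both sums are close to their constant terms. Far down the term of the largest frequency \<open>\<omega>\<close> dominates
  the sum with the coefficients \<open>d\<close>, and the other sum contains no larger frequency. In the strip between, the uniform lower bound on
  vertical segments helps. So the quotient is bounded on the boundary of a rectangle of bounded size around each
  point of the strip.
\<close>

lemma expsum_ratio_bound:
  assumes T: "finite T" "T \<subseteq> {0..\<omega>}" "0 \<in> T" "\<omega> \<in> T" and c: "c 0 = 1" and d: "d 0 = 1" "d \<omega> \<noteq> 0"
  shows "\<exists>C Y. Y > 0 \<and> C > 0 \<and> (\<forall>k. \<bar>Im k\<bar> \<ge> Y \<longrightarrow> norm (expsum T c k) \<le> C * norm (expsum T d k) \<and> expsum T d k \<noteq> 0) \<and>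
    (\<forall>t. \<exists>r\<in>{t..t+1}. \<forall>y. \<bar>y\<bar> \<le> Y \<longrightarrow> norm (expsum T c (Complex r y)) \<le> C * norm (expsum T d (Complex r y)) \<and>
       expsum T d (Complex r y) \<noteq> 0)"
proof -
  define S where "S = (\<Sum>l\<in>T. norm (c l))"
  have S: "S \<ge> 1" using T c member_le_sum[of 0 T "\<lambda>l. norm (c l)"] by (simp add: S_def)
  have \<omega>: "\<omega> \<ge> 0" using T by auto
  have T0: "T \<subseteq> {0..}" using T by auto
  have bd: "norm (expsum T c k) \<le> S * exp (\<omega> * max 0 (- Im k))" for k
    unfolding expsum_def S_def sum_distrib_right
  proof (intro sum_norm_le)
    fix l assume "l \<in> T"
    then have "0 \<le> l" "l \<le> \<omega>" using T by auto
    then have "l * (- Im k) \<le> \<omega> * max 0 (- Im k)"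
      by (intro order_trans[OF mult_left_mono mult_right_mono]) auto
    then show "norm (c l * exp (\<i> * of_real l * k)) \<le> norm (c l) * exp (\<omega> * max 0 (- Im k))"
      unfolding norm_mult norm_exp_i_times by (intro mult_left_mono) auto
  qed
  obtain Y1 where Y1: "\<And>k. Im k \<ge> Y1 \<Longrightarrow> norm (expsum T d k - 1) < 1/2"
    using expsum_upper_limit[OF T(1) T0 T(3), of "1/2" d] d by auto
  \<comment> \<open>Reversing the frequencies turns the lower half plane into the upper one.\<close>
  define d' where "d' l = d (\<omega> - l)" for l
  define T' where "T' = (\<lambda>l. \<omega> - l) ` T"
  have refl: "expsum T d k = exp (\<i> * of_real \<omega> * k) * expsum T' d' (- k)" for k
  proof -
    have "expsum T' d' (- k) = (\<Sum>l\<in>T. d l * exp (\<i> * of_real (\<omega> - l) * (- k)))"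
      unfolding expsum_def T'_def by (subst sum.reindex) (auto simp: inj_on_def d'_def)
    then have "exp (\<i> * of_real \<omega> * k) * expsum T' d' (- k) =
        (\<Sum>l\<in>T. d l * (exp (\<i> * of_real \<omega> * k) * exp (\<i> * of_real (\<omega> - l) * (- k))))"
      by (simp add: sum_distrib_left mult_ac)
    also have "\<dots> = expsum T d k"
      unfolding expsum_def exp_add[symmetric] by (intro sum.cong refl) (simp add: algebra_simps)
    finally show ?thesis by simp
  qed
  have T': "finite T'" "T' \<subseteq> {0..}" "0 \<in> T'" using T by (auto simp: T'_def)
  obtain Y2 where Y2: "\<And>k. Im k \<ge> Y2 \<Longrightarrow> norm (expsum T' d' k - d \<omega>) < norm (d \<omega>) / 2"
    using expsum_upper_limit[OF T', of "norm (d \<omega>) / 2" d'] d by (auto simp: d'_def)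
  define Y where "Y = max 1 (max Y1 Y2)"
  have Y: "Y > 0" "Y \<ge> Y1" "Y \<ge> Y2" by (auto simp: Y_def)
  obtain \<epsilon> where \<epsilon>: "\<epsilon> > 0" "\<And>t. \<exists>r\<in>{t..t+1}. \<forall>y. \<bar>y\<bar> \<le> Y \<longrightarrow> norm (expsum T d (Complex r y)) \<ge> \<epsilon>"
    using expsum_lower_bound_vertical[of T d Y, OF T(1) T0 T(3)] d Y by auto
  define C where "C = max (2 * S) (max (2 * S / norm (d \<omega>)) (S * exp (\<omega> * Y) / \<epsilon>))"
  have C: "C \<ge> 2 * S" "C \<ge> 2 * S / norm (d \<omega>)" "C \<ge> S * exp (\<omega> * Y) / \<epsilon>" by (auto simp: C_def)
  have "C > 0" using C S by linarith
  moreover have "norm (expsum T c k) \<le> C * norm (expsum T d k) \<and> expsum T d k \<noteq> 0" if k: "\<bar>Im k\<bar> \<ge> Y" for k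
  proof (cases "Im k \<ge> Y")
    case True
    then have "norm (expsum T d k - 1) < 1/2" using Y1 Y by simp
    then have ge: "norm (expsum T d k) \<ge> 1/2"
      using norm_triangle_ineq2[of 1 "expsum T d k"] by (simp add: norm_minus_commute)
    have "norm (expsum T c k) \<le> S" using bd[of k] True Y by simp
    also have "\<dots> \<le> (2 * S) * norm (expsum T d k)" using mult_left_mono[OF ge, of "2 * S"] S by simp
    also have "\<dots> \<le> C * norm (expsum T d k)" using C by (intro mult_right_mono) auto
    finally show ?thesis using ge by auto
  next
    case False
    then have neg: "Im k \<le> - Y" using k by linarith
    then have "norm (expsum T' d' (-k) - d \<omega>) < norm (d \<omega>) / 2" using Y2[of "-k"] Y by simp
    then have "norm (expsum T' d' (-k)) \<ge> norm (d \<omega>) / 2"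
      using norm_triangle_ineq2[of "d \<omega>" "expsum T' d' (-k)"] by (simp add: norm_minus_commute)
    then have ge: "norm (expsum T d k) \<ge> exp (- (\<omega> * Im k)) * (norm (d \<omega>) / 2)"
      unfolding refl norm_mult norm_exp_i_times by (intro mult_left_mono) auto
    then have pos: "norm (expsum T d k) > 0"
      using d by (intro less_le_trans[OF _ ge]) auto
    have "norm (expsum T c k) \<le> S * exp (- (\<omega> * Im k))" using bd[of k] neg Y by (simp add: max_def split: if_splits)
    also have "\<dots> = (2 * S / norm (d \<omega>)) * (exp (- (\<omega> * Im k)) * (norm (d \<omega>) / 2))" using d by simp
    also have "\<dots> \<le> (2 * S / norm (d \<omega>)) * norm (expsum T d k)" using S by (intro mult_left_mono ge) auto
    also have "\<dots> \<le> C * norm (expsum T d k)" using C by (intro mult_right_mono) auto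
    finally show ?thesis using pos by auto
  qed
  moreover have "\<exists>r\<in>{t..t+1}. \<forall>y. \<bar>y\<bar> \<le> Y \<longrightarrow> norm (expsum T c (Complex r y)) \<le> C * norm (expsum T d (Complex r y)) \<and>
       expsum T d (Complex r y) \<noteq> 0" for t
  proof -
    obtain r where r: "r \<in> {t..t+1}" "\<And>y. \<bar>y\<bar> \<le> Y \<Longrightarrow> norm (expsum T d (Complex r y)) \<ge> \<epsilon>" using \<epsilon>(2) by blast
    have "norm (expsum T c (Complex r y)) \<le> C * norm (expsum T d (Complex r y)) \<and> expsum T d (Complex r y) \<noteq> 0"
      if y: "\<bar>y\<bar> \<le> Y" for y
    proof -
      have "norm (expsum T c (Complex r y)) \<le> S * exp (\<omega> * max 0 (- y))" using bd[of "Complex r y"] by simp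
      also have "\<dots> \<le> S * exp (\<omega> * Y)" using S \<omega> y by (intro mult_left_mono) (auto intro!: mult_left_mono)
      also have "\<dots> = (S * exp (\<omega> * Y) / \<epsilon>) * \<epsilon>" using \<epsilon>(1) by simp
      also have "\<dots> \<le> C * norm (expsum T d (Complex r y))"
        using C \<epsilon>(1) r(2)[OF y] \<open>C > 0\<close> by (intro mult_mono) auto
      finally show ?thesis using r(2)[OF y] \<epsilon>(1) by auto
    qed
    then show ?thesis using r(1) by blast
  qed
  ultimately show ?thesis using Y(1) by blast
qed

text \<open>
  The orders at 0 may differ, so both sums are multiplied by powers of the variable that make them equal. The quotient is
  then entire without zeros, and by the maximum principle on the rectangles of the previous lemma it grows
  at most polynomially. Hence it is constant. The behaviour along the imaginary axis shows that the two powers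
  agree and that the constant is 1.
\<close>

lemma expsum_eq_of_orders:
  assumes T: "finite T" "T \<subseteq> {0..\<omega>}" "0 \<in> T" "\<omega> \<in> T" and c: "c 0 = 1" and d: "d 0 = 1" "d \<omega> \<noteq> 0"
    and ord: "\<And>z. z \<noteq> 0 \<Longrightarrow> \<exists>n. has_order (expsum T c) z n \<and> has_order (expsum T d) z n"
    and ord0: "has_order (expsum T c) 0 a" "has_order (expsum T d) 0 b"
    and z: "z \<noteq> 0"
  shows "expsum T c z = expsum T d z"
proof -
  let ?P = "expsum T c" and ?Q = "expsum T d"
  have "\<exists>n. has_order (\<lambda>w. w ^ b * ?P w) z n \<and> has_order (\<lambda>w. w ^ a * ?Q w) z n" for z
  proof (cases "z = 0")
    case True
    then show ?thesis using ord0[THEN has_order_times_power_0] by (metis add.commute)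
  next
    case False
    then show ?thesis using ord has_order_times_power by meson
  qed
  from entire_quotient[OF this] obtain R where R: "R holomorphic_on UNIV" "\<And>z. R z \<noteq> 0"
    "\<And>z. z ^ b * ?P z = R z * (z ^ a * ?Q z)" by blast
  from expsum_ratio_bound[of T \<omega> c d, OF T c d] obtain C Y where Y: "Y > 0" and C: "C > 0"
    and hor: "\<And>k. \<bar>Im k\<bar> \<ge> Y \<Longrightarrow> norm (?P k) \<le> C * norm (?Q k) \<and> ?Q k \<noteq> 0"
    and ver: "\<And>t. \<exists>r\<in>{t..t+1}. \<forall>y. \<bar>y\<bar> \<le> Y \<longrightarrow> norm (?P (Complex r y)) \<le> C * norm (?Q (Complex r y)) \<and> ?Q (Complex r y) \<noteq> 0"
    by blast
  have good: "norm (R k) \<le> C * norm k ^ b" if k: "norm k \<ge> 1" "norm (?P k) \<le> C * norm (?Q k)" "?Q k \<noteq> 0" for k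
  proof -
    have "norm (R k) * norm (?Q k) \<le> norm (R k) * norm (?Q k) * norm k ^ a"
      using mult_left_mono[OF one_le_power[OF k(1), of a], of "norm (R k) * norm (?Q k)"] by simp
    also have "\<dots> = norm k ^ b * norm (?P k)"
      using arg_cong[OF R(3)[of k], of norm] by (simp add: norm_mult norm_power mult_ac)
    also have "\<dots> \<le> norm k ^ b * (C * norm (?Q k))" using k by (intro mult_left_mono) auto
    finally have "norm (R k) * norm (?Q k) \<le> (C * norm k ^ b) * norm (?Q k)" by (simp add: mult_ac)
    then show ?thesis using k(3) by simp
  qed
  have "norm (R k) \<le> (C * 2 ^ b) * norm k ^ b" if k: "norm k \<ge> 2 * Y + 4" for k
  proof (cases "\<bar>Im k\<bar> \<ge> Y")
    case True
    have "C * norm k ^ b \<le> (C * 2 ^ b) * norm k ^ b" using C by (intro mult_right_mono) auto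
    then show ?thesis using good[of k] hor[OF True] k Y by linarith
  next
    case False
    obtain r1 where r1: "r1 \<in> {Re k - 1..Re k}"
      "\<And>y. \<bar>y\<bar> \<le> Y \<Longrightarrow> norm (?P (Complex r1 y)) \<le> C * norm (?Q (Complex r1 y)) \<and> ?Q (Complex r1 y) \<noteq> 0"
      using ver[of "Re k - 1"] by auto
    obtain r2 where r2: "r2 \<in> {Re k..Re k + 1}"
      "\<And>y. \<bar>y\<bar> \<le> Y \<Longrightarrow> norm (?P (Complex r2 y)) \<le> C * norm (?Q (Complex r2 y)) \<and> ?Q (Complex r2 y) \<noteq> 0"
      using ver[of "Re k"] by auto
    let ?S = "cbox (Complex r1 (-Y)) (Complex r2 Y)"
    have dist: "norm (w - k) \<le> 1 + 2 * Y" if "w \<in> ?S" for w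
      using cmod_le[of "w - k"] that r1(1) r2(1) False by (auto simp: in_cbox_complex_iff)
    show ?thesis
    proof (rule maximum_modulus_frontier[of R ?S])
      fix w assume w: "w \<in> frontier ?S"
      then have wS: "w \<in> ?S" using frontier_subset_closed[OF closed_cbox] by blast
      have "w \<notin> box (Complex r1 (-Y)) (Complex r2 Y)" using w by (simp add: frontier_def)
      then have "Re w = r1 \<or> Re w = r2 \<or> Im w = Y \<or> Im w = - Y"
        using wS by (auto simp: in_cbox_complex_iff in_box_complex_iff)
      moreover have "\<bar>Im w\<bar> \<le> Y" using wS by (auto simp: in_cbox_complex_iff abs_le_iff)
      ultimately have *: "norm (?P w) \<le> C * norm (?Q w) \<and> ?Q w \<noteq> 0"
        using hor[of w] r1(2)[of "Im w"] r2(2)[of "Im w"] by (metis abs_of_pos abs_minus_cancel complex.collapse Y order_refl)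
      have "norm w \<ge> norm k - norm (w - k)" using norm_triangle_ineq2[of k w] by (smt (verit) norm_minus_commute norm_triangle_ineq3 norm_triangle_sub)
      moreover have "norm w \<le> norm k + norm (w - k)" by (metis norm_triangle_sub)
      ultimately have nw: "norm w \<ge> 1" "norm w \<le> 2 * norm k" using dist[OF wS] k Y by linarith+
      have "norm (R w) \<le> C * norm w ^ b" using good[of w] nw * by blast
      also have "\<dots> \<le> C * (2 * norm k) ^ b" using C nw by (intro mult_left_mono power_mono) auto
      finally show "norm (R w) \<le> (C * 2 ^ b) * norm k ^ b" by (simp add: power_mult_distrib)
    next
      show "k \<in> ?S" using r1(1) r2(1) False by (auto simp: in_cbox_complex_iff)
    qed (use R(1) in \<open>auto intro: holomorphic_on_subset holomorphic_on_imp_continuous_on continuous_on_subset\<close>)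
  qed
  from zero_free_polynomial_growth_imp_constant[OF R(1,2) this]
  obtain q where q: "q \<noteq> 0" "\<And>z. R z = q" by blast
  have eq: "z ^ b * ?P z = q * (z ^ a * ?Q z)" for z using R(3)[of z] q(2) by simp
  have T0: "T \<subseteq> {0..}" using T by auto
  note lim = expsum_tendsto_1[of T c, OF T(1) T0 T(3) c] expsum_tendsto_1[of T d, OF T(1) T0 T(3) d(1)]
  consider "a = b" | m where "b = a + Suc m" | m where "a = b + Suc m"
    by (metis less_iff_Suc_add add_Suc_right linorder_less_linear)
  then show ?thesis
  proof cases
    case 1
    then have PQ: "?P z = q * ?Q z" if "z \<noteq> 0" for z using eq[of z] that by simp
    have "eventually (\<lambda>y. q * ?Q (Complex 0 y) = ?P (Complex 0 y)) at_top"
      using eventually_gt_at_top[of "0::real"] by eventually_elim (simp add: PQ complex_eq_iff)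
    moreover have "((\<lambda>y. q * ?Q (Complex 0 y)) \<longlongrightarrow> q * 1) at_top" by (intro tendsto_intros lim)
    ultimately have "((\<lambda>y. ?P (Complex 0 y)) \<longlongrightarrow> q * 1) at_top" by (simp add: tendsto_cong)
    then have "q = 1" using tendsto_unique[OF _ lim(1)] by fastforce
    then show ?thesis using PQ z by simp
  next
    case (2 m)
    have "k ^ Suc m * ?P k = q * ?Q k" if "k \<noteq> 0" for k
      using eq[of k] that 2 by (simp add: power_add mult_ac)
    from power_dominates_bounded[OF lim this] show ?thesis by simp
  next
    case (3 m)
    have "k ^ Suc m * ?Q k = (1 / q) * ?P k" if "k \<noteq> 0" for k
      using eq[of k] that 3 q by (simp add: power_add field_simps)
    from power_dominates_bounded[OF lim(2,1) this] show ?thesis by simp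
  qed
qed

text \<open>
  The open right half plane is closed under addition and leaves out the point 0, where the two sums are not
  assumed to agree.
\<close>

lemma exponentials_independent:
  assumes "finite T" and eq: "\<And>z. z \<noteq> 0 \<Longrightarrow> expsum T c z = expsum T d z" and "l \<in> T"
  shows "c l = d l"
proof -
  have "\<forall>l\<in>T. c l - d l = 0"
  proof (rule characters_independent[where X = "{z. Re z > 0}" and \<kappa> = "\<lambda>l z. exp (\<i> * of_real l * z)"])
    fix i j :: real assume "i \<noteq> j"
    then have "exp (\<i> * of_real i * (1 + \<i>)) \<noteq> exp (\<i> * of_real j * (1 + \<i>))"
      using norm_exp_i_times[of i "1 + \<i>"] norm_exp_i_times[of j "1 + \<i>"] by force
    then show "\<exists>z\<in>{z. Re z > 0}. exp (\<i> * of_real i * z) \<noteq> exp (\<i> * of_real j * z)"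
      by (intro bexI[of _ "1 + \<i>"]) auto
  next
    fix z :: complex assume "z \<in> {z. Re z > 0}"
    then have "expsum T c z = expsum T d z" by (intro eq) auto
    then show "(\<Sum>l\<in>T. (c l - d l) * exp (\<i> * of_real l * z)) = 0"
      by (simp add: expsum_def left_diff_distrib sum_subtractf)
  qed (use \<open>finite T\<close> in \<open>auto simp: algebra_simps exp_add intro!: exI[of _ 1]\<close>)
  then show ?thesis using \<open>l \<in> T\<close> by simp
qed

text \<open>
  The two sums play symmetric roles, so the one with the higher top frequency may be taken as the denominator
  of the quotient. This choice keeps the quotient bounded in the lower half plane.
\<close>

theorem expsum_determined_by_zeros:
  assumes T: "finite T" "T \<subseteq> {0..}" "0 \<in> T" and c: "c 0 = 1" and d: "d 0 = 1"
    and ord: "\<And>z. z \<noteq> 0 \<Longrightarrow> \<exists>n. has_order (expsum T c) z n \<and> has_order (expsum T d) z n"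
    and ord0: "\<exists>a. has_order (expsum T c) 0 a" "\<exists>b. has_order (expsum T d) 0 b"
    and l: "l \<in> T"
  shows "c l = d l"
proof -
  have main: "\<forall>l\<in>T. c l = d l"
    if cd: "c 0 = 1" "d 0 = 1" and le: "Max {l\<in>T. c l \<noteq> 0} \<le> Max {l\<in>T. d l \<noteq> 0}"
      and ord: "\<And>z. z \<noteq> 0 \<Longrightarrow> \<exists>n. has_order (expsum T c) z n \<and> has_order (expsum T d) z n"
      and ord0: "\<exists>a. has_order (expsum T c) 0 a" "\<exists>b. has_order (expsum T d) 0 b" for c d
  proof -
    define \<omega> where "\<omega> = Max {l\<in>T. d l \<noteq> 0}"
    have "{l\<in>T. d l \<noteq> 0} \<noteq> {}" using T(3) cd by force
    then have \<omega>: "\<omega> \<in> T" "d \<omega> \<noteq> 0" using Max_in[of "{l\<in>T. d l \<noteq> 0}"] T(1) by (auto simp: \<omega>_def)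
    have dz: "d l = 0" if "l \<in> T" "l > \<omega>" for l
    proof (rule ccontr)
      assume "d l \<noteq> 0"
      then have "l \<le> Max {l\<in>T. d l \<noteq> 0}" using T(1) that by (intro Max_ge) auto
      then show False using that by (simp add: \<omega>_def)
    qed
    have cz: "c l = 0" if "l \<in> T" "l > \<omega>" for l
    proof (rule ccontr)
      assume "c l \<noteq> 0"
      then have "l \<le> Max {l\<in>T. c l \<noteq> 0}" using T(1) that by (intro Max_ge) auto
      then show False using that le by (simp add: \<omega>_def)
    qed
    define T' where "T' = T \<inter> {0..\<omega>}"
    have T': "finite T'" "T' \<subseteq> {0..\<omega>}" "0 \<in> T'" "\<omega> \<in> T'" using T \<omega> by (auto simp: T'_def)
    have out: "c l = 0 \<and> d l = 0" if "l \<in> T - T'" for l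
      using that T(2) cz[of l] dz[of l] by (force simp: T'_def)
    have ec: "expsum T c = expsum T' c"
      unfolding expsum_def[abs_def] using T(1) out
      by (intro ext sum.mono_neutral_right) (auto simp: T'_def)
    have ed: "expsum T d = expsum T' d"
      unfolding expsum_def[abs_def] using T(1) out
      by (intro ext sum.mono_neutral_right) (auto simp: T'_def)
    obtain a b where ab: "has_order (expsum T' c) 0 a" "has_order (expsum T' d) 0 b"
      using ord0 by (auto simp: ec ed)
    have eq: "expsum T' c z = expsum T' d z" if z: "z \<noteq> 0" for z
      by (rule expsum_eq_of_orders[of T' \<omega> c d a b z, OF T' cd \<omega>(2) ord[unfolded ec ed] ab z])
    have "\<forall>l\<in>T'. c l = d l"
      by (intro ballI exponentials_independent[OF T'(1), of c d] eq) auto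
    moreover have "c l = d l" if "l \<in> T - T'" for l
      using out[OF that] by simp
    ultimately show ?thesis by blast
  qed
  show ?thesis
  proof (cases "Max {l\<in>T. c l \<noteq> 0} \<le> Max {l\<in>T. d l \<noteq> 0}")
    case True
    from main[of c d, OF c d True ord ord0] l show ?thesis by blast
  next
    case False
    then have "Max {l\<in>T. d l \<noteq> 0} \<le> Max {l\<in>T. c l \<noteq> 0}" by simp
    from main[of d c, OF d c this] ord ord0 l show ?thesis by metis
  qed
qed

section \<open>Zeros of determinants\<close>

text \<open>
  The determinant of a matrix whose rows and columns are indexed by a finite set \<open>B\<close>. The matrices below are indexed
  by directed edges, which have no preferred order.
\<close>

definition fdet :: "'b set \<Rightarrow> ('b \<Rightarrow> 'b \<Rightarrow> 'a::comm_ring_1) \<Rightarrow> 'a" where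
  "fdet B M = (\<Sum>p | p permutes B. of_int (sign p) * (\<Prod>b\<in>B. M b (p b)))"

lemma det_eq_fdet:
  assumes \<beta>: "bij_betw \<beta> {0..<n} B"
  shows "Determinant.det (Matrix.mat n n (\<lambda>(i, j). M (\<beta> i) (\<beta> j))) = fdet B M"
proof -
  let ?A = "Matrix.mat n n (\<lambda>(i, j). M (\<beta> i) (\<beta> j))"
  let ?h = "map_permutation {0..<n} \<beta>"
  have inj: "inj_on \<beta> {0..<n}" using \<beta> by (rule bij_betw_imp_inj_on)
  have "Determinant.det ?A = (\<Sum>p | p permutes {0..<n}. of_int (sign p) * (\<Prod>i = 0..<n. M (\<beta> i) (\<beta> (p i))))"
    unfolding Determinant.det_def
    by (auto intro!: sum.cong prod.cong simp: permutes_in_image)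
  also have "\<dots> = (\<Sum>p | p permutes {0..<n}. of_int (sign (?h p)) * (\<Prod>b\<in>B. M b (?h p b)))"
  proof (intro sum.cong refl)
    fix p assume "p \<in> {p. p permutes {0..<n}}"
    then have p: "p permutes {0..<n}" by simp
    have "(\<Prod>b\<in>B. M b (?h p b)) = (\<Prod>i = 0..<n. M (\<beta> i) (?h p (\<beta> i)))"
      by (rule prod.reindex_bij_betw[OF \<beta>, symmetric])
    also have "\<dots> = (\<Prod>i = 0..<n. M (\<beta> i) (\<beta> (p i)))"
      by (intro prod.cong refl) (simp add: map_permutation_apply inj)
    finally show "of_int (sign p) * (\<Prod>i = 0..<n. M (\<beta> i) (\<beta> (p i))) =
        of_int (sign (?h p)) * (\<Prod>b\<in>B. M b (?h p b))"
      by (simp add: sign_map_permutation[OF inj p])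
  qed
  also have "\<dots> = fdet B M"
    unfolding fdet_def
  proof (rule sum.reindex_bij_witness[where i = "map_permutation B (inv_into {0..<n} \<beta>)" and j = ?h])
    fix p assume "p \<in> {p. p permutes {0..<n}}"
    then have p: "p permutes {0..<n}" by simp
    show "?h p \<in> {p. p permutes B}" using map_permutation_permutes[OF \<beta> p] by simp
    show "map_permutation B (inv_into {0..<n} \<beta>) (?h p) = p"
      using \<beta> p by (subst map_permutation_compose_inv[where B = B])
        (auto simp: bij_betw_def inj_on_inv_into)
  next
    fix q assume "q \<in> {q. q permutes B}"
    then have q: "q permutes B" by simp
    show "map_permutation B (inv_into {0..<n} \<beta>) q \<in> {p. p permutes {0..<n}}"
      using map_permutation_permutes[OF bij_betw_inv_into[OF \<beta>] q] by simp
    show "?h (map_permutation B (inv_into {0..<n} \<beta>) q) = q"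
      using bij_betw_inv_into[OF \<beta>] q \<beta>
      by (subst map_permutation_compose_inv[where B = "{0..<n}"])
        (auto simp: bij_betw_def inj f_inv_into_f)
  qed auto
  finally show ?thesis .
qed

lemma fdet_mult:
  assumes "finite B"
  shows "fdet B (\<lambda>b c. \<Sum>l\<in>B. A b l * C l c) = fdet B A * fdet B (C :: 'b \<Rightarrow> 'b \<Rightarrow> complex)"
proof -
  obtain \<beta> where \<beta>: "bij_betw \<beta> {0..<card B} B"
    using ex_bij_betw_nat_finite[OF assms] by blast
  let ?n = "card B"
  let ?m = "\<lambda>M. Matrix.mat ?n ?n (\<lambda>(i, j). M (\<beta> i) (\<beta> j)) :: complex mat"
  have "?m (\<lambda>b c. \<Sum>l\<in>B. A b l * C l c) = ?m A * ?m C"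
    by (rule eq_matI)
       (auto simp: scalar_prod_def sum.reindex_bij_betw[OF \<beta>, symmetric])
  then show ?thesis
    unfolding det_eq_fdet[OF \<beta>, symmetric] by (simp add: det_mult[of _ ?n])
qed

lemma fdet_eq_0_iff:
  assumes "finite B"
  shows "fdet B A = (0::complex) \<longleftrightarrow> (\<exists>v. (\<exists>c\<in>B. v c \<noteq> 0) \<and> (\<forall>b\<in>B. (\<Sum>c\<in>B. A b c * v c) = 0))"
proof -
  obtain \<beta> where \<beta>: "bij_betw \<beta> {0..<card B} B"
    using ex_bij_betw_nat_finite[OF assms] by blast
  let ?n = "card B"
  let ?m = "Matrix.mat ?n ?n (\<lambda>(i, j). A (\<beta> i) (\<beta> j))"
  have B: "\<exists>i<?n. b = \<beta> i" if "b \<in> B" for b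
    using \<beta> that by (metis bij_betw_def imageE atLeastLessThan_iff)
  have \<beta>B: "\<beta> i \<in> B" if "i < ?n" for i
    using \<beta> that bij_betwE by fastforce
  have inj: "inj_on \<beta> {0..<?n}" using \<beta> by (rule bij_betw_imp_inj_on)
  have *: "vec_index (?m *\<^sub>v w) i = (\<Sum>j = 0..<?n. A (\<beta> i) (\<beta> j) * vec_index w j)"
    if "i < ?n" "w \<in> carrier_vec ?n" for i w
    using that by (auto simp: scalar_prod_def)
  have sumB: "(\<Sum>c\<in>B. g c) = (\<Sum>j = 0..<?n. g (\<beta> j))" for g :: "'a \<Rightarrow> complex"
    by (rule sum.reindex_bij_betw[OF \<beta>, symmetric])
  have "fdet B A = 0 \<longleftrightarrow> (\<exists>w. w \<in> carrier_vec ?n \<and> w \<noteq> 0\<^sub>v ?n \<and> ?m *\<^sub>v w = 0\<^sub>v ?n)"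
    unfolding det_eq_fdet[OF \<beta>, symmetric] by (rule det_0_iff_vec_prod_zero_field) simp
  also have "\<dots> \<longleftrightarrow> (\<exists>v. (\<exists>c\<in>B. v c \<noteq> 0) \<and> (\<forall>b\<in>B. (\<Sum>c\<in>B. A b c * v c) = 0))"
  proof (intro iffI; elim exE conjE)
    fix w :: "complex Matrix.vec" assume w: "w \<in> carrier_vec ?n" "w \<noteq> 0\<^sub>v ?n" "?m *\<^sub>v w = 0\<^sub>v ?n"
    define v where "v c = vec_index w (inv_into {0..<?n} \<beta> c)" for c
    have v: "v (\<beta> j) = vec_index w j" if "j < ?n" for j using that inj by (simp add: v_def)
    obtain j where j: "j < ?n" "vec_index w j \<noteq> 0" using w(1,2) by (metis carrier_vecD eq_vecI index_zero_vec)
    have "\<exists>c\<in>B. v c \<noteq> 0" using j v[OF j(1)] \<beta>B by (intro bexI[of _ "\<beta> j"]) auto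
    moreover have "(\<Sum>c\<in>B. A b c * v c) = 0" if b: "b \<in> B" for b
    proof -
      obtain i where i: "i < ?n" "b = \<beta> i" using B[OF b] by blast
      show ?thesis using *[OF i(1) w(1)] w(3) i by (simp add: sumB v)
    qed
    ultimately show "\<exists>v. (\<exists>c\<in>B. v c \<noteq> 0) \<and> (\<forall>b\<in>B. (\<Sum>c\<in>B. A b c * v c) = 0)" by blast
  next
    fix v assume v: "\<exists>c\<in>B. v c \<noteq> 0" "\<forall>b\<in>B. (\<Sum>c\<in>B. A b c * v c) = 0"
    let ?w = "Matrix.vec ?n (\<lambda>j. v (\<beta> j))"
    obtain j where j: "j < ?n" "v (\<beta> j) \<noteq> 0" using v(1) B by blast
    have "?w \<noteq> 0\<^sub>v ?n" using j by (metis index_vec index_zero_vec(1))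
    moreover have "?m *\<^sub>v ?w = 0\<^sub>v ?n"
    proof (rule eq_vecI)
      fix i assume "i < dim_vec (0\<^sub>v ?n)"
      then have i: "i < ?n" by simp
      then have "\<beta> i \<in> B" by (rule \<beta>B)
      then show "vec_index (?m *\<^sub>v ?w) i = vec_index (0\<^sub>v ?n) i"
        using v(2) i by (subst *) (auto simp: sumB)
    qed auto
    ultimately show "\<exists>w. w \<in> carrier_vec ?n \<and> w \<noteq> 0\<^sub>v ?n \<and> ?m *\<^sub>v w = 0\<^sub>v ?n" by (intro exI[of _ ?w]) auto
  qed
  finally show ?thesis .
qed

lemma fdet_scale_columns:
  assumes "finite B"
  shows "fdet B (\<lambda>b c. A b c * s c) = (\<Prod>c\<in>B. s c) * fdet B A"
proof -
  have "(\<Prod>b\<in>B. A b (p b) * s (p b)) = (\<Prod>c\<in>B. s c) * (\<Prod>b\<in>B. A b (p b))" if "p permutes B" for p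
    using prod.permute[OF that, of s] by (simp add: prod.distrib o_def mult.commute)
  then show ?thesis unfolding fdet_def sum_distrib_left by (intro sum.cong) (auto simp: mult_ac)
qed

global_interpretation vfun: vector_space "\<lambda>(c::complex) (f :: 'b \<Rightarrow> complex) x. c * f x"
  by unfold_locales (auto simp: fun_eq_iff algebra_simps)

lemma sum_fun_apply: "(\<Sum>a\<in>A. f a) x = (\<Sum>a\<in>A. f a x)" for f :: "'a \<Rightarrow> 'b \<Rightarrow> 'c::comm_monoid_add"
  by (induction A rule: infinite_finite_induct) auto

lemma supported_functions_basis:
  assumes "finite B"
  defines "V \<equiv> {x :: 'b \<Rightarrow> complex. \<forall>c. c \<notin> B \<longrightarrow> x c = 0}"
  shows "vfun.dim V = card B" and "\<And>S. S \<subseteq> V \<Longrightarrow> vfun.independent S \<Longrightarrow> finite S"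
proof -
  define e :: "'b \<Rightarrow> 'b \<Rightarrow> complex" where "e c = (\<lambda>b. if b = c then 1 else 0)" for c
  have e_app: "e c b = (if b = c then 1 else 0)" for b c by (simp add: e_def)
  have "c = c'" if "e c = e c'" for c c'
    using fun_cong[OF that, of c] by (simp add: e_def split: if_splits)
  then have inj: "inj_on e B" by (auto simp: inj_on_def)
  have ex: "(\<Sum>c\<in>B. x c * e c b) = x b" if "x \<in> V" for x b
    using that \<open>finite B\<close> by (auto simp: e_def V_def if_distrib cong: if_cong)
  have "V \<subseteq> vfun.span (e ` B)"
  proof
    fix x assume "x \<in> V"
    then have x: "x = (\<Sum>c\<in>B. (\<lambda>b. x c * e c b))"
      by (intro ext) (simp add: sum_fun_apply ex)
    show "x \<in> vfun.span (e ` B)"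
      by (subst x) (intro vfun.span_sum vfun.span_scale vfun.span_base imageI)
  qed
  moreover have "vfun.independent (e ` B)"
  proof (rule vfun.independent_if_scalars_zero)
    show "finite (e ` B)" using \<open>finite B\<close> by simp
    fix f x assume "(\<Sum>x\<in>e ` B. (\<lambda>b. f x * x b)) = 0" and x: "x \<in> e ` B"
    then have "(\<Sum>c\<in>B. (\<lambda>b. f (e c) * e c b)) = 0"
      by (simp add: sum.reindex[OF inj] o_def)
    from fun_cong[OF this] have "(\<Sum>c\<in>B. f (e c) * e c b) = 0" for b by (simp add: sum_fun_apply)
    moreover have "(\<Sum>c\<in>B. f (e c) * e c b) = (\<Sum>c\<in>B. if b = c then f (e c) else 0)" for b
      by (intro sum.cong refl) (simp add: e_app)
    moreover have "(\<Sum>c\<in>B. if b = c then f (e c) else 0) = f (e b)" if "b \<in> B" for b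
      using that \<open>finite B\<close> by simp
    ultimately have "f (e b) = 0" if "b \<in> B" for b
      using that by simp
    then show "f x = 0" using x by blast
  qed
  moreover have "e ` B \<subseteq> V" by (auto simp: e_def V_def)
  moreover have "card (e ` B) = card B" using inj by (rule card_image)
  ultimately show "vfun.dim V = card B" using vfun.dim_unique[of "e ` B" V] by blast
  fix S assume "S \<subseteq> V" "vfun.independent S"
  then show "finite S"
    using vfun.independent_span_bound[of "e ` B" S] \<open>V \<subseteq> vfun.span (e ` B)\<close> \<open>finite B\<close> by auto
qed

text \<open>
  After a change of basis the first columns of the matrix belong to a basis of the kernel at \<open>k0\<close>. Each of
  them vanishes at \<open>k0\<close>, so each splits off a factor \<open>k - k0\<close>. What remains has at \<open>k0\<close> the columns \<open>M' x\<close> for \<open>x\<close> in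
  the basis of the kernel and \<open>M y\<close> for the other basis vectors. A linear relation between these columns is what \<open>nondeg\<close>
  excludes, so the remaining determinant does not vanish at \<open>k0\<close>.
\<close>

theorem has_order_fdet:
  fixes M :: "complex \<Rightarrow> 'b \<Rightarrow> 'b \<Rightarrow> complex"
  assumes fin: "finite B"
    and hol: "\<And>b c. b \<in> B \<Longrightarrow> c \<in> B \<Longrightarrow> (\<lambda>k. M k b c) holomorphic_on UNIV"
    and nondeg: "\<And>x y. (\<forall>b\<in>B. (\<Sum>c\<in>B. M k0 b c * x c) = 0) \<Longrightarrow>
      (\<forall>b\<in>B. (\<Sum>c\<in>B. deriv (\<lambda>k. M k b c) k0 * x c) = (\<Sum>c\<in>B. M k0 b c * y c)) \<Longrightarrow> \<forall>c\<in>B. x c = 0"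
  shows "has_order (\<lambda>k. fdet B (M k)) k0
    (vfun.dim {x. (\<forall>c. c \<notin> B \<longrightarrow> x c = 0) \<and> (\<forall>b\<in>B. (\<Sum>c\<in>B. M k0 b c * x c) = 0)})"
proof -
  define V where "V = {x :: 'b \<Rightarrow> complex. \<forall>c. c \<notin> B \<longrightarrow> x c = 0}"
  define K where "K = {x. (\<forall>c. c \<notin> B \<longrightarrow> x c = 0) \<and> (\<forall>b\<in>B. (\<Sum>c\<in>B. M k0 b c * x c) = 0)}"
  obtain S where S: "S \<subseteq> K" "vfun.independent S" "K \<subseteq> vfun.span S" "card S = vfun.dim K"
    using vfun.basis_exists by blast
  have "S \<subseteq> V" using S(1) by (auto simp: K_def V_def)
  obtain W where W: "S \<subseteq> W" "W \<subseteq> V" "vfun.independent W" "V \<subseteq> vfun.span W"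
    using vfun.maximal_independent_subset_extend[OF \<open>S \<subseteq> V\<close> S(2)] by blast
  have finW: "finite W" using supported_functions_basis(2)[OF fin] W(2,3) by (auto simp: V_def)
  have "card W = card B"
    using vfun.basis_card_eq_dim[OF W(2,4,3)] supported_functions_basis(1)[OF fin] by (simp add: V_def)
  then obtain \<gamma> where \<gamma>: "bij_betw \<gamma> B W" using finite_same_card_bij[OF fin finW] by metis
  have \<gamma>W: "\<gamma> c \<in> W" if "c \<in> B" for c using \<gamma> that bij_betwE by blast
  have indep: "v c = 0" if "\<forall>b\<in>B. (\<Sum>c\<in>B. v c * \<gamma> c b) = 0" "c \<in> B" for v c
  proof -
    define u where "u w = v (inv_into B \<gamma> w)" for w
    have u: "u (\<gamma> c) = v c" if "c \<in> B" for c
      using that \<gamma> by (simp add: u_def bij_betw_inv_into_left)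
    have "(\<Sum>w\<in>W. u w * w b) = 0" for b
    proof -
      have "(\<Sum>w\<in>W. u w * w b) = (\<Sum>c\<in>B. u (\<gamma> c) * \<gamma> c b)"
        by (rule sum.reindex_bij_betw[OF \<gamma>, symmetric])
      also have "\<dots> = (\<Sum>c\<in>B. v c * \<gamma> c b)" by (intro sum.cong) (auto simp: u)
      also have "\<dots> = 0"
      proof (cases "b \<in> B")
        case False
        then have "\<gamma> c b = 0" if "c \<in> B" for c using \<gamma>W[OF that] W(2) by (auto simp: V_def)
        then show ?thesis by simp
      qed (use that in auto)
      finally show ?thesis .
    qed
    then have "(\<Sum>w\<in>W. (\<lambda>b. u w * w b)) = 0" by (auto simp: fun_eq_iff sum_fun_apply)
    from vfun.independentD[OF W(3) finW order_refl this \<gamma>W[OF that(2)]] show ?thesis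
      using u[OF that(2)] by simp
  qed
  define P where "P b c = \<gamma> c b" for b c
  have P: "fdet B P \<noteq> 0"
  proof
    assume "fdet B P = 0"
    then obtain v where v: "\<exists>c\<in>B. v c \<noteq> 0" "\<forall>b\<in>B. (\<Sum>c\<in>B. \<gamma> c b * v c) = 0"
      unfolding fdet_eq_0_iff[OF fin] P_def by blast
    from v(2) have "\<forall>b\<in>B. (\<Sum>c\<in>B. v c * \<gamma> c b) = 0" by (simp add: mult.commute)
    from indep[OF this] v(1) show False by blast
  qed
  define F where "F b c k = (\<Sum>l\<in>B. M k b l * \<gamma> c l)" for b c k
  have F_hol: "F b c holomorphic_on UNIV" if "b \<in> B" for b c
    unfolding F_def[abs_def] using hol that by (intro holomorphic_intros) auto
  have dF: "deriv (F b c) k0 = (\<Sum>l\<in>B. deriv (\<lambda>k. M k b l) k0 * \<gamma> c l)" if "b \<in> B" for b c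
  proof (rule DERIV_imp_deriv)
    have "((\<lambda>k. M k b l) has_field_derivative deriv (\<lambda>k. M k b l) k0) (at k0)" if "l \<in> B" for l
      using hol[OF \<open>b \<in> B\<close> that] by (intro holomorphic_derivI[where S = UNIV]) auto
    then show "(F b c has_field_derivative (\<Sum>l\<in>B. deriv (\<lambda>k. M k b l) k0 * \<gamma> c l)) (at k0)"
      unfolding F_def[abs_def] by (auto intro!: derivative_eq_intros sum.cong)
  qed
  \<comment> \<open>In the columns of the kernel the difference quotient removes the zero at \<open>k0\<close>, with the derivative as its value there.\<close>
  define N where "N k b c = (if \<gamma> c \<in> S then (if k = k0 then deriv (F b c) k0 else (F b c k - F b c k0) / (k - k0)) else F b c k)" for k b c
  have N_hol: "(\<lambda>k. N k b c) holomorphic_on UNIV" if "b \<in> B" for b c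
    using F_hol[OF that] by (cases "\<gamma> c \<in> S") (auto simp: N_def[abs_def] intro: pole_lemma_open)
  define s where "s k c = (if \<gamma> c \<in> S then k - k0 else 1)" for k c
  have FN: "F b c k = N k b c * s k c" if "b \<in> B" "c \<in> B" for b c k
  proof (cases "\<gamma> c \<in> S")
    case True
    then have "F b c k0 = 0" using S(1) that by (auto simp: F_def K_def)
    then show ?thesis using True by (auto simp: N_def s_def)
  qed (auto simp: N_def s_def)
  have "fdet B (M k) * fdet B P = (\<Prod>c\<in>B. s k c) * fdet B (N k)" for k
  proof -
    have "fdet B (M k) * fdet B P = fdet B (\<lambda>b c. F b c k)"
      unfolding fdet_mult[OF fin, symmetric] by (simp add: F_def P_def)
    also have "\<dots> = fdet B (\<lambda>b c. N k b c * s k c)"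
      unfolding fdet_def using FN permutes_in_image by (intro sum.cong prod.cong arg_cong2[where f = "(*)"] refl) fastforce
    finally show ?thesis by (simp add: fdet_scale_columns[OF fin])
  qed
  moreover have "(\<Prod>c\<in>B. s k c) = (k - k0) ^ vfun.dim K" for k
  proof -
    have "(\<Prod>c\<in>B. s k c) = (\<Prod>w\<in>W. if w \<in> S then k - k0 else 1)"
      unfolding s_def by (rule prod.reindex_bij_betw[OF \<gamma>])
    also have "\<dots> = (\<Prod>w\<in>S. k - k0)" using finW W(1) by (simp add: prod.If_cases Int_absorb1)
    finally show ?thesis by (simp add: S(4))
  qed
  ultimately have eq: "fdet B (M k) = (k - k0) ^ vfun.dim K * (fdet B (N k) / fdet B P)" for k
    using P by (simp add: nonzero_eq_divide_eq)
  have "fdet B (N k0) \<noteq> 0"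
  proof
    assume "fdet B (N k0) = 0"
    then obtain v where v: "\<exists>c\<in>B. v c \<noteq> 0" "\<And>b. b \<in> B \<Longrightarrow> (\<Sum>c\<in>B. N k0 b c * v c) = 0"
      unfolding fdet_eq_0_iff[OF fin] by blast
    let ?B1 = "{c\<in>B. \<gamma> c \<in> S}" and ?B2 = "{c\<in>B. \<gamma> c \<notin> S}"
    define x where "x l = (\<Sum>c\<in>?B1. v c * \<gamma> c l)" for l
    define y where "y l = (\<Sum>c\<in>?B2. v c * \<gamma> c l)" for l
    have xK: "(\<Sum>c\<in>B. M k0 b c * x c) = 0" if "b \<in> B" for b
    proof -
      have "(\<Sum>l\<in>B. M k0 b l * x l) = (\<Sum>c\<in>?B1. v c * (\<Sum>l\<in>B. M k0 b l * \<gamma> c l))"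
        unfolding x_def sum_distrib_left by (subst sum.swap) (simp add: mult_ac)
      also have "\<dots> = 0" using S(1) that by (intro sum.neutral) (auto simp: K_def)
      finally show ?thesis .
    qed
    have split: "sum g B = sum g ?B1 + sum g ?B2" for g :: "'b \<Rightarrow> complex"
      using fin by (subst sum.union_disjoint[symmetric]) (auto intro!: sum.cong)
    have eqxy: "(\<Sum>l\<in>B. deriv (\<lambda>k. M k b l) k0 * x l) = - (\<Sum>l\<in>B. M k0 b l * y l)" if b: "b \<in> B" for b
    proof -
      have "(\<Sum>c\<in>?B1. N k0 b c * v c) = (\<Sum>l\<in>B. deriv (\<lambda>k. M k b l) k0 * x l)"
      proof -
        have "(\<Sum>c\<in>?B1. N k0 b c * v c) = (\<Sum>c\<in>?B1. v c * (\<Sum>l\<in>B. deriv (\<lambda>k. M k b l) k0 * \<gamma> c l))"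
          by (intro sum.cong) (auto simp: N_def dF[OF b] mult.commute)
        also have "\<dots> = (\<Sum>l\<in>B. deriv (\<lambda>k. M k b l) k0 * x l)"
          unfolding x_def sum_distrib_left by (subst sum.swap) (simp add: mult_ac)
        finally show ?thesis .
      qed
      moreover have "(\<Sum>c\<in>?B2. N k0 b c * v c) = (\<Sum>l\<in>B. M k0 b l * y l)"
      proof -
        have "(\<Sum>c\<in>?B2. N k0 b c * v c) = (\<Sum>c\<in>?B2. v c * (\<Sum>l\<in>B. M k0 b l * \<gamma> c l))"
          by (intro sum.cong) (auto simp: N_def F_def mult.commute)
        also have "\<dots> = (\<Sum>l\<in>B. M k0 b l * y l)"
          unfolding y_def sum_distrib_left by (subst sum.swap) (simp add: mult_ac)
        finally show ?thesis .
      qed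
      ultimately show ?thesis using v(2)[OF b] split[of "\<lambda>c. N k0 b c * v c"]
        by (simp add: add_eq_0_iff2)
    qed
    have x0: "\<forall>c\<in>B. x c = 0"
      by (rule nondeg[of x "\<lambda>l. - y l"]) (use xK eqxy in \<open>auto simp: sum_negf\<close>)
    have v1: "v c = 0" if "c \<in> ?B1" for c
    proof -
      have "\<forall>b\<in>B. (\<Sum>c\<in>B. (if \<gamma> c \<in> S then v c else 0) * \<gamma> c b) = 0"
        using x0 by (simp add: split x_def)
      from indep[OF this, of c] that show ?thesis by simp
    qed
    \<comment> \<open>Once \<open>x\<close> vanishes, \<open>y\<close> lies in the kernel. It is then a combination of \<open>S\<close> and of \<open>W - S\<close>, so it vanishes too.\<close>
    have "y \<in> K"
    proof -
      have "(\<Sum>l\<in>B. M k0 b l * y l) = 0" if "b \<in> B" for b using eqxy[OF that] x0 by simp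
      moreover have "y c = 0" if "c \<notin> B" for c
        using that \<gamma>W W(2) unfolding y_def by (intro sum.neutral) (auto simp: V_def)
      ultimately show ?thesis by (auto simp: K_def)
    qed
    then have "y \<in> vfun.span S" using S(3) by blast
    then obtain u where u: "y = (\<Sum>w\<in>S. (\<lambda>b. u w * w b))"
      using vfun.span_finite[of S] finite_subset[OF W(1) finW] by auto
    have yb: "y b = (\<Sum>c\<in>?B1. u (\<gamma> c) * \<gamma> c b)" for b
    proof -
      have "bij_betw \<gamma> ?B1 S"
        using \<gamma> W(1) by (auto simp: bij_betw_def inj_on_def)
      from sum.reindex_bij_betw[OF this, of "\<lambda>w. u w * w b"]
      show ?thesis by (simp add: u sum_fun_apply)
    qed
    have v2: "v c = 0" if "c \<in> ?B2" for c
    proof -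
      have "\<forall>b\<in>B. (\<Sum>c\<in>B. (if \<gamma> c \<in> S then - u (\<gamma> c) else v c) * \<gamma> c b) = 0"
      proof
        fix b
        have "(\<Sum>c\<in>B. (if \<gamma> c \<in> S then - u (\<gamma> c) else v c) * \<gamma> c b) =
            - (\<Sum>c\<in>?B1. u (\<gamma> c) * \<gamma> c b) + y b"
          by (simp add: split y_def sum_negf)
        then show "(\<Sum>c\<in>B. (if \<gamma> c \<in> S then - u (\<gamma> c) else v c) * \<gamma> c b) = 0" by (simp add: yb)
      qed
      from indep[OF this, of c] that show ?thesis by simp
    qed
    from v(1) v1 v2 show False by blast
  qed
  moreover have "(\<lambda>k. fdet B (N k) / fdet B P) holomorphic_on UNIV"
    unfolding fdet_def using N_hol by (intro holomorphic_intros) (use P in \<open>auto simp: fdet_def\<close>)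
  ultimately show ?thesis
    unfolding has_order_def using P eq by (intro exI[of _ "\<lambda>k. fdet B (N k) / fdet B P"]) (auto simp: K_def)
qed

section \<open>Bonds, flows and the secular determinant\<close>

text \<open>
  A bond is an edge with a direction of travel, where \<open>True\<close> means from tail to head.
\<close>

definition bonds :: "('v, 'e) pre_digraph \<Rightarrow> ('e \<times> bool) set" where
  "bonds G = arcs G \<times> UNIV"

definition src :: "('v, 'e) pre_digraph \<Rightarrow> 'e \<times> bool \<Rightarrow> 'v" where
  "src G b = (if snd b then tail G (fst b) else head G (fst b))"

definition dst :: "('v, 'e) pre_digraph \<Rightarrow> 'e \<times> bool \<Rightarrow> 'v" where
  "dst G b = (if snd b then head G (fst b) else tail G (fst b))"

definition flip :: "'e \<times> bool \<Rightarrow> 'e \<times> bool" where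
  "flip b = (fst b, \<not> snd b)"

definition deg :: "('v, 'e) pre_digraph \<Rightarrow> 'v \<Rightarrow> nat" where
  "deg G v = card {b \<in> bonds G. src G b = v}"

text \<open>
  The amplitude with which a wave arriving along \<open>c\<close> continues along \<open>b\<close>: it is \<open>2/deg\<close> for transmission and
  \<open>2/deg - 1\<close> for reflection. These are the values that continuity and the Kirchhoff condition dictate.
\<close>

definition scat :: "('v, 'e) pre_digraph \<Rightarrow> 'e \<times> bool \<Rightarrow> 'e \<times> bool \<Rightarrow> complex" where
  "scat G b c = (if src G b = dst G c
     then 2 / of_nat (deg G (src G b)) - (if b = flip c then 1 else 0) else 0)"

text \<open>
  The factor a wave of wave number \<open>k\<close> collects along a bond; \<open>\<theta> e\<close> is the integral of the form over the edge,
  which enters with the sign of the direction.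
\<close>

definition phase :: "('e \<Rightarrow> real) \<Rightarrow> ('e \<Rightarrow> real) \<Rightarrow> complex \<Rightarrow> 'e \<times> bool \<Rightarrow> complex" where
  "phase L \<theta> k b = exp (\<i> * of_real (L (fst b)) * k) *
     exp (- (2 * of_real pi * \<i> * of_real ((if snd b then 1 else - 1) * \<theta> (fst b))))"

definition secular :: "('v, 'e) pre_digraph \<Rightarrow> ('e \<Rightarrow> real) \<Rightarrow> ('e \<Rightarrow> real) \<Rightarrow> complex \<Rightarrow> complex" where
  "secular G L \<theta> k = fdet (bonds G) (\<lambda>b c. (if b = c then 1 else 0) - scat G b c * phase L \<theta> k c)"

text \<open>
  The principal minor that multiplies the phases of the bonds in \<open>X\<close> when the secular determinant is expanded.
\<close>

definition pcoeff :: "('v, 'e) pre_digraph \<Rightarrow> ('e \<times> bool) set \<Rightarrow> complex" where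
  "pcoeff G X = fdet X (\<lambda>b c. - scat G b c)"

definition net :: "('e \<times> bool) set \<Rightarrow> 'e \<Rightarrow> int" where
  "net X e = of_bool ((e, True) \<in> X) - of_bool ((e, False) \<in> X)"

definition bond_length :: "('e \<Rightarrow> real) \<Rightarrow> ('e \<times> bool) set \<Rightarrow> real" where
  "bond_length L X = (\<Sum>b\<in>X. L (fst b))"

text \<open>
  The character of the flow \<open>h\<close>: for the fluxes of a form it depends on the pairing of \<open>h\<close> with the form.
\<close>

definition flow_char :: "('v, 'e) pre_digraph \<Rightarrow> ('e \<Rightarrow> real) \<Rightarrow> ('e \<Rightarrow> int) \<Rightarrow> complex" where
  "flow_char G \<theta> h = exp (- (2 * of_real pi * \<i> * of_real (\<Sum>e\<in>arcs G. of_int (h e) * \<theta> e)))"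

text \<open>
  The Fourier coefficient of the secular determinant at the frequency \<open>l\<close> and the character of \<open>h\<close>.
\<close>

definition amp :: "('v, 'e) pre_digraph \<Rightarrow> ('e \<Rightarrow> real) \<Rightarrow> ('e \<Rightarrow> int) \<Rightarrow> real \<Rightarrow> complex" where
  "amp G L h l = (\<Sum>X | X \<subseteq> bonds G \<and> net X = h \<and> bond_length L X = l. pcoeff G X)"

definition bdry :: "('v, 'e) pre_digraph \<Rightarrow> ('e \<Rightarrow> int) \<Rightarrow> 'v \<Rightarrow> int" where
  "bdry G h v = (\<Sum>e\<in>arcs G. h e * (of_bool (head G e = v) - of_bool (tail G e = v)))"

text \<open>
  The first homology group of the graph, realised as the group of integer flows without sources.
\<close>

definition cycles :: "('v, 'e) pre_digraph \<Rightarrow> ('e \<Rightarrow> int) set" where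
  "cycles G = {h. (\<forall>e. e \<notin> arcs G \<longrightarrow> h e = 0) \<and> (\<forall>v. bdry G h v = 0)}"

definition flow_norm :: "('v, 'e) pre_digraph \<Rightarrow> ('e \<Rightarrow> real) \<Rightarrow> ('e \<Rightarrow> int) \<Rightarrow> real" where
  "flow_norm G L h = (\<Sum>e\<in>arcs G. L e * real_of_int \<bar>h e\<bar>)"

lemma finite_bonds: "finite (arcs G) \<Longrightarrow> finite (bonds G)"
  by (simp add: bonds_def)

lemma sum_bonds: "(\<Sum>b\<in>bonds G. f b) = (\<Sum>e\<in>arcs G. f (e, True) + f (e, False))"
proof -
  have "(\<Sum>b\<in>bonds G. f b) = (\<Sum>(e, d)\<in>arcs G \<times> UNIV. f (e, d))" by (simp add: bonds_def)
  also have "\<dots> = (\<Sum>e\<in>arcs G. \<Sum>d\<in>UNIV. f (e, d))" by (rule sum.cartesian_product[symmetric])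
  finally show ?thesis by (simp add: UNIV_bool add.commute)
qed

text \<open>
  In each row either the entry of the identity or the other summand is chosen. Rows with the identity
  contribute only if the permutation fixes their index, so it is a permutation of the set \<open>X\<close> of the other rows.
\<close>

lemma fdet_identity_plus:
  fixes m :: "'b \<Rightarrow> 'b \<Rightarrow> complex"
  assumes "finite B"
  shows "fdet B (\<lambda>b c. (if b = c then 1 else 0) + m b c * s c) =
     (\<Sum>X\<in>Pow B. fdet X m * (\<Prod>c\<in>X. s c))"
proof -
  have "fdet B (\<lambda>b c. (if b = c then 1 else 0) + m b c * s c) =
      (\<Sum>p | p permutes B. \<Sum>X\<in>Pow B. of_int (sign p) *
        ((\<Prod>b\<in>X. m b (p b) * s (p b)) * (\<Prod>b\<in>B - X. if b = p b then 1 else 0)))"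
  proof -
    have "(\<Prod>b\<in>B. (if b = p b then 1 else 0) + m b (p b) * s (p b)) =
        (\<Sum>X\<in>Pow B. (\<Prod>b\<in>X. m b (p b) * s (p b)) * (\<Prod>b\<in>B - X. if b = p b then 1 else 0))" for p
      using prod_add[OF assms, of "\<lambda>b. m b (p b) * s (p b)" "\<lambda>b. if b = p b then 1 else 0"]
      by (simp add: add.commute)
    then show ?thesis unfolding fdet_def by (simp add: sum_distrib_left)
  qed
  also have "\<dots> = (\<Sum>X\<in>Pow B. \<Sum>p | p permutes B. of_int (sign p) *
        ((\<Prod>b\<in>X. m b (p b) * s (p b)) * (\<Prod>b\<in>B - X. if b = p b then 1 else 0)))"
    by (rule sum.swap)
  also have "\<dots> = (\<Sum>X\<in>Pow B. fdet X m * (\<Prod>c\<in>X. s c))"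
  proof (intro sum.cong refl)
    fix X assume "X \<in> Pow B"
    then have X: "X \<subseteq> B" by simp
    have "(\<Sum>p | p permutes B. of_int (sign p) *
        ((\<Prod>b\<in>X. m b (p b) * s (p b)) * (\<Prod>b\<in>B - X. if b = p b then 1 else 0))) =
       (\<Sum>p | p permutes X. of_int (sign p) *
        ((\<Prod>b\<in>X. m b (p b) * s (p b)) * (\<Prod>b\<in>B - X. if b = p b then 1 else 0)))"
    proof (rule sum.mono_neutral_right)
      show "finite {p. p permutes B}" using assms by (rule finite_permutations)
      show "{p. p permutes X} \<subseteq> {p. p permutes B}" using X by (auto intro: permutes_subset)
      show "\<forall>p\<in>{p. p permutes B} - {p. p permutes X}. of_int (sign p) *
        ((\<Prod>b\<in>X. m b (p b) * s (p b)) * (\<Prod>b\<in>B - X. if b = p b then 1 else 0)) = 0"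
      proof
        fix p assume p: "p \<in> {p. p permutes B} - {p. p permutes X}"
        then have "\<exists>b\<in>B - X. p b \<noteq> b" using permutes_superset[of p B X] by blast
        then obtain b where "b \<in> B - X" "p b \<noteq> b" by blast
        then have "(\<Prod>b\<in>B - X. if b = p b then 1 else 0 :: complex) = 0"
          using assms by (intro prod_zero bexI[of _ b]) auto
        then show "of_int (sign p) *
          ((\<Prod>b\<in>X. m b (p b) * s (p b)) * (\<Prod>b\<in>B - X. if b = p b then 1 else 0)) = 0" by simp
      qed
    qed
    also have "\<dots> = (\<Sum>p | p permutes X. of_int (sign p) * (\<Prod>b\<in>X. m b (p b)) * (\<Prod>c\<in>X. s c))"
    proof (intro sum.cong refl)
      fix p assume "p \<in> {p. p permutes X}"
      then have p: "p permutes X" by simp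
      have "(\<Prod>b\<in>B - X. if b = p b then 1 else 0 :: complex) = 1"
        using p by (intro prod.neutral) (auto simp: permutes_not_in)
      then show "of_int (sign p) * ((\<Prod>b\<in>X. m b (p b) * s (p b)) * (\<Prod>b\<in>B - X. if b = p b then 1 else 0)) =
          of_int (sign p) * (\<Prod>b\<in>X. m b (p b)) * (\<Prod>c\<in>X. s c)"
        using prod.permute[OF p, of s] by (simp add: prod.distrib o_def mult.assoc)
    qed
    finally show "(\<Sum>p | p permutes B. of_int (sign p) *
        ((\<Prod>b\<in>X. m b (p b) * s (p b)) * (\<Prod>b\<in>B - X. if b = p b then 1 else 0))) =
        fdet X m * (\<Prod>c\<in>X. s c)"
      by (simp add: fdet_def sum_distrib_right)
  qed
  finally show ?thesis .
qed

lemma net_sum: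
  assumes "finite (arcs G)" "X \<subseteq> bonds G"
  shows "(\<Sum>b\<in>X. f (fst b) * (if snd b then 1 else - 1)) = (\<Sum>e\<in>arcs G. of_int (net X e) * f e :: real)"
proof -
  have "(\<Sum>b\<in>X. f (fst b) * (if snd b then 1 else - 1)) =
      (\<Sum>b\<in>bonds G. if b \<in> X then f (fst b) * (if snd b then 1 else - 1) else 0)"
    using assms by (simp add: sum.inter_restrict[symmetric] finite_bonds Int_absorb1)
  also have "\<dots> = (\<Sum>e\<in>arcs G. of_int (net X e) * f e)"
    unfolding sum_bonds by (intro sum.cong) (auto simp: net_def)
  finally show ?thesis .
qed

lemma prod_phase:
  assumes "finite (arcs G)" "X \<subseteq> bonds G"
  shows "(\<Prod>c\<in>X. phase L \<theta> k c) = exp (\<i> * of_real (bond_length L X) * k) * flow_char G \<theta> (net X)"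
proof -
  have fX: "finite X" using assms finite_bonds finite_subset by blast
  have "(\<Prod>c\<in>X. phase L \<theta> k c) = (\<Prod>c\<in>X. exp (\<i> * of_real (L (fst c)) * k)) *
     (\<Prod>c\<in>X. exp (- (2 * of_real pi * \<i> * of_real (\<theta> (fst c) * (if snd c then 1 else - 1)))))"
    unfolding phase_def prod.distrib by (simp add: mult.commute)
  also have "\<dots> = exp (\<Sum>c\<in>X. \<i> * of_real (L (fst c)) * k) *
     exp (\<Sum>c\<in>X. - (2 * of_real pi * \<i> * of_real (\<theta> (fst c) * (if snd c then 1 else - 1))))"
    by (simp only: exp_sum[OF fX])
  also have "(\<Sum>c\<in>X. \<i> * of_real (L (fst c)) * k) = \<i> * of_real (bond_length L X) * k"
    by (simp add: bond_length_def sum_distrib_left sum_distrib_right)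
  also have "(\<Sum>c\<in>X. - (2 * of_real pi * \<i> * of_real (\<theta> (fst c) * (if snd c then 1 else - 1)))) =
      - (2 * of_real pi * \<i> * of_real (\<Sum>c\<in>X. \<theta> (fst c) * (if snd c then 1 else - 1)))"
    unfolding of_real_sum sum_distrib_left sum_negf ..
  also have "(\<Sum>c\<in>X. \<theta> (fst c) * (if snd c then 1 else - 1)) = (\<Sum>e\<in>arcs G. of_int (net X e) * \<theta> e)"
    by (rule net_sum[OF assms])
  finally show ?thesis unfolding flow_char_def .
qed

text \<open>
  The expansion over sets of bonds, grouped by total length and net flow. The finite set \<open>T\<close> of
  frequencies is left open so that two graphs can share it.
\<close>

lemma secular_expansion:
  assumes fin: "finite (arcs G)"
    and T: "finite T" "\<And>X. X \<subseteq> bonds G \<Longrightarrow> bond_length L X \<in> T"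
  shows "secular G L \<theta> k = expsum T (\<lambda>l. \<Sum>h\<in>net ` Pow (bonds G). amp G L h l * flow_char G \<theta> h) k"
proof -
  let ?B = "bonds G"
  let ?P = "\<lambda>h l. {X \<in> Pow ?B. net X = h \<and> bond_length L X = l}"
  have fB: "finite ?B" using fin by (rule finite_bonds)
  have "secular G L \<theta> k = fdet ?B (\<lambda>b c. (if b = c then 1 else 0) + (- scat G b c) * phase L \<theta> k c)"
    by (simp add: secular_def)
  also have "\<dots> = (\<Sum>X\<in>Pow ?B. pcoeff G X * (\<Prod>c\<in>X. phase L \<theta> k c))"
    by (subst fdet_identity_plus[OF fB]) (simp add: pcoeff_def)
  also have "\<dots> = (\<Sum>X\<in>Pow ?B. pcoeff G X * (exp (\<i> * of_real (bond_length L X) * k) * flow_char G \<theta> (net X)))"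
    using prod_phase[OF fin] by (intro sum.cong) auto
  also have "\<dots> = (\<Sum>l\<in>T. \<Sum>X | X \<in> Pow ?B \<and> bond_length L X = l.
      pcoeff G X * (exp (\<i> * of_real (bond_length L X) * k) * flow_char G \<theta> (net X)))"
    using fB T by (intro sum.group[symmetric]) auto
  also have "\<dots> = (\<Sum>l\<in>T. (\<Sum>h\<in>net ` Pow ?B. amp G L h l * flow_char G \<theta> h) * exp (\<i> * of_real l * k))"
  proof (intro sum.cong refl)
    fix l
    have "(\<Sum>X | X \<in> Pow ?B \<and> bond_length L X = l. pcoeff G X * (exp (\<i> * of_real (bond_length L X) * k) * flow_char G \<theta> (net X))) =
      (\<Sum>h\<in>net ` Pow ?B. \<Sum>X | X \<in> {X \<in> Pow ?B. bond_length L X = l} \<and> net X = h.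
         pcoeff G X * (exp (\<i> * of_real (bond_length L X) * k) * flow_char G \<theta> (net X)))"
      using fB by (intro sum.group[symmetric]) auto
    also have "\<dots> = (\<Sum>h\<in>net ` Pow ?B. amp G L h l * flow_char G \<theta> h * exp (\<i> * of_real l * k))"
      unfolding amp_def sum_distrib_right
      by (intro sum.cong refl) (auto simp: mult_ac)
    finally show "(\<Sum>X | X \<in> Pow ?B \<and> bond_length L X = l. pcoeff G X * (exp (\<i> * of_real (bond_length L X) * k) * flow_char G \<theta> (net X))) =
      (\<Sum>h\<in>net ` Pow ?B. amp G L h l * flow_char G \<theta> h) * exp (\<i> * of_real l * k)"
      by (simp add: sum_distrib_right)
  qed
  finally show ?thesis unfolding expsum_def .
qed

lemma amp_nonzeroD:
  assumes "amp G L h l \<noteq> 0"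
  shows "\<exists>X \<subseteq> bonds G. net X = h \<and> bond_length L X = l \<and> pcoeff G X \<noteq> 0"
  using assms unfolding amp_def by (metis (mono_tags, lifting) mem_Collect_eq sum.neutral)

lemma pcoeff_empty: "pcoeff G {} = 1"
  by (simp add: pcoeff_def fdet_def sign_id)

lemma pcoeff_nonzeroD:
  assumes "finite X" "pcoeff G X \<noteq> 0"
  shows "\<exists>p. p permutes X \<and> (\<forall>b\<in>X. src G b = dst G (p b))"
proof (rule ccontr)
  assume neg: "\<not> ?thesis"
  have "of_int (sign p) * (\<Prod>b\<in>X. - scat G b (p b)) = 0" if p: "p permutes X" for p
  proof -
    obtain b where "b \<in> X" "src G b \<noteq> dst G (p b)" using neg p by blast
    then have "(\<Prod>b\<in>X. - scat G b (p b)) = 0"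
      using assms(1) by (intro prod_zero) (auto simp: scat_def)
    then show ?thesis by simp
  qed
  then have "pcoeff G X = 0" unfolding pcoeff_def fdet_def by (intro sum.neutral) auto
  then show False using assms(2) by simp
qed

lemma sum_bond_ends:
  assumes "finite (arcs G)" "X \<subseteq> bonds G"
  shows "int (card {b\<in>X. dst G b = v}) - int (card {b\<in>X. src G b = v}) = bdry G (net X) v"
proof -
  have fX: "finite X" using assms finite_bonds finite_subset by blast
  have *: "int (card {b\<in>X. f b = v}) = (\<Sum>b\<in>bonds G. of_bool (b \<in> X) * of_bool (f b = v))" for f
  proof -
    have "int (card {b\<in>X. f b = v}) = (\<Sum>b\<in>X. of_bool (f b = v))"
      using fX by (simp add: of_bool_def sum.If_cases Int_def)
    also have "\<dots> = (\<Sum>b\<in>bonds G. if b \<in> X then of_bool (f b = v) else 0)"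
      using assms by (simp add: sum.inter_restrict[symmetric] finite_bonds Int_absorb1)
    finally show ?thesis by (auto intro!: sum.cong)
  qed
  show ?thesis
    unfolding * sum_bonds bdry_def sum_subtractf[symmetric]
    by (intro sum.cong refl) (auto simp: net_def src_def dst_def)
qed

text \<open>
  A nonzero term of the minor pairs the bonds of \<open>X\<close> such that each starts where its partner ends. So at every
  vertex as many bonds of \<open>X\<close> arrive as depart.
\<close>

lemma pcoeff_nonzero_cycles:
  assumes fin: "finite (arcs G)" and X: "X \<subseteq> bonds G" and nz: "pcoeff G X \<noteq> 0"
  shows "net X \<in> cycles G"
proof -
  have fX: "finite X" using assms finite_bonds finite_subset by blast
  obtain p where p: "p permutes X" "\<And>b. b \<in> X \<Longrightarrow> src G b = dst G (p b)"
    using pcoeff_nonzeroD[OF fX nz] by blast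
  have "card {b\<in>X. src G b = v} = card {b\<in>X. dst G b = v}" for v
  proof (rule bij_betw_same_card[of p])
    have "p ` {b\<in>X. src G b = v} = {b\<in>X. dst G b = v}"
    proof (intro Set.set_eqI iffI)
      fix c assume c: "c \<in> {b\<in>X. dst G b = v}"
      obtain b where b: "c = p b" using surjD[OF permutes_surj[OF p(1)]] by blast
      then have "b \<in> X" using c permutes_in_image[OF p(1)] by simp
      then show "c \<in> p ` {b\<in>X. src G b = v}" using b c p(2) by auto
    qed (use p permutes_in_image[OF p(1)] in auto)
    then show "bij_betw p {b\<in>X. src G b = v} {b\<in>X. dst G b = v}"
      using permutes_inj[OF p(1)] by (auto simp: bij_betw_def intro: inj_on_subset)
  qed
  then have "bdry G (net X) v = 0" for v using sum_bond_ends[OF fin X, of v] by simp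
  moreover have "net X e = 0" if "e \<notin> arcs G" for e using that X by (auto simp: net_def bonds_def)
  ultimately show ?thesis by (simp add: cycles_def)
qed

text \<open>
  Passing to the net flow loses exactly the pairs of opposite bonds.
\<close>

lemma flow_norm_le_bond_length:
  assumes "finite (arcs G)" "X \<subseteq> bonds G" "\<And>e. e \<in> arcs G \<Longrightarrow> L e > 0"
  shows "flow_norm G L (net X) \<le> bond_length L X"
    and "flow_norm G L (net X) = bond_length L X \<Longrightarrow> b \<in> X \<Longrightarrow> flip b \<notin> X"
proof -
  have eq: "bond_length L X = (\<Sum>e\<in>arcs G. L e * (of_bool ((e, True) \<in> X) + of_bool ((e, False) \<in> X)))"
  proof -
    have "bond_length L X = (\<Sum>b\<in>bonds G. if b \<in> X then L (fst b) else 0)"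
      unfolding bond_length_def using assms by (simp add: sum.inter_restrict[symmetric] finite_bonds Int_absorb1)
    then show ?thesis unfolding sum_bonds by (auto intro!: sum.cong)
  qed
  have le: "L e * real_of_int \<bar>net X e\<bar> \<le> L e * (of_bool ((e, True) \<in> X) + of_bool ((e, False) \<in> X))" if "e \<in> arcs G" for e
    using assms(3)[OF that] by (auto simp: net_def)
  then show "flow_norm G L (net X) \<le> bond_length L X" unfolding eq flow_norm_def by (rule sum_mono)
  assume *: "flow_norm G L (net X) = bond_length L X" and b: "b \<in> X"
  show "flip b \<notin> X"
  proof
    assume fb: "flip b \<in> X"
    let ?e = "fst b"
    have "(?e, True) \<in> X" "(?e, False) \<in> X" using b fb unfolding flip_def by (cases b; cases "snd b"; simp)+
    moreover have "?e \<in> arcs G" using b assms(2) by (auto simp: bonds_def)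
    ultimately have "L ?e * real_of_int \<bar>net X ?e\<bar> < L ?e * (of_bool ((?e, True) \<in> X) + of_bool ((?e, False) \<in> X))"
      using assms(3) by (simp add: net_def)
    then have "flow_norm G L (net X) < bond_length L X"
      unfolding eq flow_norm_def using le \<open>?e \<in> arcs G\<close> assms(1) by (intro sum_strict_mono_ex1) blast+
    then show False using * by simp
  qed
qed

text \<open>
  For a flow with values in \<open>{-1, 0, 1}\<close> this is the set of bonds along which it flows.
\<close>

definition flow_bonds :: "('e \<Rightarrow> int) \<Rightarrow> ('e \<times> bool) set" where
  "flow_bonds h = {b. h (fst b) = (if snd b then 1 else - 1)}"

lemma net_no_flip_eq:
  assumes "\<And>b. b \<in> X \<Longrightarrow> flip b \<notin> X"
  shows "flow_bonds (net X) = X"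
proof -
  have "b \<in> flow_bonds (net X) \<longleftrightarrow> b \<in> X" for b
    using assms[of b] assms[of "flip b"] by (cases b; cases "snd b") (auto simp: flow_bonds_def net_def flip_def)
  then show ?thesis by blast
qed

text \<open>
  Among the sets of bonds with net flow \<open>h\<close> only the one without opposite bonds has the minimal length, so the sum that
  defines the amplitude has at most one term and nothing can cancel.
\<close>

lemma amp_flow_norm:
  assumes fin: "finite (arcs G)" and L: "\<And>e. e \<in> arcs G \<Longrightarrow> L e > 0"
    and h: "\<And>e. e \<notin> arcs G \<Longrightarrow> h e = 0"
  shows "amp G L h (flow_norm G L h) = (if \<forall>e. \<bar>h e\<bar> \<le> 1 then pcoeff G (flow_bonds h) else 0)"
proof -
  let ?S = "{X. X \<subseteq> bonds G \<and> net X = h \<and> bond_length L X = flow_norm G L h}"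
  have sub: "X = flow_bonds h \<and> (\<forall>e. \<bar>h e\<bar> \<le> 1)" if "X \<in> ?S" for X
  proof -
    have "flip b \<notin> X" if b: "b \<in> X" for b
      using flow_norm_le_bond_length(2)[of G X L b, OF fin _ L] b \<open>X \<in> ?S\<close> by auto
    then have "flow_bonds (net X) = X" by (rule net_no_flip_eq)
    moreover have "\<bar>net X e\<bar> \<le> 1" for e by (simp add: net_def)
    ultimately show ?thesis using that by auto
  qed
  show ?thesis
  proof (cases "\<forall>e. \<bar>h e\<bar> \<le> 1")
    case True
    have "net (flow_bonds h) e = h e" for e
    proof -
      have "h e = -1 \<or> h e = 0 \<or> h e = 1" using True[rule_format, of e] by linarith
      then show ?thesis by (auto simp: net_def flow_bonds_def)
    qed
    then have n: "net (flow_bonds h) = h" by auto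
    have s: "flow_bonds h \<subseteq> bonds G" using h by (fastforce simp: flow_bonds_def bonds_def split: if_splits)
    have "bond_length L (flow_bonds h) = (\<Sum>b\<in>bonds G. if b \<in> flow_bonds h then L (fst b) else 0)"
      unfolding bond_length_def using s fin by (simp add: sum.inter_restrict[symmetric] finite_bonds Int_absorb1)
    also have "\<dots> = flow_norm G L h"
      unfolding sum_bonds flow_norm_def
    proof (intro sum.cong refl)
      fix e
      have "h e = -1 \<or> h e = 0 \<or> h e = 1" using True[rule_format, of e] by linarith
      then show "(if (e, True) \<in> flow_bonds h then L (fst (e, True)) else 0) +
         (if (e, False) \<in> flow_bonds h then L (fst (e, False)) else 0) = L e * real_of_int \<bar>h e\<bar>"
        by (auto simp: flow_bonds_def)
    qed
    finally have "flow_bonds h \<in> ?S" using n s by simp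
    then have "?S = {flow_bonds h}" by (intro equalityI subsetI) (simp_all add: sub)
    then show ?thesis using True by (simp add: amp_def)
  next
    case False
    then have "?S = {}" using sub by (metis (no_types, lifting) equals0I)
    then show ?thesis unfolding amp_def using False by (simp only: sum.empty if_False)
  qed
qed

text \<open>
  Only one permutation matches starts with ends, and all its factors are transmissions, which have the nonzero
  amplitude \<open>2/deg\<close>.
\<close>

lemma pcoeff_nonzeroI:
  assumes fin: "finite (arcs G)" and X: "X \<subseteq> bonds G"
    and inj: "inj_on (src G) X" "inj_on (dst G) X" and ends: "src G ` X = dst G ` X"
    and nf: "\<And>b. b \<in> X \<Longrightarrow> flip b \<notin> X"
  shows "pcoeff G X \<noteq> 0"
proof -
  have fX: "finite X" using assms finite_bonds finite_subset by blast
  define q where "q b = (if b \<in> X then inv_into X (dst G) (src G b) else b)" for b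
  have qX: "q b \<in> X" "dst G (q b) = src G b" if "b \<in> X" for b
    using that ends inv_into_into[of "src G b" "dst G" X] f_inv_into_f[of "src G b" "dst G" X]
    by (auto simp: q_def)
  have "inj_on q X" using inj qX unfolding inj_on_def by metis
  then have "bij_betw q X X" using qX fX by (simp add: bij_betw_def endo_inj_surj image_subsetI)
  then have q: "q permutes X" by (intro bij_imp_permutes) (auto simp: q_def)
  have uniq: "p = q" if "p permutes X" "\<forall>b\<in>X. src G b = dst G (p b)" for p
  proof
    fix b
    show "p b = q b"
    proof (cases "b \<in> X")
      case True
      then have "dst G (p b) = dst G (q b)" "p b \<in> X" "q b \<in> X"
        using that qX permutes_in_image[OF that(1)] by auto
      then show ?thesis using inj(2) by (auto dest: inj_onD)
    qed (use that q in \<open>auto simp: permutes_not_in\<close>)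
  qed
  have "pcoeff G X = (\<Sum>p\<in>{q}. of_int (sign p) * (\<Prod>b\<in>X. - scat G b (p b)))"
    unfolding pcoeff_def fdet_def
  proof (rule sum.mono_neutral_right)
    show "\<forall>p\<in>{p. p permutes X} - {q}. of_int (sign p) * (\<Prod>b\<in>X. - scat G b (p b)) = 0"
    proof
      fix p assume p: "p \<in> {p. p permutes X} - {q}"
      then obtain b where "b \<in> X" "src G b \<noteq> dst G (p b)" using uniq by blast
      then have "(\<Prod>b\<in>X. - scat G b (p b)) = 0" using fX by (intro prod_zero) (auto simp: scat_def)
      then show "of_int (sign p) * (\<Prod>b\<in>X. - scat G b (p b)) = 0" by simp
    qed
  qed (use q fX in \<open>auto simp: finite_permutations\<close>)
  moreover have "scat G b (q b) \<noteq> 0" if b: "b \<in> X" for b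
  proof -
    have "b \<noteq> flip (q b)" using nf[OF qX(1)[OF b]] b by auto
    moreover have "deg G (src G b) > 0"
    proof -
      have "b \<in> {c \<in> bonds G. src G c = src G b}" using b X by auto
      then show ?thesis unfolding deg_def using finite_bonds[OF fin]
        by (metis (no_types, lifting) card_gt_0_iff empty_iff finite_subset mem_Collect_eq subsetI)
    qed
    ultimately show ?thesis using qX[OF b] by (simp add: scat_def)
  qed
  ultimately show ?thesis using fX by (simp add: sign_def)
qed

text \<open>
  The rows of two bonds that leave the same vertex differ at reflections only, and without opposite bonds in \<open>X\<close> there
  are none. So the minor would have two equal rows.
\<close>

lemma pcoeff_nonzero_imp_inj:
  assumes fX: "finite X" and nz: "pcoeff G X \<noteq> 0" and nf: "\<And>b. b \<in> X \<Longrightarrow> flip b \<notin> X"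
  shows "inj_on (src G) X"
proof (rule ccontr)
  assume "\<not> ?thesis"
  then obtain a b where ab: "a \<in> X" "b \<in> X" "a \<noteq> b" "src G a = src G b" by (auto simp: inj_on_def)
  have rows: "scat G a c = scat G b c" if "c \<in> X" for c
  proof -
    have "flip (flip c) = c" by (simp add: flip_def)
    then have "a \<noteq> flip c" "b \<noteq> flip c" using nf[OF that] ab by auto
    then show ?thesis using ab by (simp add: scat_def)
  qed
  have "\<exists>v. (\<exists>c\<in>X. v c \<noteq> 0) \<and> (\<forall>c\<in>X. (\<Sum>d\<in>X. - scat G d c * v d) = 0)"
  proof (intro exI conjI ballI)
    let ?v = "\<lambda>d. if d = a then 1 else if d = b then - 1 else 0 :: complex"
    show "\<exists>c\<in>X. ?v c \<noteq> 0" using ab by auto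
    fix c assume c: "c \<in> X"
    have "(\<Sum>d\<in>X. - scat G d c * ?v d) = (\<Sum>d\<in>{a, b}. - scat G d c * ?v d)"
      using fX ab by (intro sum.mono_neutral_right) auto
    also have "\<dots> = 0" using ab rows[OF c] by simp
    finally show "(\<Sum>d\<in>X. - scat G d c * ?v d) = 0" .
  qed
  then have "fdet X (\<lambda>c d. - scat G d c) = 0" using fdet_eq_0_iff[OF fX, of "\<lambda>c d. - scat G d c"] by blast
  moreover have "fdet X (\<lambda>c d. - scat G d c) = pcoeff G X"
    unfolding pcoeff_def fdet_def
  proof (rule sum.reindex_bij_witness[where i = "inv_into UNIV" and j = "inv_into UNIV"])
    fix p assume "p \<in> {p. p permutes X}"
    then have p: "p permutes X" by simp
    have "(\<Prod>b\<in>X. - scat G b (inv_into UNIV p b)) = (\<Prod>b\<in>X. - scat G (p b) (inv_into UNIV p (p b)))"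
      using prod.permute[OF p, of "\<lambda>b. - scat G b (inv_into UNIV p b)"] by (simp add: o_def)
    also have "\<dots> = (\<Prod>b\<in>X. - scat G (p b) b)" using permutes_inverses(2)[OF p] by simp
    finally show "of_int (sign (inv_into UNIV p)) * (\<Prod>b\<in>X. - scat G b (inv_into UNIV p b)) = of_int (sign p) * (\<Prod>b\<in>X. - scat G (p b) b)"
      using sign_inverse[of p] p fX permutation_permutes[of p] by auto
  qed (auto simp: permutes_inv permutes_inv_inv)
  ultimately show False using nz by simp
qed

section \<open>Orders of the zeros of the secular determinant\<close>

lemma flip_simps [simp]: "flip (flip b) = b" "src G (flip b) = dst G b" "dst G (flip b) = src G b"
  "flip b \<in> bonds G \<longleftrightarrow> b \<in> bonds G" "fst (flip b) = fst b" "snd (flip b) \<longleftrightarrow> \<not> snd b"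
  by (cases b; auto simp: flip_def src_def dst_def bonds_def)+

lemma flip_eq_iff: "flip b = c \<longleftrightarrow> b = flip c"
  by (metis flip_simps(1))

lemma sum_flip: "(\<Sum>b\<in>{b\<in>bonds G. src G b = v}. f (flip b)) = (\<Sum>c\<in>{c\<in>bonds G. dst G c = v}. f c)"
  by (rule sum.reindex_bij_witness[where i = flip and j = flip]) auto

definition inflow :: "('v, 'e) pre_digraph \<Rightarrow> ('e \<times> bool \<Rightarrow> complex) \<Rightarrow> 'v \<Rightarrow> complex" where
  "inflow G x v = (\<Sum>c\<in>{c\<in>bonds G. dst G c = v}. x c)"

lemma sum_scat:
  assumes fin: "finite (arcs G)" and b: "b \<in> bonds G"
  shows "(\<Sum>c\<in>bonds G. scat G b c * x c) = 2 / of_nat (deg G (src G b)) * inflow G x (src G b) - x (flip b)"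
proof -
  let ?d = "2 / of_nat (deg G (src G b)) :: complex"
  have "(\<Sum>c\<in>bonds G. scat G b c * x c) =
      (\<Sum>c\<in>bonds G. (if dst G c = src G b then ?d * x c else 0) - (if c = flip b then x c else 0))"
    by (intro sum.cong) (auto simp: scat_def flip_eq_iff algebra_simps)
  also have "\<dots> = (\<Sum>c\<in>bonds G. if dst G c = src G b then ?d * x c else 0) - x (flip b)"
    using finite_bonds[OF fin] b by (simp add: sum_subtractf)
  also have "(\<Sum>c\<in>bonds G. if dst G c = src G b then ?d * x c else 0) = ?d * inflow G x (src G b)"
    unfolding inflow_def sum_distrib_left by (rule sum.inter_filter[OF finite_bonds[OF fin], symmetric])
  finally show ?thesis .
qed

text \<open>
  At a vertex of degree \<open>d\<close> scattering is the reflection \<open>2/d J - 1\<close>, where all entries of \<open>J\<close> are 1. Expanding the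
  product, the terms that contain the inflow cancel because \<open>J\<close> squared is \<open>d J\<close>.
\<close>

lemma scattering_isometry:
  assumes fin: "finite (arcs G)"
  shows "(\<Sum>b\<in>bonds G. cnj (\<Sum>c\<in>bonds G. scat G b c * x c) * (\<Sum>c\<in>bonds G. scat G b c * y c)) =
    (\<Sum>b\<in>bonds G. cnj (x b) * y b)"
proof -
  let ?B = "bonds G" and ?T = "inflow G x" and ?U = "inflow G y"
  let ?d = "\<lambda>v. 2 / of_nat (deg G v) :: complex"
  have fB: "finite ?B" using fin by (rule finite_bonds)
  have zero: "(\<Sum>b\<in>{b\<in>?B. src G b = v}. ?d v * cnj (?T v) * (?d v * ?U v) - ?d v * cnj (?T v) * y (flip b) -
      cnj (x (flip b)) * (?d v * ?U v)) = 0" for v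
  proof -
    have "(\<Sum>b\<in>{b\<in>?B. src G b = v}. ?d v * cnj (?T v) * (?d v * ?U v) - ?d v * cnj (?T v) * y (flip b) -
        cnj (x (flip b)) * (?d v * ?U v)) =
      of_nat (deg G v) * (?d v * cnj (?T v) * (?d v * ?U v)) - ?d v * cnj (?T v) * ?U v - cnj (?T v) * (?d v * ?U v)"
      unfolding sum_subtractf sum_distrib_left[symmetric] sum_distrib_right[symmetric]
        sum_flip[where f = y] sum_flip[where f = "\<lambda>b. cnj (x b)"]
      by (simp add: deg_def inflow_def)
    also have "\<dots> = 0" by (cases "deg G v = 0") (auto simp: field_simps)
    finally show ?thesis .
  qed
  have "(\<Sum>b\<in>?B. cnj (\<Sum>c\<in>?B. scat G b c * x c) * (\<Sum>c\<in>?B. scat G b c * y c)) =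
    (\<Sum>b\<in>?B. (?d (src G b) * cnj (?T (src G b)) * (?d (src G b) * ?U (src G b)) - ?d (src G b) * cnj (?T (src G b)) * y (flip b) -
      cnj (x (flip b)) * (?d (src G b) * ?U (src G b))) + cnj (x (flip b)) * y (flip b))"
  proof (intro sum.cong refl)
    fix b assume b: "b \<in> ?B"
    show "cnj (\<Sum>c\<in>?B. scat G b c * x c) * (\<Sum>c\<in>?B. scat G b c * y c) =
      (?d (src G b) * cnj (?T (src G b)) * (?d (src G b) * ?U (src G b)) - ?d (src G b) * cnj (?T (src G b)) * y (flip b) -
      cnj (x (flip b)) * (?d (src G b) * ?U (src G b))) + cnj (x (flip b)) * y (flip b)"
    proof -
      define d where "d = ?d (src G b)"
      have "cnj d = d" by (simp add: d_def)
      then show ?thesis unfolding sum_scat[OF fin b] d_def[symmetric] by (simp add: algebra_simps)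
    qed
  qed
  also have "\<dots> = (\<Sum>b\<in>?B. ?d (src G b) * cnj (?T (src G b)) * (?d (src G b) * ?U (src G b)) - ?d (src G b) * cnj (?T (src G b)) * y (flip b) -
      cnj (x (flip b)) * (?d (src G b) * ?U (src G b))) + (\<Sum>b\<in>?B. cnj (x (flip b)) * y (flip b))"
    by (rule sum.distrib)
  also have "(\<Sum>b\<in>?B. ?d (src G b) * cnj (?T (src G b)) * (?d (src G b) * ?U (src G b)) - ?d (src G b) * cnj (?T (src G b)) * y (flip b) -
      cnj (x (flip b)) * (?d (src G b) * ?U (src G b))) = (\<Sum>v\<in>src G ` ?B. \<Sum>b\<in>{b\<in>?B. src G b = v}.
       ?d (src G b) * cnj (?T (src G b)) * (?d (src G b) * ?U (src G b)) - ?d (src G b) * cnj (?T (src G b)) * y (flip b) -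
      cnj (x (flip b)) * (?d (src G b) * ?U (src G b)))"
    using fB by (intro sum.group[symmetric]) auto
  also have "\<dots> = (\<Sum>v\<in>src G ` ?B. \<Sum>b\<in>{b\<in>?B. src G b = v}.
       ?d v * cnj (?T v) * (?d v * ?U v) - ?d v * cnj (?T v) * y (flip b) - cnj (x (flip b)) * (?d v * ?U v))"
    by (intro sum.cong refl) auto
  also have "\<dots> = 0" using zero by (simp only: sum.neutral_const)
  also have "(\<Sum>b\<in>?B. cnj (x (flip b)) * y (flip b)) = (\<Sum>b\<in>?B. cnj (x b) * y b)"
    by (rule sum.reindex_bij_witness[where i = flip and j = flip]) auto
  finally show ?thesis by simp
qed

definition secular_kernel :: "('v, 'e) pre_digraph \<Rightarrow> ('e \<Rightarrow> real) \<Rightarrow> ('e \<Rightarrow> real) \<Rightarrow> complex \<Rightarrow> ('e \<times> bool \<Rightarrow> complex) set" where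
  "secular_kernel G L \<theta> k = {x. (\<forall>b. b \<notin> bonds G \<longrightarrow> x b = 0) \<and>
     (\<forall>b\<in>bonds G. x b = (\<Sum>c\<in>bonds G. scat G b c * (phase L \<theta> k c * x c)))}"

lemma secular_row:
  assumes "finite (arcs G)" "b \<in> bonds G"
  shows "(\<Sum>c\<in>bonds G. ((if b = c then 1 else 0) - scat G b c * phase L \<theta> k c) * x c) =
    x b - (\<Sum>c\<in>bonds G. scat G b c * (phase L \<theta> k c * x c))"
proof -
  have "(\<Sum>c\<in>bonds G. (if b = c then 1 else 0) * x c) = (\<Sum>c\<in>bonds G. if b = c then x c else 0)"
    by (intro sum.cong) auto
  also have "\<dots> = x b"
    using finite_bonds[OF assms(1)] assms(2) by simp
  finally have "(\<Sum>c\<in>bonds G. (if b = c then 1 else 0) * x c) = x b" .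
  then show ?thesis by (simp add: left_diff_distrib sum_subtractf mult.assoc)
qed

lemma norm_phase: "norm (phase L \<theta> k b) = exp (- (L (fst b) * Im k))"
  by (simp add: phase_def norm_mult norm_exp_eq_Re)

text \<open>
  A kernel vector is fixed by \<open>S D\<close>. Here \<open>S\<close> preserves the norm, while for nonreal \<open>k\<close> the matrix \<open>D\<close> strictly
  shrinks or strictly expands every nonzero vector.
\<close>

lemma secular_nonreal_nonzero:
  assumes fin: "finite (arcs G)" and L: "\<And>e. e \<in> arcs G \<Longrightarrow> L e > 0" and k: "Im k \<noteq> 0"
  shows "secular G L \<theta> k \<noteq> 0"
proof
  let ?B = "bonds G"
  assume "secular G L \<theta> k = 0"
  then obtain v where v: "\<exists>c\<in>?B. v c \<noteq> 0"
    "\<And>b. b \<in> ?B \<Longrightarrow> (\<Sum>c\<in>?B. ((if b = c then 1 else 0) - scat G b c * phase L \<theta> k c) * v c) = 0"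
    unfolding secular_def fdet_eq_0_iff[OF finite_bonds[OF fin]] by blast
  have vS: "v b = (\<Sum>c\<in>?B. scat G b c * (phase L \<theta> k c * v c))" if "b \<in> ?B" for b
    using v(2)[OF that] secular_row[OF fin that, of L \<theta> k v] by simp
  have "(\<Sum>b\<in>?B. cnj (v b) * v b) = (\<Sum>b\<in>?B. cnj (\<Sum>c\<in>?B. scat G b c * (phase L \<theta> k c * v c)) * (\<Sum>c\<in>?B. scat G b c * (phase L \<theta> k c * v c)))"
    using vS by (intro sum.cong) auto
  also have "\<dots> = (\<Sum>b\<in>?B. cnj (phase L \<theta> k b * v b) * (phase L \<theta> k b * v b))"
    by (rule scattering_isometry[OF fin])
  finally have "(\<Sum>b\<in>?B. complex_of_real ((cmod (v b))\<^sup>2)) = (\<Sum>b\<in>?B. complex_of_real ((cmod (phase L \<theta> k b * v b))\<^sup>2))"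
    by (simp only: complex_norm_square mult.commute[of "cnj _"])
  then have eq: "(\<Sum>b\<in>?B. (cmod (v b))\<^sup>2) = (\<Sum>b\<in>?B. (exp (- (L (fst b) * Im k)) * cmod (v b))\<^sup>2)"
    unfolding of_real_sum[symmetric] of_real_eq_iff norm_mult norm_phase .
  obtain c where c: "c \<in> ?B" "v c \<noteq> 0" using v(1) by blast
  have Lb: "L (fst b) > 0" if "b \<in> ?B" for b using L that by (auto simp: bonds_def)
  show False
  proof (cases "Im k > 0")
    case True
    have e: "exp (- (L (fst b) * Im k)) < 1" if "b \<in> ?B" for b using Lb[OF that] True by simp
    have "(\<Sum>b\<in>?B. (exp (- (L (fst b) * Im k)) * cmod (v b))\<^sup>2) < (\<Sum>b\<in>?B. (cmod (v b))\<^sup>2)"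
    proof (intro sum_strict_mono_ex1 ballI bexI[of _ c])
      fix b assume "b \<in> ?B"
      then show "(exp (- (L (fst b) * Im k)) * cmod (v b))\<^sup>2 \<le> (cmod (v b))\<^sup>2"
        using e[of b] by (intro power_mono mult_left_le_one_le) auto
    next
      show "(exp (- (L (fst c) * Im k)) * cmod (v c))\<^sup>2 < (cmod (v c))\<^sup>2"
        using e[OF c(1)] c(2) by (intro power_strict_mono) auto
    qed (use finite_bonds[OF fin] c in auto)
    then show False using eq by simp
  next
    case False
    then have neg: "Im k < 0" using k by simp
    have e: "exp (- (L (fst b) * Im k)) > 1" if "b \<in> ?B" for b
      using Lb[OF that] neg by (simp add: mult_pos_neg)
    have "(\<Sum>b\<in>?B. (cmod (v b))\<^sup>2) < (\<Sum>b\<in>?B. (exp (- (L (fst b) * Im k)) * cmod (v b))\<^sup>2)"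
    proof (intro sum_strict_mono_ex1 ballI bexI[of _ c])
      fix b assume "b \<in> ?B"
      then show "(cmod (v b))\<^sup>2 \<le> (exp (- (L (fst b) * Im k)) * cmod (v b))\<^sup>2"
        using e[of b] mult_right_mono[of 1 "exp (- (L (fst b) * Im k))" "cmod (v b)"] by (intro power_mono) auto
    next
      have "1 * cmod (v c) < exp (- (L (fst c) * Im k)) * cmod (v c)"
        using e[OF c(1)] c(2) by (intro mult_strict_right_mono) auto
      then show "(cmod (v c))\<^sup>2 < (exp (- (L (fst c) * Im k)) * cmod (v c))\<^sup>2"
        by (intro power_strict_mono) auto
    qed (use finite_bonds[OF fin] c in auto)
    then show False using eq by simp
  qed
qed

text \<open>
  For real \<open>k\<close> the matrix \<open>D\<close> is unitary and \<open>M = I - S D\<close>. If \<open>x\<close> lies in the kernel and \<open>M' x = M y\<close>, then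
  pairing with \<open>x\<close> removes the right-hand side, and the left-hand side is a multiple of \<open>\<Sum>b. L b * \<bar>x b\<bar>\<^sup>2\<close>. So \<open>x = 0\<close>,
  and the order of the determinant is the dimension of the kernel. This includes \<open>k = 0\<close>.
\<close>

lemma secular_has_order:
  assumes fin: "finite (arcs G)" and L: "\<And>e. e \<in> arcs G \<Longrightarrow> L e > 0" and k: "Im k = 0"
  shows "has_order (secular G L \<theta>) k (vfun.dim (secular_kernel G L \<theta> k))"
proof -
  let ?B = "bonds G" and ?D = "\<lambda>c. phase L \<theta> k c"
  let ?M = "\<lambda>k b c. (if b = c then 1 else 0) - scat G b c * phase L \<theta> k c"
  let ?S = "\<lambda>x b. \<Sum>c\<in>?B. scat G b c * x c"
  have fB: "finite ?B" using fin by (rule finite_bonds)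
  have Dn: "cnj (?D c) * ?D c = 1" for c
    using complex_norm_square[of "?D c"] k by (simp add: norm_phase mult.commute)
  have dM: "deriv (\<lambda>k. ?M k b c) k = - (scat G b c * (\<i> * of_real (L (fst c)) * ?D c))" for b c
    unfolding phase_def by (rule DERIV_imp_deriv) (auto intro!: derivative_eq_intros)
  have "has_order (\<lambda>k. fdet ?B (?M k)) k (vfun.dim {x. (\<forall>c. c \<notin> ?B \<longrightarrow> x c = 0) \<and> (\<forall>b\<in>?B. (\<Sum>c\<in>?B. ?M k b c * x c) = 0)})"
  proof (rule has_order_fdet[OF fB])
    fix b c
    show "(\<lambda>k. ?M k b c) holomorphic_on UNIV" unfolding phase_def by (intro holomorphic_intros)
  next
    fix x y assume x: "\<forall>b\<in>?B. (\<Sum>c\<in>?B. ?M k b c * x c) = 0"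
      and xy: "\<forall>b\<in>?B. (\<Sum>c\<in>?B. deriv (\<lambda>k. ?M k b c) k * x c) = (\<Sum>c\<in>?B. ?M k b c * y c)"
    have xS: "x b = ?S (\<lambda>c. ?D c * x c) b" if "b \<in> ?B" for b
      using x that secular_row[OF fin that, of L \<theta> k x] by simp
    have yS: "y b - ?S (\<lambda>c. ?D c * y c) b = - ?S (\<lambda>c. \<i> * of_real (L (fst c)) * ?D c * x c) b" if "b \<in> ?B" for b
      using xy[rule_format, OF that] secular_row[OF fin that, of L \<theta> k y] unfolding dM by (simp add: sum_negf mult_ac)
    have "(\<Sum>b\<in>?B. cnj (x b) * (y b - ?S (\<lambda>c. ?D c * y c) b)) =
        (\<Sum>b\<in>?B. cnj (x b) * y b) - (\<Sum>b\<in>?B. cnj (?S (\<lambda>c. ?D c * x c) b) * ?S (\<lambda>c. ?D c * y c) b)"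
      unfolding sum_subtractf[symmetric] using xS by (intro sum.cong refl) (simp add: right_diff_distrib)
    also have "(\<Sum>b\<in>?B. cnj (?S (\<lambda>c. ?D c * x c) b) * ?S (\<lambda>c. ?D c * y c) b) = (\<Sum>b\<in>?B. cnj (?D b * x b) * (?D b * y b))"
      by (rule scattering_isometry[OF fin])
    also have "\<dots> = (\<Sum>b\<in>?B. (cnj (?D b) * ?D b) * (cnj (x b) * y b))" by (intro sum.cong refl) (simp add: mult_ac)
    also have "\<dots> = (\<Sum>b\<in>?B. cnj (x b) * y b)" by (simp add: Dn)
    finally have "0 = (\<Sum>b\<in>?B. cnj (x b) * (y b - ?S (\<lambda>c. ?D c * y c) b))" by simp
    also have "\<dots> = - (\<Sum>b\<in>?B. cnj (?S (\<lambda>c. ?D c * x c) b) * ?S (\<lambda>c. \<i> * of_real (L (fst c)) * ?D c * x c) b)"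
      unfolding sum_negf[symmetric] using xS yS by (intro sum.cong refl) simp
    also have "(\<Sum>b\<in>?B. cnj (?S (\<lambda>c. ?D c * x c) b) * ?S (\<lambda>c. \<i> * of_real (L (fst c)) * ?D c * x c) b) =
        (\<Sum>b\<in>?B. cnj (?D b * x b) * (\<i> * of_real (L (fst b)) * ?D b * x b))"
      by (rule scattering_isometry[OF fin])
    also have "\<dots> = (\<Sum>b\<in>?B. (cnj (?D b) * ?D b) * (\<i> * of_real (L (fst b)) * (x b * cnj (x b))))"
      by (intro sum.cong refl) (simp add: mult_ac)
    also have "\<dots> = \<i> * of_real (\<Sum>b\<in>?B. L (fst b) * (cmod (x b))\<^sup>2)"
      unfolding Dn complex_norm_square[symmetric] by (simp add: sum_distrib_left mult_ac)
    finally have "complex_of_real (\<Sum>b\<in>?B. L (fst b) * (cmod (x b))\<^sup>2) = 0"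
      by (simp del: of_real_sum)
    then have "(\<Sum>b\<in>?B. L (fst b) * (cmod (x b))\<^sup>2) = 0" by (simp only: of_real_eq_0_iff)
    moreover have Lb: "L (fst b) > 0" if "b \<in> ?B" for b using L that by (auto simp: bonds_def)
    ultimately have "\<forall>b\<in>?B. L (fst b) * (cmod (x b))\<^sup>2 = 0"
      using fB by (subst (asm) sum_nonneg_eq_0_iff) (auto intro!: mult_nonneg_nonneg dest: Lb)
    then show "\<forall>c\<in>?B. x c = 0" using Lb by fastforce
  qed
  moreover have "{x. (\<forall>c. c \<notin> ?B \<longrightarrow> x c = 0) \<and> (\<forall>b\<in>?B. (\<Sum>c\<in>?B. ?M k b c * x c) = 0)} = secular_kernel G L \<theta> k"
    unfolding secular_kernel_def using secular_row[OF fin] by auto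
  ultimately show ?thesis by (simp add: secular_def[abs_def])
qed

lemma secular_has_order_nonreal:
  assumes "finite (arcs G)" "\<And>e. e \<in> arcs G \<Longrightarrow> L e > 0" "Im k \<noteq> 0"
  shows "has_order (secular G L \<theta>) k 0"
proof -
  have "secular G L \<theta> holomorphic_on UNIV"
    unfolding secular_def[abs_def] fdet_def phase_def by (intro holomorphic_intros)
  then show ?thesis unfolding has_order_def
    using secular_nonreal_nonzero[OF assms] by (intro exI[of _ "secular G L \<theta>"]) auto
qed

section \<open>Waves on one edge\<close>

lemma L2_upto_continuous:
  assumes "continuous_on {0..l} g" shows "L2_upto l g"
  unfolding L2_upto_def
proof
  show "g \<in> borel_measurable (lebesgue_on {0..l})"
    using assms by (intro continuous_imp_measurable_on_sets_lebesgue) auto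
  show "(\<lambda>x. (cmod (g x))\<^sup>2) integrable_on {0..l}"
    by (intro integrable_continuous_interval continuous_intros assms)
qed

lemma L2_upto_integrable:
  assumes "L2_upto l g" shows "g integrable_on {0..l}"
proof (rule measurable_bounded_by_integrable_imp_integrable)
  show "g \<in> borel_measurable (lebesgue_on {0..l})" using assms by (simp add: L2_upto_def)
  show "(\<lambda>x. 1 + (cmod (g x))\<^sup>2) integrable_on {0..l}"
    using assms by (intro integrable_add integrable_const_ivl) (auto simp: L2_upto_def)
  fix x
  have "0 \<le> (cmod (g x) - 1)\<^sup>2" by simp
  then have "2 * cmod (g x) \<le> 1 + (cmod (g x))\<^sup>2" by (simp add: power2_eq_square algebra_simps)
  then show "norm (g x) \<le> 1 + (cmod (g x))\<^sup>2" using norm_ge_zero[of "g x"] by linarith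
qed auto

lemma sobolev_deriv_imp_continuous:
  assumes "sobolev_deriv l f g" shows "continuous_on {0..l} f"
proof -
  have "continuous_on {0..l} (\<lambda>x. f 0 + integral {0..x} g)"
    using assms L2_upto_integrable
    by (intro continuous_intros indefinite_integral_continuous_1) (auto simp: sobolev_deriv_def)
  then show ?thesis
  proof (rule continuous_on_eq)
    fix x assume "x \<in> {0..l}"
    then show "f 0 + integral {0..x} g = f x"
      using assms unfolding sobolev_deriv_def by metis
  qed
qed

text \<open>
  Weak derivatives that are continuous are classical, so eigenfunctions solve an ordinary differential equation.
\<close>

lemma sobolev_deriv_imp_vector_derivative:
  assumes "sobolev_deriv l f g" "continuous_on {0..l} g" and x: "x \<in> {0..l}"
  shows "(f has_vector_derivative g x) (at x within {0..l})"
proof -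
  have "((\<lambda>x. f 0 + integral {0..x} g) has_vector_derivative 0 + g x) (at x within {0..l})"
    using assms by (intro has_vector_derivative_add integral_has_vector_derivative) auto
  then have "((\<lambda>x. f 0 + integral {0..x} g) has_vector_derivative g x) (at x within {0..l})" by simp
  then show ?thesis
  proof (rule has_vector_derivative_transform[OF x, rotated])
    fix y assume "y \<in> {0..l}"
    then show "f y = f 0 + integral {0..y} g"
      using assms unfolding sobolev_deriv_def by metis
  qed
qed

lemma vector_derivative_imp_sobolev_deriv:
  assumes d: "\<And>x. x \<in> {0..l} \<Longrightarrow> (f has_vector_derivative g x) (at x within {0..l})"
    and c: "continuous_on {0..l} g"
  shows "sobolev_deriv l f g"
  unfolding sobolev_deriv_def
proof (intro conjI ballI)
  show "L2_upto l g" using c by (rule L2_upto_continuous)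
  fix x assume x: "x \<in> {0..l}"
  have "(g has_integral (f x - f 0)) {0..x}"
    using x by (intro fundamental_theorem_of_calculus has_vector_derivative_within_subset[OF d]) auto
  then show "f x = f 0 + integral {0..x} g" by (simp add: integral_unique)
qed

text \<open>
  Multiplication by this factor turns the covariant derivative of the form \<open>a dx\<close> into the ordinary one.
\<close>

definition gauge :: "(real \<Rightarrow> real) \<Rightarrow> real \<Rightarrow> complex" where
  "gauge a t = exp (- (2 * of_real pi * \<i> * of_real (integral {0..t} a)))"

lemma gauge_nonzero [simp]: "gauge a t \<noteq> 0" by (simp add: gauge_def)

lemma gauge_0 [simp]: "gauge a 0 = 1" by (simp add: gauge_def)

lemma gauge_derivative:
  assumes "continuous_on {0..l} a" "t \<in> {0..l}"
  shows "(gauge a has_vector_derivative - (2 * of_real pi * \<i> * of_real (a t)) * gauge a t) (at t within {0..l})"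
proof -
  have "((\<lambda>t. integral {0..t} a) has_vector_derivative a t) (at t within {0..l})"
    using assms by (intro integral_has_vector_derivative)
  then have "((\<lambda>t. complex_of_real (integral {0..t} a)) has_vector_derivative of_real (a t)) (at t within {0..l})"
    by (intro has_vector_derivative_of_real) (simp add: has_real_derivative_iff_has_vector_derivative)
  then have "((\<lambda>t. - (2 * of_real pi * \<i> * of_real (integral {0..t} a))) has_vector_derivative
      - (2 * of_real pi * \<i> * of_real (a t))) (at t within {0..l})"
    by (intro has_vector_derivative_minus has_vector_derivative_mult_right)
  from field_vector_diff_chain_within[OF this, of exp "exp (- (2 * of_real pi * \<i> * of_real (integral {0..t} a)))"]
  show ?thesis unfolding gauge_def[abs_def] o_def
    by (auto intro: DERIV_exp has_field_derivative_at_within)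
qed

lemma exp_ikt_derivative:
  "((\<lambda>t. exp (\<i> * k * of_real t)) has_vector_derivative (\<i> * k) * exp (\<i> * k * of_real t)) (at t within S)"
proof -
  have "((\<lambda>t. \<i> * k * of_real t) has_vector_derivative \<i> * k) (at t within S)"
    by (auto intro!: derivative_eq_intros)
  from field_vector_diff_chain_within[OF this, of exp "exp (\<i> * k * of_real t)"]
  show ?thesis unfolding o_def by (auto intro: DERIV_exp has_field_derivative_at_within)
qed

definition wave :: "(real \<Rightarrow> real) \<Rightarrow> complex \<Rightarrow> complex \<Rightarrow> complex \<Rightarrow> real \<Rightarrow> complex" where
  "wave a k P Q t = gauge a t * (P * exp (\<i> * k * of_real t) + Q * exp (\<i> * (- k) * of_real t))"

text \<open>
  The covariant derivative of a wave; differentiation reverses the sign of the amplitude \<open>Q\<close> of the backward wave.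
\<close>

definition wave_cov :: "(real \<Rightarrow> real) \<Rightarrow> complex \<Rightarrow> complex \<Rightarrow> complex \<Rightarrow> real \<Rightarrow> complex" where
  "wave_cov a k P Q t = \<i> * k * wave a k P (- Q) t"

lemma wave_derivative:
  assumes "continuous_on {0..l} a" "t \<in> {0..l}"
  shows "(wave a k P Q has_vector_derivative
     (wave_cov a k P Q t - 2 * of_real pi * \<i> * of_real (a t) * wave a k P Q t)) (at t within {0..l})"
proof -
  have "((\<lambda>t. P * exp (\<i> * k * of_real t) + Q * exp (\<i> * (- k) * of_real t)) has_vector_derivative
      (P * ((\<i> * k) * exp (\<i> * k * of_real t)) + Q * ((\<i> * (- k)) * exp (\<i> * (- k) * of_real t)))) (at t within {0..l})"
    by (intro has_vector_derivative_add has_vector_derivative_mult_right exp_ikt_derivative)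
  from has_vector_derivative_mult[OF gauge_derivative[OF assms] this]
  show ?thesis unfolding wave_def[abs_def] wave_cov_def by (simp add: algebra_simps)
qed

lemma wave_cov_derivative:
  assumes "continuous_on {0..l} a" "t \<in> {0..l}"
  shows "(wave_cov a k P Q has_vector_derivative
     (- (k\<^sup>2 * wave a k P Q t) - 2 * of_real pi * \<i> * of_real (a t) * wave_cov a k P Q t)) (at t within {0..l})"
proof -
  have eq: "wave_cov a k P Q = (\<lambda>t. \<i> * k * wave a k P (- Q) t)" by (auto simp: wave_cov_def)
  have "\<i> * k * (\<i> * k * W - A * V) = - (k\<^sup>2 * W) - A * (\<i> * k * V)" for W A V
    by (simp add: algebra_simps power2_eq_square)
  moreover have "(wave_cov a k P Q has_vector_derivative
     (\<i> * k) * (wave_cov a k P (-Q) t - 2 * of_real pi * \<i> * of_real (a t) * wave a k P (-Q) t)) (at t within {0..l})"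
    unfolding eq by (intro has_vector_derivative_mult_right wave_derivative assms)
  ultimately show ?thesis by (simp only: wave_cov_def minus_minus)
qed

lemma vector_derivative_imp_continuous_on:
  assumes "\<And>x. x \<in> S \<Longrightarrow> (f has_vector_derivative g x) (at x within S)"
  shows "continuous_on S f"
  unfolding continuous_on_eq_continuous_within
  by (intro ballI has_vector_derivative_continuous[OF assms])

lemma wave_continuous:
  assumes "continuous_on {0..l} a"
  shows "continuous_on {0..l} (wave a k P Q)" "continuous_on {0..l} (wave_cov a k P Q)"
  by (rule vector_derivative_imp_continuous_on, rule wave_derivative[OF assms], assumption)
     (rule vector_derivative_imp_continuous_on, rule wave_cov_derivative[OF assms], assumption)

text \<open>
  With \<open>u\<close> the covariant derivative of \<open>f\<close>, the combinations \<open>u + i q f\<close> for \<open>q = k\<close> and \<open>q = - k\<close> satisfy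
  equations of first order, whose solutions are the gauge factor times an exponential. Their difference is a multiple of \<open>f\<close>.
\<close>

lemma bloch_edge_solution:
  assumes l: "l > 0" and a: "continuous_on {0..l} a" and k: "k \<noteq> 0"
    and fu: "cov_deriv l a f u" and uf: "cov_deriv l a u (\<lambda>x. - (k\<^sup>2 * f x))"
  shows "\<exists>P Q. \<forall>t\<in>{0..l}. f t = wave a k P Q t"
proof -
  let ?a = "\<lambda>t. 2 * complex_of_real pi * \<i> * complex_of_real (a t)"
  have cf: "continuous_on {0..l} f" and cu: "continuous_on {0..l} u"
    using fu uf sobolev_deriv_imp_continuous by (auto simp: cov_deriv_def)
  have df: "(f has_vector_derivative (u t - ?a t * f t)) (at t within {0..l})" if "t \<in> {0..l}" for t
    using fu that unfolding cov_deriv_def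
    by (intro sobolev_deriv_imp_vector_derivative[where g = "\<lambda>t. u t - ?a t * f t"] continuous_intros cf cu a) auto
  have du: "(u has_vector_derivative (- (k\<^sup>2 * f t) - ?a t * u t)) (at t within {0..l})" if "t \<in> {0..l}" for t
    using uf that unfolding cov_deriv_def
    by (intro sobolev_deriv_imp_vector_derivative[where g = "\<lambda>t. - (k\<^sup>2 * f t) - ?a t * u t"] continuous_intros cf cu a) auto
  have const: "\<exists>C. \<forall>t\<in>{0..l}. u t + \<i> * q * f t = C * gauge a t * exp (\<i> * q * of_real t)" if q: "q\<^sup>2 = k\<^sup>2" for q
  proof -
    let ?w = "\<lambda>t. u t + \<i> * q * f t"
    let ?r = "\<lambda>t. exp (\<i> * (- q) * of_real t) / gauge a t"
    let ?z = "\<lambda>t. exp (\<i> * (- q) * of_real t) * (?w t * exp (2 * of_real pi * \<i> * of_real (integral {0..t} a)))"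
    have ig: "exp (2 * of_real pi * \<i> * of_real (integral {0..t} a)) = gauge (\<lambda>t. - a t) t" for t
      by (simp add: gauge_def)
    have dz: "(?z has_vector_derivative 0) (at t within {0..l})" if t: "t \<in> {0..l}" for t
    proof -
      have w: "(?w has_vector_derivative ((- (k\<^sup>2 * f t) - ?a t * u t) + \<i> * q * (u t - ?a t * f t))) (at t within {0..l})"
        by (intro has_vector_derivative_add has_vector_derivative_mult_right df du t)
      have "((- (k\<^sup>2 * f t) - ?a t * u t) + \<i> * q * (u t - ?a t * f t)) = (\<i> * q - ?a t) * ?w t"
        unfolding q[symmetric] by (simp add: algebra_simps power2_eq_square)
      with w have w: "(?w has_vector_derivative ((\<i> * q - ?a t) * ?w t)) (at t within {0..l})" by simp
      have g: "(gauge (\<lambda>t. - a t) has_vector_derivative - (2 * of_real pi * \<i> * of_real (- a t)) * gauge (\<lambda>t. - a t) t) (at t within {0..l})"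
        by (intro gauge_derivative continuous_intros a t)
      from has_vector_derivative_mult[OF exp_ikt_derivative[of "-q" t "{0..l}"] has_vector_derivative_mult[OF w g]]
      show ?thesis unfolding ig by (simp add: algebra_simps)
    qed
    obtain C where C: "\<And>t. t \<in> {0..l} \<Longrightarrow> ?z t = C"
      using has_vector_derivative_zero_constant[of "{0..l}" ?z] dz by (auto simp: convex_real_interval)
    have "?w t = C * gauge a t * exp (\<i> * q * of_real t)" if t: "t \<in> {0..l}" for t
    proof -
      have "C * gauge a t * exp (\<i> * q * of_real t) = ?z t * gauge a t * exp (\<i> * q * of_real t)" using C[OF t] by simp
      also have "\<dots> = ?w t * (exp (2 * of_real pi * \<i> * of_real (integral {0..t} a)) * gauge a t) *
          (exp (\<i> * (- q) * of_real t) * exp (\<i> * q * of_real t))" by (simp only: mult_ac)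
      also have "\<dots> = ?w t" by (simp add: gauge_def exp_add[symmetric])
      finally show ?thesis by simp
    qed
    then show ?thesis by blast
  qed
  obtain C1 where C1: "\<And>t. t \<in> {0..l} \<Longrightarrow> u t + \<i> * k * f t = C1 * gauge a t * exp (\<i> * k * of_real t)"
    using const[of k] by auto
  obtain C2 where C2: "\<And>t. t \<in> {0..l} \<Longrightarrow> u t + \<i> * (- k) * f t = C2 * gauge a t * exp (\<i> * (- k) * of_real t)"
    using const[of "- k"] by auto
  have "f t = wave a k (C1 / (2 * \<i> * k)) (- C2 / (2 * \<i> * k)) t" if "t \<in> {0..l}" for t
  proof -
    have "2 * \<i> * k * f t = (u t + \<i> * k * f t) - (u t + \<i> * (- k) * f t)" by (simp add: algebra_simps)
    also have "\<dots> = gauge a t * (C1 * exp (\<i> * k * of_real t) - C2 * exp (\<i> * (- k) * of_real t))"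
      unfolding C1[OF that] C2[OF that] by (simp add: algebra_simps)
    finally show ?thesis using k by (simp add: wave_def field_simps)
  qed
  then show ?thesis by blast
qed

lemma wave_solves_edge:
  assumes a: "smooth_upto l a" and f: "\<And>t. t \<in> {0..l} \<Longrightarrow> f t = wave a k P Q t"
  shows "sobolev2 l f"
    and "cov_deriv l a f (wave_cov a k P Q)" and "cov_deriv l a (wave_cov a k P Q) (\<lambda>x. - (k\<^sup>2 * f x))"
    and "continuous_on {0..l} f"
    and "\<And>t. t \<in> {0..l} \<Longrightarrow> (f has_vector_derivative
      (wave_cov a k P Q t - 2 * of_real pi * \<i> * of_real (a t) * f t)) (at t within {0..l})"
proof -
  let ?a = "\<lambda>t. 2 * complex_of_real pi * \<i> * complex_of_real (a t)"
  let ?u = "wave_cov a k P Q" and ?w = "wave a k P Q"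
  obtain a' a'' where a': "\<And>x. x \<in> {0..l} \<Longrightarrow> (a has_vector_derivative a' x) (at x within {0..l})"
    and a'': "\<And>x. x \<in> {0..l} \<Longrightarrow> (a' has_vector_derivative a'' x) (at x within {0..l})"
    using a unfolding smooth_upto_def by metis
  have ca: "continuous_on {0..l} a" using a' by (rule vector_derivative_imp_continuous_on)
  have ca': "continuous_on {0..l} a'" using a'' by (rule vector_derivative_imp_continuous_on)
  note cw = wave_continuous[OF ca]
  show cf: "continuous_on {0..l} f" by (rule continuous_on_eq[OF cw(1)]) (simp add: f)
  show df: "(f has_vector_derivative (?u t - ?a t * f t)) (at t within {0..l})" if t: "t \<in> {0..l}" for t
    unfolding f[OF t] by (rule has_vector_derivative_transform[OF t _ wave_derivative[OF ca t, of k P Q]]) (rule f)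
  have du: "(?u has_vector_derivative (- (k\<^sup>2 * f t) - ?a t * ?u t)) (at t within {0..l})" if t: "t \<in> {0..l}" for t
    using wave_cov_derivative[OF ca t, of k P Q] by (simp add: f[OF t])
  show "cov_deriv l a f ?u" unfolding cov_deriv_def
    by (intro vector_derivative_imp_sobolev_deriv df continuous_intros cf cw ca)
  show "cov_deriv l a ?u (\<lambda>x. - (k\<^sup>2 * f x))" unfolding cov_deriv_def
    by (intro vector_derivative_imp_sobolev_deriv du continuous_intros cf cw ca)
  let ?g = "\<lambda>t. (- (k\<^sup>2 * f t) - ?a t * ?u t) - (?a t * (?u t - ?a t * f t) + 2 * of_real pi * \<i> * of_real (a' t) * f t)"
  have "((\<lambda>t. ?u t - ?a t * f t) has_vector_derivative ?g t) (at t within {0..l})" if t: "t \<in> {0..l}" for t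
    by (intro has_vector_derivative_diff du t has_vector_derivative_mult has_vector_derivative_mult_right
        has_vector_derivative_of_real a'[unfolded has_real_derivative_iff_has_vector_derivative[symmetric]] df)
  then have "sobolev_deriv l (\<lambda>t. ?u t - ?a t * f t) ?g"
    by (intro vector_derivative_imp_sobolev_deriv continuous_intros cf cw ca ca') auto
  moreover have "sobolev_deriv l f (\<lambda>t. ?u t - ?a t * f t)"
    by (intro vector_derivative_imp_sobolev_deriv df continuous_intros cf cw ca)
  ultimately show "sobolev2 l f" unfolding sobolev2_def by blast
qed

section \<open>Eigenfunctions and scattering\<close>

definition edge_flux :: "('e \<Rightarrow> real) \<Rightarrow> ('e \<Rightarrow> real \<Rightarrow> real) \<Rightarrow> 'e \<Rightarrow> real" where
  "edge_flux L \<alpha> e = integral {0..L e} (\<alpha> e)"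

text \<open>
  The number \<open>x b\<close> is the amplitude with which the wave leaves along \<open>b\<close>, measured at the source of \<open>b\<close>. The backward
  wave starts at the head of the edge, hence the phase on its amplitude in the coordinate of the edge. Outside
  the graph the value is 0, as eigenfunctions are normalised in this way.
\<close>

definition bond_wave ::
    "('v, 'e) pre_digraph \<Rightarrow> ('e \<Rightarrow> real) \<Rightarrow> ('e \<Rightarrow> real \<Rightarrow> real) \<Rightarrow> complex \<Rightarrow>
     ('e \<times> bool \<Rightarrow> complex) \<Rightarrow> 'e \<Rightarrow> real \<Rightarrow> complex" where
  "bond_wave G L \<alpha> k x e t = (if e \<in> arcs G \<and> t \<in> {0..L e}
     then wave (\<alpha> e) k (x (e, True)) (x (e, False) * phase L (edge_flux L \<alpha>) k (e, False)) t else 0)"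

lemma gauge_L: "gauge (\<alpha> e) (L e) * exp (\<i> * k * of_real (L e)) = phase L (edge_flux L \<alpha>) k (e, True)"
  "gauge (\<alpha> e) (L e) * exp (\<i> * (- k) * of_real (L e)) * phase L (edge_flux L \<alpha>) k (e, False) = 1"
  by (simp_all add: gauge_def phase_def edge_flux_def exp_add[symmetric] mult_ac)

text \<open>
  At either end the value is the sum of the outgoing and the incoming amplitude, and the covariant derivative is a multiple of
  their difference.
\<close>

lemma wave_ends:
  fixes x :: "'e \<times> bool \<Rightarrow> complex" and L :: "'e \<Rightarrow> real" and \<alpha> :: "'e \<Rightarrow> real \<Rightarrow> real" and k :: complex
  defines "D \<equiv> phase L (edge_flux L \<alpha>) k"
  shows "wave (\<alpha> e) k (x (e, True)) (x (e, False) * D (e, False)) 0 = x (e, True) + D (e, False) * x (e, False)"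
    and "wave (\<alpha> e) k (x (e, True)) (x (e, False) * D (e, False)) (L e) = x (e, False) + D (e, True) * x (e, True)"
    and "wave_cov (\<alpha> e) k (x (e, True)) (x (e, False) * D (e, False)) 0 = \<i> * k * (x (e, True) - D (e, False) * x (e, False))"
    and "wave_cov (\<alpha> e) k (x (e, True)) (x (e, False) * D (e, False)) (L e) = - (\<i> * k * (x (e, False) - D (e, True) * x (e, True)))"
proof -
  have *: "wave (\<alpha> e) k P (Q * D (e, False)) (L e) = P * (gauge (\<alpha> e) (L e) * exp (\<i> * k * of_real (L e))) +
      Q * (gauge (\<alpha> e) (L e) * exp (\<i> * (- k) * of_real (L e)) * D (e, False))" for P Q
    by (simp add: wave_def algebra_simps)
  then have **: "wave (\<alpha> e) k P (Q * D (e, False)) (L e) = P * D (e, True) + Q" for P Q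
    unfolding D_def gauge_L(2) gauge_L(1)[where k = k] by simp
  then show "wave (\<alpha> e) k (x (e, True)) (x (e, False) * D (e, False)) (L e) = x (e, False) + D (e, True) * x (e, True)"
    by simp
  show "wave_cov (\<alpha> e) k (x (e, True)) (x (e, False) * D (e, False)) (L e) = - (\<i> * k * (x (e, False) - D (e, True) * x (e, True)))"
    by (simp only: wave_cov_def minus_mult_left **) (simp add: algebra_simps)
qed (simp_all add: wave_def wave_cov_def algebra_simps)

lemma smooth_upto_continuous: "smooth_upto l a \<Longrightarrow> continuous_on {0..l} a"
  unfolding smooth_upto_def by (metis vector_derivative_imp_continuous_on)

lemma bond_pair_simps:
  "src G (e, True) = tail G e" "src G (e, False) = head G e"
  "dst G (e, True) = head G e" "dst G (e, False) = tail G e"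
  "flip (e, True) = (e, False)" "flip (e, False) = (e, True)"
  by (simp_all add: src_def dst_def flip_def)

lemma deg_eq_sum: "(\<Sum>b\<in>{b\<in>bonds G. src G b = v}. c) = of_nat (deg G v) * (c :: complex)"
  by (simp add: deg_def)

text \<open>
  The Kirchhoff condition says that the outgoing and the incoming amplitudes at a vertex have the same sum. With
  continuity the common value at the vertex is therefore \<open>2/deg\<close> times the inflow, and solving for the outgoing amplitude
  gives the scattering matrix.
\<close>

lemma scattering_matching:
  fixes x D :: "'e \<times> bool \<Rightarrow> complex"
  assumes fin: "finite (arcs G)"
  shows "((\<exists>\<phi>. \<forall>b\<in>bonds G. x b + D (flip b) * x (flip b) = \<phi> (src G b)) \<and>
      (\<forall>v. (\<Sum>b\<in>{b\<in>bonds G. src G b = v}. x b - D (flip b) * x (flip b)) = 0)) \<longleftrightarrow>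
    (\<forall>b\<in>bonds G. x b = (\<Sum>c\<in>bonds G. scat G b c * (D c * x c)))" (is "(\<exists>\<phi>. ?C \<phi>) \<and> ?K \<longleftrightarrow> ?S")
proof -
  let ?T = "inflow G (\<lambda>c. D c * x c)"
  have S: "?S \<longleftrightarrow> (\<forall>b\<in>bonds G. x b = 2 / of_nat (deg G (src G b)) * ?T (src G b) - D (flip b) * x (flip b))"
    using sum_scat[OF fin, of _ "\<lambda>c. D c * x c"] by simp
  have T: "(\<Sum>b\<in>{b\<in>bonds G. src G b = v}. D (flip b) * x (flip b)) = ?T v" for v
    unfolding inflow_def by (rule sum_flip)
  have deg: "deg G (src G b) \<noteq> 0" if "b \<in> bonds G" for b
  proof -
    have "b \<in> {c \<in> bonds G. src G c = src G b}" using that by simp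
    then show ?thesis using finite_bonds[OF fin] unfolding deg_def by (metis (no_types, lifting) card_0_eq empty_iff finite_subset mem_Collect_eq subsetI)
  qed
  show ?thesis
  proof
    assume "(\<exists>\<phi>. ?C \<phi>) \<and> ?K"
    then obtain \<phi> where C: "?C \<phi>" and K: ?K by blast
    have x: "(\<Sum>b\<in>{b\<in>bonds G. src G b = v}. x b) = ?T v" for v
      using K[rule_format, of v] T[of v] by (simp add: sum_subtractf)
    have "of_nat (deg G v) * \<phi> v = 2 * ?T v" for v
    proof -
      have "of_nat (deg G v) * \<phi> v = (\<Sum>b\<in>{b\<in>bonds G. src G b = v}. x b + D (flip b) * x (flip b))"
        unfolding deg_eq_sum[symmetric] using C by (intro sum.cong) auto
      then show ?thesis by (simp add: sum.distrib x T)
    qed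
    then have \<phi>: "\<phi> (src G b) = 2 / of_nat (deg G (src G b)) * ?T (src G b)" if "b \<in> bonds G" for b
      using deg[OF that] by (simp add: field_simps)
    show ?S unfolding S
    proof
      fix b assume b: "b \<in> bonds G"
      show "x b = 2 / of_nat (deg G (src G b)) * ?T (src G b) - D (flip b) * x (flip b)"
        unfolding \<phi>[OF b, symmetric] C[rule_format, OF b, symmetric] by simp
    qed
  next
    assume ?S
    then have x: "x b = 2 / of_nat (deg G (src G b)) * ?T (src G b) - D (flip b) * x (flip b)" if "b \<in> bonds G" for b
      using that S by blast
    have "?C (\<lambda>v. 2 / of_nat (deg G v) * ?T v)"
    proof
      fix b assume "b \<in> bonds G"
      from x[OF this] show "x b + D (flip b) * x (flip b) = 2 / of_nat (deg G (src G b)) * ?T (src G b)"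
        unfolding eq_diff_eq .
    qed
    moreover have "(\<Sum>b\<in>{b\<in>bonds G. src G b = v}. x b - D (flip b) * x (flip b)) = 0" for v
    proof -
      have "(\<Sum>b\<in>{b\<in>bonds G. src G b = v}. x b - D (flip b) * x (flip b)) =
          (\<Sum>b\<in>{b\<in>bonds G. src G b = v}. 2 / of_nat (deg G v) * ?T v - 2 * (D (flip b) * x (flip b)))"
      proof (intro sum.cong refl)
        fix b assume "b \<in> {b\<in>bonds G. src G b = v}"
        then have b: "b \<in> bonds G" "src G b = v" by auto
        show "x b - D (flip b) * x (flip b) = 2 / of_nat (deg G v) * ?T v - 2 * (D (flip b) * x (flip b))"
          by (subst x[OF b(1)]) (simp add: b(2))
      qed
      also have "\<dots> = of_nat (deg G v) * (2 / of_nat (deg G v) * ?T v) - 2 * ?T v"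
        unfolding sum_subtractf sum_distrib_left[symmetric] T deg_eq_sum by (simp add: mult.left_commute)
      also have "\<dots> = 0"
      proof (cases "deg G v = 0")
        case True
        then have e: "{b\<in>bonds G. src G b = v} = {}" using finite_bonds[OF fin] by (simp add: deg_def)
        have "?T v = 0" using T[of v] unfolding e by simp
        then show ?thesis by simp
      qed simp
      finally show ?thesis .
    qed
    ultimately show "(\<exists>\<phi>. ?C \<phi>) \<and> ?K"
      by (intro conjI exI[of _ "\<lambda>v. 2 / of_nat (deg G v) * ?T v"] allI)
  qed
qed

lemma bond_wave_bloch:
  assumes G: "fin_digraph G" and L: "\<And>e. e \<in> arcs G \<Longrightarrow> L e > 0" and \<alpha>: "one_form G L \<alpha>" and k: "k \<noteq> 0"
  shows "bloch_laplacian G L \<alpha> (bond_wave G L \<alpha> k x) (\<lambda>e t. k\<^sup>2 * bond_wave G L \<alpha> k x e t) \<longleftrightarrow>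
    (\<forall>b\<in>bonds G. x b = (\<Sum>c\<in>bonds G. scat G b c * (phase L (edge_flux L \<alpha>) k c * x c)))"
proof -
  interpret fin_digraph G by fact
  let ?f = "bond_wave G L \<alpha> k x" and ?D = "phase L (edge_flux L \<alpha>) k"
  let ?u = "\<lambda>e. wave_cov (\<alpha> e) k (x (e, True)) (x (e, False) * ?D (e, False))"
  have fin: "finite (arcs G)" by simp
  have sm: "smooth_upto (L e) (\<alpha> e)" if "e \<in> arcs G" for e using \<alpha> that by (simp add: one_form_def)
  have fw: "?f e t = wave (\<alpha> e) k (x (e, True)) (x (e, False) * ?D (e, False)) t" if "e \<in> arcs G" "t \<in> {0..L e}" for e t
    using that by (simp add: bond_wave_def)
  note ws = wave_solves_edge[OF sm fw]
  have f0: "?f e 0 = x (e, True) + ?D (e, False) * x (e, False)"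
    and fL: "?f e (L e) = x (e, False) + ?D (e, True) * x (e, True)" if "e \<in> arcs G" for e
    using fw[OF that, of 0] fw[OF that, of "L e"] L[OF that] by (simp_all add: wave_ends)
  have vd: "edge_deriv L ?f e t = ?u e t - 2 * of_real pi * \<i> * of_real (\<alpha> e t) * ?f e t"
    if "e \<in> arcs G" "t \<in> {0..L e}" for e t
    unfolding edge_deriv_def
    by (intro vector_derivative_within_closed_interval L ws(5) that)
  have cont: "continuous_on_graph G L ?f \<longleftrightarrow> (\<exists>\<phi>. \<forall>b\<in>bonds G. x b + ?D (flip b) * x (flip b) = \<phi> (src G b))"
  proof -
    have "(\<forall>e\<in>arcs G. ?f e 0 = \<phi> (tail G e) \<and> ?f e (L e) = \<phi> (head G e)) \<longleftrightarrow>
        (\<forall>b\<in>bonds G. x b + ?D (flip b) * x (flip b) = \<phi> (src G b))" for \<phi>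
      using f0 fL by (auto simp: bonds_def src_def flip_def)
    then show ?thesis using ws(4) unfolding continuous_on_graph_def by simp
  qed
  have kir: "kirchhoff G L ?f \<longleftrightarrow> (\<forall>v. (\<Sum>b\<in>{b\<in>bonds G. src G b = v}. x b - ?D (flip b) * x (flip b)) = 0)"
    if cf: "continuous_on_graph G L ?f"
  proof -
    obtain \<phi> where \<phi>: "\<And>e. e \<in> arcs G \<Longrightarrow> ?f e 0 = \<phi> (tail G e) \<and> ?f e (L e) = \<phi> (head G e)"
      using cf unfolding continuous_on_graph_def by blast
    have ns: "normal_sum G L (edge_deriv L ?f) v =
        - (\<i> * k * (\<Sum>b\<in>{b\<in>bonds G. src G b = v}. x b - ?D (flip b) * x (flip b)))"
      if v: "v \<in> verts G" for v
    proof -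
      have "normal_sum G L (edge_deriv L ?f) v =
          (\<Sum>e\<in>in_arcs G v. ?u e (L e) - 2 * of_real pi * \<i> * \<phi> v * of_real (\<alpha> e (L e))) -
          (\<Sum>e\<in>out_arcs G v. ?u e 0 - 2 * of_real pi * \<i> * \<phi> v * of_real (\<alpha> e 0))"
        unfolding normal_sum_def using L \<phi>
        by (intro arg_cong2[where f = "(-)"] sum.cong refl) (auto simp: vd less_imp_le)
      also have "\<dots> = (\<Sum>e\<in>in_arcs G v. ?u e (L e)) - (\<Sum>e\<in>out_arcs G v. ?u e 0) -
          2 * of_real pi * \<i> * \<phi> v * of_real (normal_sum G L \<alpha> v)"
        by (simp add: normal_sum_def sum_subtractf sum_distrib_left[symmetric] right_diff_distrib)
      also have "normal_sum G L \<alpha> v = 0" using \<alpha> v by (simp add: one_form_def)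
      also have "(\<Sum>e\<in>in_arcs G v. ?u e (L e)) = - (\<i> * k * (\<Sum>e\<in>in_arcs G v. x (e, False) - ?D (e, True) * x (e, True)))"
        unfolding wave_ends sum_distrib_left sum_negf ..
      also have "(\<Sum>e\<in>out_arcs G v. ?u e 0) = \<i> * k * (\<Sum>e\<in>out_arcs G v. x (e, True) - ?D (e, False) * x (e, False))"
        unfolding wave_ends sum_distrib_left ..
      finally have "normal_sum G L (edge_deriv L ?f) v = - (\<i> * k *
         ((\<Sum>e\<in>in_arcs G v. x (e, False) - ?D (e, True) * x (e, True)) +
          (\<Sum>e\<in>out_arcs G v. x (e, True) - ?D (e, False) * x (e, False))))"
        by (simp add: algebra_simps)
      also have "(\<Sum>e\<in>in_arcs G v. x (e, False) - ?D (e, True) * x (e, True)) +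
          (\<Sum>e\<in>out_arcs G v. x (e, True) - ?D (e, False) * x (e, False)) =
          (\<Sum>b\<in>{b\<in>bonds G. src G b = v}. x b - ?D (flip b) * x (flip b))"
      proof -
        have "(\<Sum>b\<in>{b\<in>bonds G. src G b = v}. x b - ?D (flip b) * x (flip b)) =
            (\<Sum>b\<in>bonds G. if src G b = v then x b - ?D (flip b) * x (flip b) else 0)"
          by (rule sum.inter_filter[OF finite_bonds[OF fin]])
        then show ?thesis unfolding sum_bonds in_arcs_def out_arcs_def sum.distrib sum.inter_filter[OF fin] bond_pair_simps
          by (simp only: add.commute)
      qed
      finally show ?thesis .
    qed
    have out: "(\<Sum>b\<in>{b\<in>bonds G. src G b = v}. x b - ?D (flip b) * x (flip b)) = 0" if "v \<notin> verts G" for v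
    proof -
      have "src G b \<in> verts G" if "b \<in> bonds G" for b using that by (auto simp: bonds_def src_def)
      then have e: "{b\<in>bonds G. src G b = v} = {}" using that by blast
      show ?thesis unfolding e by simp
    qed
    have "kirchhoff G L ?f \<longleftrightarrow> (\<forall>v\<in>verts G. (\<Sum>b\<in>{b\<in>bonds G. src G b = v}. x b - ?D (flip b) * x (flip b)) = 0)"
      unfolding kirchhoff_def using k by (intro ball_cong refl) (simp add: ns)
    then show ?thesis using out by blast
  qed
  have "bloch_laplacian G L \<alpha> ?f (\<lambda>e t. k\<^sup>2 * ?f e t) \<longleftrightarrow> continuous_on_graph G L ?f \<and> kirchhoff G L ?f"
    using ws(1,2,3) unfolding bloch_laplacian_def bloch_domain_def by blast
  then show ?thesis using cont kir scattering_matching[OF fin, of x ?D] by blast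
qed

lemma eigenspace_eq_image:
  assumes G: "fin_digraph G" and L: "\<And>e. e \<in> arcs G \<Longrightarrow> L e > 0" and \<alpha>: "one_form G L \<alpha>" and k: "k \<noteq> 0"
  shows "eigenspace G L \<alpha> (k\<^sup>2) = bond_wave G L \<alpha> k ` secular_kernel G L (edge_flux L \<alpha>) k"
proof (intro equalityI subsetI)
  fix f assume "f \<in> bond_wave G L \<alpha> k ` secular_kernel G L (edge_flux L \<alpha>) k"
  then obtain x where "x \<in> secular_kernel G L (edge_flux L \<alpha>) k" "f = bond_wave G L \<alpha> k x" by blast
  then show "f \<in> eigenspace G L \<alpha> (k\<^sup>2)"
    using bond_wave_bloch[OF G L \<alpha> k, of x] by (auto simp: eigenspace_def secular_kernel_def bond_wave_def)
next
  let ?D = "phase L (edge_flux L \<alpha>) k"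
  fix f assume "f \<in> eigenspace G L \<alpha> (k\<^sup>2)"
  then have bl: "bloch_laplacian G L \<alpha> f (\<lambda>e x. k\<^sup>2 * f e x)"
    and out: "\<And>e x. \<not> (e \<in> arcs G \<and> x \<in> {0..L e}) \<Longrightarrow> f e x = 0" by (auto simp: eigenspace_def)
  have "\<exists>P Q. \<forall>t\<in>{0..L e}. f e t = wave (\<alpha> e) k P Q t" if e: "e \<in> arcs G" for e
  proof -
    obtain u where u: "cov_deriv (L e) (\<alpha> e) (f e) u" "cov_deriv (L e) (\<alpha> e) u (\<lambda>x. - (k\<^sup>2 * f e x))"
      using bl e unfolding bloch_laplacian_def by blast
    have "continuous_on {0..L e} (\<alpha> e)" using \<alpha> e by (auto simp: one_form_def intro: smooth_upto_continuous)
    then show ?thesis by (rule bloch_edge_solution[OF L[OF e] _ k u])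
  qed
  then obtain P Q where PQ: "\<And>e t. e \<in> arcs G \<Longrightarrow> t \<in> {0..L e} \<Longrightarrow> f e t = wave (\<alpha> e) k (P e) (Q e) t"
    by metis
  define x where "x b = (if b \<in> bonds G then if snd b then P (fst b) else Q (fst b) / ?D b else 0)" for b
  have "phase L (edge_flux L \<alpha>) k b \<noteq> 0" for b by (simp add: phase_def)
  then have x: "x (e, True) = P e" "x (e, False) * ?D (e, False) = Q e" if "e \<in> arcs G" for e
    using that by (auto simp: x_def bonds_def)
  have f: "f = bond_wave G L \<alpha> k x"
  proof (intro ext)
    fix e t show "f e t = bond_wave G L \<alpha> k x e t"
      by (cases "e \<in> arcs G \<and> t \<in> {0..L e}") (auto simp: bond_wave_def out PQ x)
  qed
  moreover have "x \<in> secular_kernel G L (edge_flux L \<alpha>) k"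
    using bl bond_wave_bloch[OF G L \<alpha> k, of x] unfolding f[symmetric] secular_kernel_def by (auto simp: x_def)
  ultimately show "f \<in> bond_wave G L \<alpha> k ` secular_kernel G L (edge_flux L \<alpha>) k" by blast
qed

lemma wave_diff: "wave a k (P - P') (Q - Q') t = wave a k P Q t - wave a k P' Q' t"
  by (simp add: wave_def algebra_simps)

lemma wave_eq_0_imp:
  assumes l: "l > 0" and k: "k \<noteq> 0" "Im k = 0" and z: "\<And>t. t \<in> {0..l} \<Longrightarrow> wave a k P Q t = 0"
  shows "P = 0 \<and> Q = 0"
proof -
  define r where "r = Re k"
  have kr: "k = of_real r" "r \<noteq> 0" using k by (auto simp: r_def complex_eq_iff)
  define t where "t = min l (pi / (2 * \<bar>r\<bar>))"
  have t: "t > 0" "t \<le> l" "\<bar>r\<bar> * t \<le> pi / 2"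
    using l kr(2) by (auto simp: t_def min_def field_simps)
  have "P + Q = 0" using z[of 0] l by (simp add: wave_def)
  then have Q: "Q = - P" by (simp add: add_eq_0_iff2)
  have "P * (exp (\<i> * k * of_real t) - exp (\<i> * (- k) * of_real t)) = 0"
    using z[of t] t unfolding wave_def Q by (simp add: algebra_simps)
  moreover have "Im (exp (\<i> * k * of_real t) - exp (\<i> * (- k) * of_real t)) = 2 * sin (r * t)"
    unfolding kr by (simp add: Im_exp)
  moreover have "sin (r * t) \<noteq> 0"
  proof -
    have "0 < \<bar>r\<bar> * t" "\<bar>r\<bar> * t < pi" using t kr(2) pi_gt_zero by (simp, linarith)
    then have "sin (\<bar>r\<bar> * t) > 0" by (rule sin_gt_zero)
    then show ?thesis by (cases "r < 0") auto
  qed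
  ultimately have "P = 0" by (metis mult_eq_0_iff zero_complex.simps(2) zero_neq_numeral)
  then show ?thesis using Q by simp
qed

text \<open>
  The amplitudes on an edge can be recovered from the wave, so amplitude vectors and eigenfunctions form spaces of the
  same dimension.
\<close>

lemma dim_eigenspace:
  assumes G: "fin_digraph G" and L: "\<And>e. e \<in> arcs G \<Longrightarrow> L e > 0" and \<alpha>: "one_form G L \<alpha>"
    and k: "k \<noteq> 0" "Im k = 0"
  shows "edge_fun.dim (eigenspace G L \<alpha> (k\<^sup>2)) = vfun.dim (secular_kernel G L (edge_flux L \<alpha>) k)"
proof -
  let ?K = "secular_kernel G L (edge_flux L \<alpha>) k" and ?\<Psi> = "bond_wave G L \<alpha> k"
  let ?V = "{x :: 'b \<times> bool \<Rightarrow> complex. \<forall>b. b \<notin> bonds G \<longrightarrow> x b = 0}"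
  interpret p: vector_space_pair "\<lambda>(c::complex) (f :: 'b \<times> bool \<Rightarrow> complex) x. c * f x"
    "\<lambda>(c::complex) (f :: 'b \<Rightarrow> real \<Rightarrow> complex) e x. c * f e x" ..
  have lin: "Vector_Spaces.linear (\<lambda>(c::complex) (f :: 'b \<times> bool \<Rightarrow> complex) x. c * f x)
     (\<lambda>(c::complex) (f :: 'b \<Rightarrow> real \<Rightarrow> complex) e x. c * f e x) ?\<Psi>"
    by unfold_locales (auto simp: fun_eq_iff bond_wave_def wave_def algebra_simps)
  have subV: "vfun.subspace ?V" by (auto simp: vfun.subspace_def)
  have inj: "inj_on ?\<Psi> ?V"
  proof (rule inj_onI)
    fix x y assume x: "x \<in> ?V" and y: "y \<in> ?V" and eq: "?\<Psi> x = ?\<Psi> y"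
    show "x = y"
    proof
      fix b
      show "x b = y b"
      proof (cases "b \<in> bonds G")
        case True
        let ?e = "fst b" and ?D = "phase L (edge_flux L \<alpha>) k"
        have e: "?e \<in> arcs G" using True by (auto simp: bonds_def)
        have "wave (\<alpha> ?e) k (x (?e, True) - y (?e, True)) (x (?e, False) * ?D (?e, False) - y (?e, False) * ?D (?e, False)) t = 0"
          if "t \<in> {0..L ?e}" for t
          using fun_cong[OF fun_cong[OF eq, of ?e], of t] e that unfolding wave_diff by (simp add: bond_wave_def)
        from wave_eq_0_imp[OF L[OF e] k this]
        have "x (?e, True) = y (?e, True) \<and> x (?e, False) * ?D (?e, False) = y (?e, False) * ?D (?e, False)" by simp
        then have "x (?e, True) = y (?e, True) \<and> x (?e, False) = y (?e, False)" by (simp add: phase_def)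
        then show ?thesis by (cases b; cases "snd b") auto
      next
        case False
        have "x b = 0" "y b = 0" using x y False by blast+
        then show ?thesis by simp
      qed
    qed
  qed
  obtain S where S: "S \<subseteq> ?K" "vfun.independent S" "?K \<subseteq> vfun.span S" "card S = vfun.dim ?K"
    using vfun.basis_exists by blast
  have KV: "?K \<subseteq> ?V" by (auto simp: secular_kernel_def)
  have spV: "vfun.span S \<subseteq> ?V" using S(1) KV subV by (intro vfun.span_minimal) auto
  have "edge_fun.independent (?\<Psi> ` S)"
    by (rule p.linear_independent_injective_image[OF lin S(2) inj_on_subset[OF inj spV]])
  moreover have "?\<Psi> ` ?K \<subseteq> edge_fun.span (?\<Psi> ` S)"
    using S(3) p.linear_span_image[OF lin, of S] by blast
  moreover have "?\<Psi> ` S \<subseteq> ?\<Psi> ` ?K" using S(1) by blast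
  ultimately have "card (?\<Psi> ` S) = edge_fun.dim (?\<Psi> ` ?K)" by (intro edge_fun.basis_card_eq_dim)
  moreover have "card (?\<Psi> ` S) = card S"
    using S(1) KV by (intro card_image inj_on_subset[OF inj]) auto
  ultimately show ?thesis using S(4) eigenspace_eq_image[OF G L \<alpha> k(1)] by simp
qed

section \<open>The spectrum determines the amplitudes\<close>

text \<open>
  The estimate that defines the resolvent set, with right-hand side 0, would force an eigenfunction to vanish.
\<close>

lemma eigenvalue_not_in_resolvent_set:
  assumes fin: "finite (arcs G)" and L: "\<And>e. e \<in> arcs G \<Longrightarrow> L e > 0"
    and f: "f \<in> eigenspace G L \<alpha> z" "f \<noteq> 0"
  shows "z \<notin> resolvent_set G L \<alpha>"
proof
  assume "z \<in> resolvent_set G L \<alpha>"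
  then obtain C where C: "\<And>f g. bloch_laplacian G L \<alpha> f (\<lambda>e x. g e x + z * f e x) \<Longrightarrow> L2_norm G L f \<le> C * L2_norm G L g"
    unfolding resolvent_set_def by blast
  have bl: "bloch_laplacian G L \<alpha> f (\<lambda>e x. z * f e x)"
    and out: "\<And>e x. \<not> (e \<in> arcs G \<and> x \<in> {0..L e}) \<Longrightarrow> f e x = 0" using f(1) by (auto simp: eigenspace_def)
  have "L2_norm G L f \<le> C * L2_norm G L (\<lambda>e x. 0)" using bl by (intro C) simp
  also have "\<dots> = 0" by (simp add: L2_norm_def)
  finally have le: "(\<Sum>e\<in>arcs G. integral {0..L e} (\<lambda>x. (cmod (f e x))\<^sup>2)) \<le> 0"
    by (simp add: L2_norm_def)
  have cont: "continuous_on {0..L e} (f e)" if "e \<in> arcs G" for e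
    using bl that by (auto simp: bloch_laplacian_def bloch_domain_def continuous_on_graph_def)
  have int: "(\<lambda>x. (cmod (f e x))\<^sup>2) integrable_on {0..L e}" if "e \<in> arcs G" for e
    by (intro integrable_continuous_interval continuous_intros cont that)
  have nn: "integral {0..L e} (\<lambda>x. (cmod (f e x))\<^sup>2) \<ge> 0" if "e \<in> arcs G" for e
    by (intro integral_nonneg int that) auto
  have "(\<Sum>e\<in>arcs G. integral {0..L e} (\<lambda>x. (cmod (f e x))\<^sup>2)) = 0"
    using le nn by (intro antisym sum_nonneg) auto
  then have zero: "integral {0..L e} (\<lambda>x. (cmod (f e x))\<^sup>2) = 0" if "e \<in> arcs G" for e
    using sum_nonneg_eq_0_iff[OF fin, of "\<lambda>e. integral {0..L e} (\<lambda>x. (cmod (f e x))\<^sup>2)"] nn that by simp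
  have "f e x = 0" for e x
  proof (cases "e \<in> arcs G \<and> x \<in> {0..L e}")
    case True
    then have e: "e \<in> arcs G" by simp
    have "continuous_on {0..L e} (\<lambda>x. (cmod (f e x))\<^sup>2)" by (intro continuous_intros cont e)
    then have "\<forall>x\<in>{0..L e}. (cmod (f e x))\<^sup>2 = 0"
      using zero[OF e] integral_eq_0_iff[of 0 "L e" "\<lambda>x. (cmod (f e x))\<^sup>2"] L[OF e] by simp
    then have "(cmod (f e x))\<^sup>2 = 0" using True by blast
    then show ?thesis by simp
  next
    case False
    then show ?thesis by (rule out)
  qed
  then have "f = (\<lambda>e x. 0)" by blast
  also have "\<dots> = 0" unfolding zero_fun_def ..
  finally show False using f(2) by contradiction
qed

lemma eigenvalue_in_Spec:
  assumes fin: "finite (arcs G)" and L: "\<And>e. e \<in> arcs G \<Longrightarrow> L e > 0"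
    and dim: "edge_fun.dim (eigenspace G L \<alpha> z) \<noteq> 0"
  shows "(z, edge_fun.dim (eigenspace G L \<alpha> z)) \<in> Spec G L \<alpha>"
proof -
  obtain B where B: "B \<subseteq> eigenspace G L \<alpha> z" "edge_fun.independent B" "card B = edge_fun.dim (eigenspace G L \<alpha> z)"
    by (rule edge_fun.basis_exists[of "eigenspace G L \<alpha> z"])
  have "B \<noteq> {}" using B(3) dim by auto
  then obtain f where f: "f \<in> B" by blast
  have "f \<noteq> 0"
  proof
    assume "f = 0"
    with f have "edge_fun.dependent B" by (intro edge_fun.dependent_zero) simp
    with B(2) show False by contradiction
  qed
  moreover have "f \<in> eigenspace G L \<alpha> z" using f B(1) by (rule subsetD[rotated])
  ultimately have "z \<notin> resolvent_set G L \<alpha>"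
    by (intro eigenvalue_not_in_resolvent_set[OF fin L])
  then show ?thesis unfolding Spec_def by simp
qed

text \<open>
  The spectrum records dimensions only outside the resolvent set, but every point with a nonzero eigenspace lies
  there.
\<close>

lemma Spec_eq_imp_dim_eq:
  assumes G: "finite (arcs G)" "\<And>e. e \<in> arcs G \<Longrightarrow> L e > 0"
    and G': "finite (arcs G')" "\<And>e. e \<in> arcs G' \<Longrightarrow> L' e > 0"
    and eq: "Spec G L \<alpha> = Spec G' L' \<alpha>'"
  shows "edge_fun.dim (eigenspace G L \<alpha> z) = edge_fun.dim (eigenspace G' L' \<alpha>' z)"
proof (cases "edge_fun.dim (eigenspace G L \<alpha> z) = 0")
  case False
  from eigenvalue_in_Spec[OF G this] show ?thesis unfolding eq by (simp add: Spec_def)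
next
  case True
  have "edge_fun.dim (eigenspace G' L' \<alpha>' z) = 0"
  proof (rule ccontr)
    assume ne: "edge_fun.dim (eigenspace G' L' \<alpha>' z) \<noteq> 0"
    from eigenvalue_in_Spec[OF G' this] show False
      unfolding eq[symmetric] using True ne by (simp add: Spec_def)
  qed
  then show ?thesis using True by simp
qed

text \<open>
  Only the empty set of bonds has length 0, so the secular determinant has constant term 1.
\<close>

lemma amp_sum_at_0:
  assumes fin: "finite (arcs G)" and L: "\<And>e. e \<in> arcs G \<Longrightarrow> L e > 0"
  shows "(\<Sum>h\<in>net ` Pow (bonds G). amp G L h 0 * flow_char G \<theta> h) = 1"
proof -
  have X0: "X = {}" if X: "X \<subseteq> bonds G" "bond_length L X = 0" for X
  proof (rule ccontr)
    assume "X \<noteq> {}"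
    then have "bond_length L X > 0" unfolding bond_length_def
      using X(1) L finite_subset[OF X(1) finite_bonds[OF fin]] by (intro sum_pos) (auto simp: bonds_def)
    then show False using X(2) by simp
  qed
  have net0: "net {} = (\<lambda>e. 0)" by (simp add: net_def[abs_def])
  have "amp G L h 0 = (if h = (\<lambda>e. 0) then 1 else 0)" for h
  proof -
    have "{X. X \<subseteq> bonds G \<and> net X = h \<and> bond_length L X = 0} = (if h = (\<lambda>e. 0) then {{}} else {})"
      using X0 net0 by (auto simp: bond_length_def)
    then show ?thesis by (simp add: amp_def pcoeff_empty)
  qed
  then have "(\<Sum>h\<in>net ` Pow (bonds G). amp G L h 0 * flow_char G \<theta> h) =
      (\<Sum>h\<in>net ` Pow (bonds G). if h = (\<lambda>e. 0) then flow_char G \<theta> h else 0)"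
    by (intro sum.cong) auto
  also have "\<dots> = 1"
  proof -
    have "net {} \<in> net ` Pow (bonds G)" by (intro imageI) simp
    then have "(\<lambda>e. 0) \<in> net ` Pow (bonds G)" by (simp only: net0)
    then show ?thesis using finite_bonds[OF fin] by (simp add: sum.delta' flow_char_def)
  qed
  finally show ?thesis .
qed

text \<open>
  Away from \<open>k = 0\<close> the order of the secular determinant at a real \<open>k\<close> is the multiplicity of \<open>k\<^sup>2\<close>, and there are no
  nonreal zeros. At \<open>k = 0\<close> the order need not be the multiplicity, which is why the theorem on sums of exponentials
  leaves the orders at 0 open.
\<close>

theorem Spec_determines_amplitudes:
  assumes G: "quantum_graph G L" "one_form G L \<alpha>" and G': "quantum_graph G' L'" "one_form G' L' \<alpha>'"
    and eq: "Spec G L \<alpha> = Spec G' L' \<alpha>'"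
  shows "(\<Sum>h\<in>net ` Pow (bonds G). amp G L h l * flow_char G (edge_flux L \<alpha>) h) =
    (\<Sum>h\<in>net ` Pow (bonds G'). amp G' L' h l * flow_char G' (edge_flux L' \<alpha>') h)"
proof -
  interpret G: quantum_graph G L by fact
  interpret G': quantum_graph G' L' by fact
  have fin: "finite (arcs G)" "finite (arcs G')" by simp_all
  define T where "T = insert l (bond_length L ` Pow (bonds G) \<union> bond_length L' ` Pow (bonds G'))"
  \<comment> \<open>A negative \<open>l\<close> is admitted in the statement, where both sides vanish.\<close>
  define T' where "T' = T \<inter> {0..}"
  define c where "c l = (\<Sum>h\<in>net ` Pow (bonds G). amp G L h l * flow_char G (edge_flux L \<alpha>) h)" for l
  define c' where "c' l = (\<Sum>h\<in>net ` Pow (bonds G'). amp G' L' h l * flow_char G' (edge_flux L' \<alpha>') h)" for l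
  have pos: "bond_length L X \<ge> 0" if "X \<subseteq> bonds G" for X
    unfolding bond_length_def using that G.length_pos by (intro sum_nonneg) (auto simp: bonds_def less_imp_le)
  have pos': "bond_length L' X \<ge> 0" if "X \<subseteq> bonds G'" for X
    unfolding bond_length_def using that G'.length_pos by (intro sum_nonneg) (auto simp: bonds_def less_imp_le)
  have T': "finite T'" "T' \<subseteq> {0..}" "0 \<in> T'"
  proof -
    have "bond_length L {} \<in> T" unfolding T_def by blast
    then show "0 \<in> T'" by (simp add: T'_def bond_length_def)
  qed (use fin in \<open>auto simp: T'_def T_def finite_bonds\<close>)
  have ce: "secular G L (edge_flux L \<alpha>) = expsum T' c" "secular G' L' (edge_flux L' \<alpha>') = expsum T' c'"
    unfolding c_def[abs_def] c'_def[abs_def]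
    by (intro ext secular_expansion fin T'; use pos pos' in \<open>auto simp: T'_def T_def\<close>)+
  have c1: "c 0 = 1" "c' 0 = 1"
    unfolding c_def c'_def using amp_sum_at_0 fin G.length_pos G'.length_pos by blast+
  have "c m = c' m" if "m \<in> T'" for m
  proof (rule expsum_determined_by_zeros[of T' c c' m, OF T' c1])
    fix k :: complex assume k: "k \<noteq> 0"
    show "\<exists>n. has_order (expsum T' c) k n \<and> has_order (expsum T' c') k n"
    proof (cases "Im k = 0")
      case True
      have dims: "vfun.dim (secular_kernel G L (edge_flux L \<alpha>) k) = vfun.dim (secular_kernel G' L' (edge_flux L' \<alpha>') k)"
        using dim_eigenspace[OF G.fin_digraph_axioms G.length_pos G(2) k True]
          dim_eigenspace[OF G'.fin_digraph_axioms G'.length_pos G'(2) k True]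
          Spec_eq_imp_dim_eq[of G L G' L', OF fin(1) G.length_pos fin(2) G'.length_pos eq] by simp
      show ?thesis
        unfolding ce[symmetric]
        by (intro exI conjI, rule secular_has_order[OF fin(1) G.length_pos True], assumption,
            unfold dims, rule secular_has_order[OF fin(2) G'.length_pos True])
    next
      case False
      show ?thesis
        using secular_has_order_nonreal[where L = L, OF fin(1) G.length_pos False] secular_has_order_nonreal[where L = L', OF fin(2) G'.length_pos False]
        unfolding ce[symmetric] by blast
    qed
  next
    show "\<exists>a. has_order (expsum T' c) 0 a" "\<exists>b. has_order (expsum T' c') 0 b"
      using secular_has_order[where L = L and k = 0, OF fin(1) G.length_pos]
        secular_has_order[where L = L' and k = 0, OF fin(2) G'.length_pos]
      unfolding ce[symmetric] by auto
  next
    show "m \<in> T'" by fact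
  qed
  moreover have "c l = c' l" if "l \<notin> T'"
  proof -
    have neg: "l < 0" using that by (simp add: T'_def T_def)
    have "amp G L h l = 0" for h
    proof (rule ccontr)
      assume "amp G L h l \<noteq> 0"
      then obtain X where "X \<subseteq> bonds G" "bond_length L X = l" using amp_nonzeroD by blast
      then show False using pos[of X] neg by simp
    qed
    moreover have "amp G' L' h l = 0" for h
    proof (rule ccontr)
      assume "amp G' L' h l \<noteq> 0"
      then obtain X where "X \<subseteq> bonds G'" "bond_length L' X = l" using amp_nonzeroD by blast
      then show False using pos'[of X] neg by simp
    qed
    ultimately show ?thesis by (simp add: c_def c'_def)
  qed
  ultimately have "c l = c' l" by blast
  then show ?thesis by (simp add: c_def c'_def)
qed

section \<open>Forms, cohomology classes and the torus\<close>

lemma smooth_upto_cmult: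
  fixes u :: "real \<Rightarrow> real"
  assumes "smooth_upto l u" shows "smooth_upto l (\<lambda>x. r * u x)"
proof -
  obtain D where D: "D 0 = u" "\<And>n x. x \<in> {0..l} \<Longrightarrow> (D n has_vector_derivative D (Suc n) x) (at x within {0..l})"
    using assms unfolding smooth_upto_def by blast
  then show ?thesis unfolding smooth_upto_def
    by (intro exI[of _ "\<lambda>n x. r * D n x"]) (auto intro!: has_vector_derivative_mult_right)
qed

lemma smooth_upto_add:
  fixes u :: "real \<Rightarrow> real"
  assumes "smooth_upto l u" "smooth_upto l v" shows "smooth_upto l (\<lambda>x. u x + v x)"
proof -
  obtain D where D: "D 0 = u" "\<And>n x. x \<in> {0..l} \<Longrightarrow> (D n has_vector_derivative D (Suc n) x) (at x within {0..l})"
    using assms(1) unfolding smooth_upto_def by blast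
  obtain E where E: "E 0 = v" "\<And>n x. x \<in> {0..l} \<Longrightarrow> (E n has_vector_derivative E (Suc n) x) (at x within {0..l})"
    using assms(2) unfolding smooth_upto_def by blast
  from D E show ?thesis unfolding smooth_upto_def
    by (intro exI[of _ "\<lambda>n x. D n x + E n x"]) (auto intro!: has_vector_derivative_add)
qed

lemma smooth_upto_const: "smooth_upto l (\<lambda>x. c :: real)"
  unfolding smooth_upto_def
  by (intro exI[of _ "\<lambda>n x. if n = 0 then c else 0"]) (auto intro!: derivative_eq_intros)

lemma smooth_upto_derivative:
  fixes u :: "real \<Rightarrow> real"
  assumes "smooth_upto l u" "l > 0" "x \<in> {0..l}"
  shows "(u has_vector_derivative vector_derivative u (at x within {0..l})) (at x within {0..l})"
proof -
  obtain d where "(u has_vector_derivative d) (at x within {0..l})"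
    using assms unfolding smooth_upto_def by metis
  moreover from this have "vector_derivative u (at x within {0..l}) = d"
    by (intro vector_derivative_within_closed_interval[OF assms(2,3)])
  ultimately show ?thesis by simp
qed

lemma normal_sum_add: "normal_sum G L (\<lambda>e x. u e x + v e x) w = normal_sum G L u w + normal_sum G L v w"
  by (simp add: normal_sum_def sum.distrib algebra_simps)

lemma normal_sum_cmult: "normal_sum G L (\<lambda>e x. r * u e x) w = (r::real) * normal_sum G L u w"
  by (simp add: normal_sum_def sum_distrib_left algebra_simps)

lemma one_form_add: "one_form G L \<alpha> \<Longrightarrow> one_form G L \<beta> \<Longrightarrow> one_form G L (\<alpha> + \<beta>)"
  unfolding one_form_def plus_fun_def by (auto simp: normal_sum_add intro: smooth_upto_add)

lemma one_form_cmult: "one_form G L \<alpha> \<Longrightarrow> one_form G L (\<lambda>e x. r * \<alpha> e x)"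
  unfolding one_form_def by (auto simp: normal_sum_cmult intro: smooth_upto_cmult)

lemma one_form_uminus: "one_form G L \<alpha> \<Longrightarrow> one_form G L (- \<alpha>)"
  using one_form_cmult[of G L \<alpha> "-1"] by (simp add: fun_Compl_def)

lemma one_form_0: "one_form G L 0"
  unfolding one_form_def zero_fun_def by (auto simp: smooth_upto_const normal_sum_def)

lemma (in quantum_graph) edge_deriv_linear:
  fixes f g :: "'e \<Rightarrow> real \<Rightarrow> real"
  assumes "e \<in> arcs G" "smooth_upto (L e) (f e)" "smooth_upto (L e) (g e)" "x \<in> {0..L e}"
  shows "edge_deriv L (\<lambda>e x. f e x + r * g e x) e x = edge_deriv L f e x + r * edge_deriv L g e x"
  unfolding edge_deriv_def
  using assms length_pos[OF assms(1)]
  by (intro vector_derivative_within_closed_interval has_vector_derivative_add has_vector_derivative_mult_right smooth_upto_derivative)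

lemma (in quantum_graph) zero_form_linear:
  assumes f: "zero_form G L f" and g: "zero_form G L g"
  shows "zero_form G L (\<lambda>e x. f e x + r * g e x)"
proof -
  obtain \<phi> \<psi> where \<phi>: "\<forall>e\<in>arcs G. f e 0 = \<phi> (tail G e) \<and> f e (L e) = \<phi> (head G e)"
    and \<psi>: "\<forall>e\<in>arcs G. g e 0 = \<psi> (tail G e) \<and> g e (L e) = \<psi> (head G e)"
    using f g unfolding zero_form_def continuous_on_graph_def by blast
  have sm: "smooth_upto (L e) (f e)" "smooth_upto (L e) (g e)" if "e \<in> arcs G" for e
    using f g that by (auto simp: zero_form_def)
  have "continuous_on_graph G L (\<lambda>e x. f e x + r * g e x)"
    unfolding continuous_on_graph_def
  proof (intro conjI ballI exI[of _ "\<lambda>v. \<phi> v + r * \<psi> v"])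
    fix e assume "e \<in> arcs G"
    then show "continuous_on {0..L e} (\<lambda>x. f e x + r * g e x)"
      using f g by (auto simp: zero_form_def continuous_on_graph_def intro!: continuous_intros)
  qed (use \<phi> \<psi> in auto)
  moreover have "kirchhoff G L (\<lambda>e x. f e x + r * g e x)"
    unfolding kirchhoff_def
  proof
    fix v assume v: "v \<in> verts G"
    have "normal_sum G L (edge_deriv L (\<lambda>e x. f e x + r * g e x)) v =
        normal_sum G L (\<lambda>e x. edge_deriv L f e x + r * edge_deriv L g e x) v"
      unfolding normal_sum_def using length_pos sm
      by (intro arg_cong2[where f = "(-)"] sum.cong refl) (auto intro!: edge_deriv_linear less_imp_le)
    also have "\<dots> = 0"
      unfolding normal_sum_add normal_sum_cmult using f g v by (auto simp: zero_form_def kirchhoff_def)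
    finally show "normal_sum G L (edge_deriv L (\<lambda>e x. f e x + r * g e x)) v = 0" .
  qed
  ultimately show ?thesis using sm by (auto simp: zero_form_def intro!: smooth_upto_add smooth_upto_cmult)
qed

lemma (in quantum_graph) exact_forms_linear:
  assumes "\<alpha> \<in> exact_forms G L" "\<beta> \<in> exact_forms G L"
  shows "(\<lambda>e x. \<alpha> e x + r * \<beta> e x) \<in> exact_forms G L"
proof -
  obtain f where f: "one_form G L \<alpha>" "zero_form G L f" "\<And>e x. e \<in> arcs G \<Longrightarrow> x \<in> {0..L e} \<Longrightarrow> \<alpha> e x = edge_deriv L f e x"
    using assms(1) unfolding exact_forms_def by blast
  obtain g where g: "one_form G L \<beta>" "zero_form G L g" "\<And>e x. e \<in> arcs G \<Longrightarrow> x \<in> {0..L e} \<Longrightarrow> \<beta> e x = edge_deriv L g e x"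
    using assms(2) unfolding exact_forms_def by blast
  have "one_form G L (\<lambda>e x. \<alpha> e x + r * \<beta> e x)"
    using one_form_add[OF f(1) one_form_cmult[OF g(1), of r]] by (simp add: plus_fun_def)
  moreover have "\<alpha> e x + r * \<beta> e x = edge_deriv L (\<lambda>e x. f e x + r * g e x) e x" if "e \<in> arcs G" "x \<in> {0..L e}" for e x
    using f g that by (subst edge_deriv_linear) (auto simp: zero_form_def)
  ultimately show ?thesis
    unfolding exact_forms_def using zero_form_linear[OF f(2) g(2), of r] by blast
qed

lemma (in quantum_graph) edge_deriv_0:
  assumes "e \<in> arcs G" "x \<in> {0..L e}"
  shows "edge_deriv L (\<lambda>e x. 0 :: real) e x = 0"
  unfolding edge_deriv_def
  using assms length_pos[OF assms(1)]
  by (intro vector_derivative_within_closed_interval) (auto intro!: derivative_eq_intros)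

lemma (in quantum_graph) zero_form_0: "zero_form G L (\<lambda>e x. 0)"
proof -
  have "normal_sum G L (edge_deriv L (\<lambda>e x. 0 :: real)) v = 0" for v
    unfolding normal_sum_def using length_pos by (auto simp: edge_deriv_0 less_imp_le)
  then show ?thesis
    unfolding zero_form_def continuous_on_graph_def kirchhoff_def by (auto simp: smooth_upto_const)
qed

lemma (in quantum_graph) exact_forms_0: "0 \<in> exact_forms G L"
  unfolding exact_forms_def
  by (intro CollectI conjI exI[of _ "\<lambda>e x. 0"] one_form_0 zero_form_0) (simp add: edge_deriv_0)

lemma one_forms_simps [simp]:
  "carrier (one_forms G L) = {\<alpha>. one_form G L \<alpha>}" "\<alpha> \<otimes>\<^bsub>one_forms G L\<^esub> \<beta> = \<alpha> + \<beta>" "\<one>\<^bsub>one_forms G L\<^esub> = 0"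
  by (simp_all add: one_forms_def)

lemma one_forms_comm_group: "comm_group (one_forms G L)"
proof (rule comm_groupI)
  fix \<alpha> assume "\<alpha> \<in> carrier (one_forms G L)"
  then show "\<exists>\<beta>\<in>carrier (one_forms G L). \<beta> \<otimes>\<^bsub>one_forms G L\<^esub> \<alpha> = \<one>\<^bsub>one_forms G L\<^esub>"
    by (intro bexI[of _ "- \<alpha>"]) (auto intro: one_form_uminus)
qed (auto intro: one_form_add one_form_0 simp: algebra_simps)

lemma inv_one_forms:
  assumes "one_form G L \<alpha>" shows "inv\<^bsub>one_forms G L\<^esub> \<alpha> = - \<alpha>"
proof -
  interpret comm_group "one_forms G L" by (rule one_forms_comm_group)
  show ?thesis by (rule inv_equality) (use assms one_form_uminus in auto)
qed

lemma (in quantum_graph) exact_forms_subgroup: "subgroup (exact_forms G L) (one_forms G L)"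
proof
  show "exact_forms G L \<subseteq> carrier (one_forms G L)" by (auto simp: exact_forms_def)
  show "\<one>\<^bsub>one_forms G L\<^esub> \<in> exact_forms G L" by (simp add: exact_forms_0)
  fix \<alpha> assume \<alpha>: "\<alpha> \<in> exact_forms G L"
  have "(\<lambda>e x. 0 e x + (-1) * \<alpha> e x) \<in> exact_forms G L"
    by (intro exact_forms_linear exact_forms_0 \<alpha>)
  moreover have "one_form G L \<alpha>" using \<alpha> by (simp add: exact_forms_def)
  ultimately show "inv\<^bsub>one_forms G L\<^esub> \<alpha> \<in> exact_forms G L"
    by (simp add: inv_one_forms fun_Compl_def)
  fix \<beta> assume \<beta>: "\<beta> \<in> exact_forms G L"
  have "(\<lambda>e x. \<alpha> e x + 1 * \<beta> e x) \<in> exact_forms G L" by (intro exact_forms_linear \<alpha> \<beta>)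
  then show "\<alpha> \<otimes>\<^bsub>one_forms G L\<^esub> \<beta> \<in> exact_forms G L" by (simp add: plus_fun_def)
qed

lemma (in quantum_graph) H1_comm_group: "comm_group (H1 G L)"
  unfolding H1_def by (rule comm_group.abelian_FactGroup[OF one_forms_comm_group exact_forms_subgroup])

lemma (in quantum_graph) exact_forms_normal: "normal (exact_forms G L) (one_forms G L)"
  by (rule comm_group.subgroup_imp_normal[OF one_forms_comm_group exact_forms_subgroup])

lemma (in quantum_graph) H1_class_add:
  assumes "one_form G L \<alpha>" "one_form G L \<beta>"
  shows "H1_class G L (\<alpha> + \<beta>) = H1_class G L \<alpha> \<otimes>\<^bsub>H1 G L\<^esub> H1_class G L \<beta>"
  using normal.rcos_sum[OF exact_forms_normal, of \<alpha> \<beta>] assms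
  by (simp add: H1_class_def H1_def FactGroup_def)

lemma carrier_H1: "carrier (H1 G L) = H1_class G L ` {\<alpha>. one_form G L \<alpha>}"
  by (auto simp: H1_def FactGroup_def RCOSETS_def H1_class_def)

text \<open>
  The fundamental theorem of calculus on each edge; continuity glues the edges together. So exact forms integrate to 0 over closed
  walks.
\<close>

lemma walk_integral_exact:
  assumes "quantum_graph G L" "\<alpha> \<in> exact_forms G L" and w: "walk G u w v"
  shows "\<exists>\<phi>. \<forall>u w v. walk G u w v \<longrightarrow> walk_integral L \<alpha> w = \<phi> v - \<phi> u"
proof -
  interpret quantum_graph G L by fact
  obtain f where f: "zero_form G L f" "\<And>e x. e \<in> arcs G \<Longrightarrow> x \<in> {0..L e} \<Longrightarrow> \<alpha> e x = edge_deriv L f e x"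
    using assms(2) unfolding exact_forms_def by blast
  obtain \<phi> where \<phi>: "\<And>e. e \<in> arcs G \<Longrightarrow> f e 0 = \<phi> (tail G e) \<and> f e (L e) = \<phi> (head G e)"
    using f(1) unfolding zero_form_def continuous_on_graph_def by blast
  have int: "integral {0..L e} (\<alpha> e) = \<phi> (head G e) - \<phi> (tail G e)" if e: "e \<in> arcs G" for e
  proof -
    have "(\<alpha> e has_integral (f e (L e) - f e 0)) {0..L e}"
    proof (rule fundamental_theorem_of_calculus)
      fix x assume x: "x \<in> {0..L e}"
      show "(f e has_vector_derivative \<alpha> e x) (at x within {0..L e})"
        using f(1) e x length_pos[OF e] unfolding f(2)[OF e x] edge_deriv_def
        by (intro smooth_upto_derivative) (auto simp: zero_form_def)
    qed (use length_pos[OF e] in auto)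
    then show ?thesis using \<phi>[OF e] by (simp add: integral_unique)
  qed
  have "walk_integral L \<alpha> w = \<phi> v - \<phi> u" if "walk G u w v" for u w v
    using that by (induction w arbitrary: u) (auto simp: walk_integral_def int split: if_splits)
  then show ?thesis by blast
qed

lemma walk_integral_linear:
  assumes "one_form G L \<alpha>" "one_form G L \<beta>" "walk G u w v"
  shows "walk_integral L (\<lambda>e x. \<alpha> e x + r * \<beta> e x) w = walk_integral L \<alpha> w + r * walk_integral L \<beta> w"
proof -
  have "integral {0..L e} (\<lambda>x. \<alpha> e x + r * \<beta> e x) = integral {0..L e} (\<alpha> e) + r * integral {0..L e} (\<beta> e)"
    if "e \<in> arcs G" for e
  proof -
    have "continuous_on {0..L e} (\<alpha> e)" "continuous_on {0..L e} (\<beta> e)"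
      using assms(1,2) that by (auto simp: one_form_def intro!: smooth_upto_continuous)
    then show ?thesis
      by (subst integral_add) (auto intro!: integrable_continuous_interval continuous_intros)
  qed
  then show ?thesis using assms(3)
    by (induction w arbitrary: u) (auto simp: walk_integral_def algebra_simps split: if_splits)
qed

lemma (in quantum_graph) H1_class_eq: "H1_class G L \<alpha> = {\<epsilon> + \<alpha> |\<epsilon>. \<epsilon> \<in> exact_forms G L}"
  by (auto simp: H1_class_def r_coset_def)

lemma (in quantum_graph) H1_class_mem_H1_int_iff:
  assumes \<alpha>: "one_form G L \<alpha>"
  shows "H1_class G L \<alpha> \<in> H1_int G L \<longleftrightarrow> (\<forall>v w. walk G v w v \<longrightarrow> walk_integral L \<alpha> w \<in> \<int>)"
proof -
  have "walk_integral L (\<epsilon> + \<alpha>) w = walk_integral L \<alpha> w" if \<epsilon>: "\<epsilon> \<in> exact_forms G L" and w: "walk G v w v" for \<epsilon> v w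
  proof -
    have "walk_integral L (\<lambda>e x. \<epsilon> e x + 1 * \<alpha> e x) w = walk_integral L \<epsilon> w + 1 * walk_integral L \<alpha> w"
      using \<epsilon> by (intro walk_integral_linear[OF _ \<alpha> w]) (simp add: exact_forms_def)
    moreover have "walk_integral L \<epsilon> w = 0"
      using walk_integral_exact[OF quantum_graph_axioms \<epsilon>] w by fastforce
    ultimately show ?thesis by (simp add: plus_fun_def)
  qed
  moreover have "H1_class G L \<alpha> \<in> carrier (H1 G L)" using \<alpha> by (auto simp: carrier_H1)
  moreover have "0 + \<alpha> \<in> H1_class G L \<alpha>" unfolding H1_class_eq using exact_forms_0 by blast
  ultimately show ?thesis unfolding H1_int_def H1_class_eq by auto
qed

lemma (in quantum_graph) H1_int_subgroup: "subgroup (H1_int G L) (H1 G L)"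
proof -
  interpret H1: comm_group "H1 G L" by (rule H1_comm_group)
  have one: "H1_class G L 0 = \<one>\<^bsub>H1 G L\<^esub>"
    by (auto simp: H1_class_eq H1_def)
  have inv: "inv\<^bsub>H1 G L\<^esub> (H1_class G L \<alpha>) = H1_class G L (- \<alpha>)" if "one_form G L \<alpha>" for \<alpha>
  proof (rule H1.inv_equality)
    show "H1_class G L (- \<alpha>) \<otimes>\<^bsub>H1 G L\<^esub> H1_class G L \<alpha> = \<one>\<^bsub>H1 G L\<^esub>"
      using H1_class_add[OF one_form_uminus[OF that] that] one by simp
  qed (use that one_form_uminus in \<open>auto simp: carrier_H1\<close>)
  show ?thesis
  proof
    show "H1_int G L \<subseteq> carrier (H1 G L)" by (auto simp: H1_int_def)
    have "walk_integral L (0 :: 'e \<Rightarrow> real \<Rightarrow> real) w = 0" for w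
      by (induction w) (auto simp: walk_integral_def)
    then show "\<one>\<^bsub>H1 G L\<^esub> \<in> H1_int G L"
      unfolding one[symmetric] H1_class_mem_H1_int_iff[OF one_form_0] by simp
  next
    fix a assume a: "a \<in> H1_int G L"
    then obtain \<alpha> where \<alpha>: "a = H1_class G L \<alpha>" "one_form G L \<alpha>" by (auto simp: H1_int_def carrier_H1)
    have "walk_integral L (- \<alpha>) w \<in> \<int>" if w: "walk G v w v" for v w
    proof -
      have "walk_integral L (\<lambda>e x. 0 e x + (-1) * \<alpha> e x) w = walk_integral L 0 w + (-1) * walk_integral L \<alpha> w"
        by (intro walk_integral_linear[OF one_form_0 \<alpha>(2) w])
      moreover have "walk_integral L (0 :: 'e \<Rightarrow> real \<Rightarrow> real) w = 0"
        by (induction w) (auto simp: walk_integral_def)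
      moreover have "walk_integral L \<alpha> w \<in> \<int>" using a w H1_class_mem_H1_int_iff[OF \<alpha>(2)] \<alpha>(1) by blast
      ultimately show ?thesis by (simp add: fun_Compl_def)
    qed
    then show "inv\<^bsub>H1 G L\<^esub> a \<in> H1_int G L"
      unfolding \<alpha>(1) inv[OF \<alpha>(2)] H1_class_mem_H1_int_iff[OF one_form_uminus[OF \<alpha>(2)]] by blast
    fix b assume b: "b \<in> H1_int G L"
    then obtain \<beta> where \<beta>: "b = H1_class G L \<beta>" "one_form G L \<beta>" by (auto simp: H1_int_def carrier_H1)
    have "walk_integral L (\<alpha> + \<beta>) w \<in> \<int>" if w: "walk G v w v" for v w
    proof -
      have "walk_integral L (\<lambda>e x. \<alpha> e x + 1 * \<beta> e x) w = walk_integral L \<alpha> w + 1 * walk_integral L \<beta> w"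
        by (intro walk_integral_linear[OF \<alpha>(2) \<beta>(2) w])
      moreover have "walk_integral L \<alpha> w \<in> \<int>" using a w H1_class_mem_H1_int_iff[OF \<alpha>(2)] \<alpha>(1) by blast
      moreover have "walk_integral L \<beta> w \<in> \<int>" using b w H1_class_mem_H1_int_iff[OF \<beta>(2)] \<beta>(1) by blast
      ultimately show ?thesis by (simp add: plus_fun_def)
    qed
    then show "a \<otimes>\<^bsub>H1 G L\<^esub> b \<in> H1_int G L"
      unfolding \<alpha>(1) \<beta>(1) H1_class_add[OF \<alpha>(2) \<beta>(2), symmetric]
        H1_class_mem_H1_int_iff[OF one_form_add[OF \<alpha>(2) \<beta>(2)]] by blast
  qed
qed

lemma (in quantum_graph) torus_class_add:
  assumes "one_form G L \<alpha>" "one_form G L \<beta>"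
  shows "torus_class G L (\<alpha> + \<beta>) = torus_class G L \<alpha> \<otimes>\<^bsub>torus G L\<^esub> torus_class G L \<beta>"
proof -
  have "normal (H1_int G L) (H1 G L)"
    by (rule comm_group.subgroup_imp_normal[OF H1_comm_group H1_int_subgroup])
  from normal.rcos_sum[OF this, of "H1_class G L \<alpha>" "H1_class G L \<beta>"] show ?thesis
    using assms by (auto simp: torus_class_def torus_def H1_class_add carrier_H1)
qed

lemma carrier_torus: "carrier (torus G L) = torus_class G L ` {\<alpha>. one_form G L \<alpha>}"
  by (auto simp: torus_def FactGroup_def RCOSETS_def torus_class_def carrier_H1)

lemma edge_flux_add:
  assumes "one_form G L \<alpha>" "one_form G L \<beta>" "e \<in> arcs G"
  shows "edge_flux L (\<alpha> + \<beta>) e = edge_flux L \<alpha> e + edge_flux L \<beta> e"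
  unfolding edge_flux_def plus_fun_def
  using assms by (intro integral_add integrable_continuous_interval smooth_upto_continuous) (auto simp: one_form_def)

lemma flow_char_add_form:
  assumes "one_form G L \<alpha>" "one_form G L \<beta>"
  shows "flow_char G (edge_flux L (\<alpha> + \<beta>)) h = flow_char G (edge_flux L \<alpha>) h * flow_char G (edge_flux L \<beta>) h"
proof -
  have "(\<Sum>e\<in>arcs G. of_int (h e) * edge_flux L (\<alpha> + \<beta>) e) =
      (\<Sum>e\<in>arcs G. of_int (h e) * edge_flux L \<alpha> e) + (\<Sum>e\<in>arcs G. of_int (h e) * edge_flux L \<beta> e)"
    unfolding sum.distrib[symmetric]
    by (intro sum.cong refl) (simp add: edge_flux_add[OF assms] algebra_simps)
  then show ?thesis by (simp add: flow_char_def exp_add[symmetric] algebra_simps)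
qed

lemma flow_char_nonzero: "flow_char G \<theta> h \<noteq> 0" by (simp add: flow_char_def)

lemma flow_char_diff: "flow_char G \<theta> (h - h') = flow_char G \<theta> h / flow_char G \<theta> h'"
  by (simp add: flow_char_def exp_diff[symmetric] sum_subtractf algebra_simps)

text \<open>
  Conservation of the flow at a vertex is the vertex condition for the form with these constant coefficients.
\<close>

lemma flow_one_form:
  assumes "fin_digraph G" "h \<in> cycles G"
  shows "one_form G L (\<lambda>e x. r * of_int (h e))"
proof -
  interpret fin_digraph G by fact
  have "normal_sum G L (\<lambda>e x. real_of_int (h e)) v = 0" for v
  proof -
    have "normal_sum G L (\<lambda>e x. real_of_int (h e)) v = real_of_int (bdry G h v)"
      unfolding normal_sum_def bdry_def in_arcs_def out_arcs_def
        sum.inter_filter[OF finite_arcs] of_int_sum sum_subtractf[symmetric]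
      by (intro sum.cong refl) auto
    then show ?thesis using assms(2) by (simp add: cycles_def)
  qed
  then have "one_form G L (\<lambda>e x. of_int (h e))" by (simp add: one_form_def smooth_upto_const)
  then show ?thesis by (rule one_form_cmult)
qed

text \<open>
  A form proportional to \<open>d = h - h'\<close> pairs with \<open>d\<close> to a multiple of \<open>\<Sum>e. L e * (d e)\<^sup>2 > 0\<close>. It is scaled such that the
  pairing is \<open>1/2\<close>, where the character has the value \<open>- 1\<close>.
\<close>

lemma flow_chars_separate:
  assumes G: "fin_digraph G" and L: "\<And>e. e \<in> arcs G \<Longrightarrow> L e > 0"
    and h: "h \<in> cycles G" "h' \<in> cycles G" "h \<noteq> h'"
  shows "\<exists>\<alpha>. one_form G L \<alpha> \<and> flow_char G (edge_flux L \<alpha>) h \<noteq> flow_char G (edge_flux L \<alpha>) h'"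
proof -
  interpret fin_digraph G by fact
  let ?d = "h - h'"
  have d: "?d \<in> cycles G" using h by (auto simp: cycles_def bdry_def left_diff_distrib sum_subtractf)
  define s where "s = (\<Sum>e\<in>arcs G. L e * (real_of_int (?d e))\<^sup>2)"
  have "s > 0"
  proof -
    obtain e where e: "h e \<noteq> h' e" using h(3) by blast
    have "e \<in> arcs G"
    proof (rule ccontr)
      assume "e \<notin> arcs G"
      then have "h e = 0" "h' e = 0" using h by (simp_all add: cycles_def)
      then show False using e by simp
    qed
    show ?thesis unfolding s_def
    proof (rule sum_pos2)
      show "0 < L e * (real_of_int (?d e))\<^sup>2" using L[OF \<open>e \<in> arcs G\<close>] e by simp
      show "0 \<le> L i * (real_of_int (?d i))\<^sup>2" if "i \<in> arcs G" for i using L[OF that] by simp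
    qed (use \<open>e \<in> arcs G\<close> in auto)
  qed
  define \<alpha> where "\<alpha> = (\<lambda>e (x::real). 1 / (2 * s) * real_of_int (?d e))"
  have "one_form G L \<alpha>" unfolding \<alpha>_def by (rule flow_one_form[OF G d])
  have "edge_flux L \<alpha> e = L e * real_of_int (?d e) / (2 * s)" if "e \<in> arcs G" for e
    unfolding edge_flux_def \<alpha>_def using L[OF that] by simp
  then have "(\<Sum>e\<in>arcs G. of_int (?d e) * edge_flux L \<alpha> e) = (\<Sum>e\<in>arcs G. L e * (real_of_int (?d e))\<^sup>2 / (2 * s))"
    by (intro sum.cong refl) (simp add: power2_eq_square)
  also have "\<dots> = 1 / 2" using \<open>s > 0\<close> by (simp add: s_def sum_divide_distrib[symmetric])
  finally have half: "(\<Sum>e\<in>arcs G. of_int (?d e) * edge_flux L \<alpha> e) = 1 / 2" .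
  have "flow_char G (edge_flux L \<alpha>) ?d = exp (- (\<i> * of_real pi))"
    unfolding flow_char_def half by (simp add: mult.commute)
  also have "\<dots> = - 1" by (simp add: exp_minus exp_pi_i')
  finally have "flow_char G (edge_flux L \<alpha>) h \<noteq> flow_char G (edge_flux L \<alpha>) h'"
    unfolding flow_char_diff by (auto simp: flow_char_nonzero)
  then show ?thesis using \<open>one_form G L \<alpha>\<close> by blast
qed

section \<open>Matching the flows of isospectral graphs\<close>

text \<open>
  The relation that an isomorphism of tori induces between representing forms. Working with the relation avoids
  choosing representatives; since it is closed under addition, forms on both graphs give characters of it.
\<close>

definition form_correspondence ::
    "('v, 'e) pre_digraph \<Rightarrow> ('e \<Rightarrow> real) \<Rightarrow> ('w, 'f) pre_digraph \<Rightarrow> ('f \<Rightarrow> real) \<Rightarrow>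
     (('e \<Rightarrow> real \<Rightarrow> real) \<times> ('f \<Rightarrow> real \<Rightarrow> real)) set \<Rightarrow> bool" where
  "form_correspondence G L G' L' T \<longleftrightarrow>
     (\<forall>\<alpha> \<alpha>'. (\<alpha>, \<alpha>') \<in> T \<longrightarrow> one_form G L \<alpha> \<and> one_form G' L' \<alpha>' \<and> Spec G L \<alpha> = Spec G' L' \<alpha>') \<and>
     (\<forall>\<alpha>. one_form G L \<alpha> \<longrightarrow> (\<exists>\<alpha>'. (\<alpha>, \<alpha>') \<in> T)) \<and> (\<forall>\<alpha>'. one_form G' L' \<alpha>' \<longrightarrow> (\<exists>\<alpha>. (\<alpha>, \<alpha>') \<in> T)) \<and>
     (\<forall>x\<in>T. \<forall>y\<in>T. x + y \<in> T)"

lemma bloch_isospectral_imp_correspondence: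
  assumes "quantum_graph G L" "quantum_graph G' L'" "bloch_isospectral G L G' L'"
  shows "\<exists>T. form_correspondence G L G' L' T"
proof -
  interpret G: quantum_graph G L by fact
  interpret G': quantum_graph G' L' by fact
  obtain \<Phi> where \<Phi>: "\<Phi> \<in> iso (torus G L) (torus G' L')"
    and spec: "\<And>\<alpha> \<alpha>'. one_form G L \<alpha> \<Longrightarrow> one_form G' L' \<alpha>' \<Longrightarrow> torus_class G' L' \<alpha>' = \<Phi> (torus_class G L \<alpha>) \<Longrightarrow>
      Spec G L \<alpha> = Spec G' L' \<alpha>'"
    using assms(3) unfolding bloch_isospectral_def lie_torus_iso_def by blast
  have hom: "\<Phi> (x \<otimes>\<^bsub>torus G L\<^esub> y) = \<Phi> x \<otimes>\<^bsub>torus G' L'\<^esub> \<Phi> y" if "x \<in> carrier (torus G L)" "y \<in> carrier (torus G L)" for x y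
    using \<Phi> that by (auto simp: iso_def hom_def)
  have bij: "\<Phi> ` carrier (torus G L) = carrier (torus G' L')"
    using \<Phi> by (auto simp: iso_def bij_betw_def)
  define T where "T = {(\<alpha>, \<alpha>'). one_form G L \<alpha> \<and> one_form G' L' \<alpha>' \<and> torus_class G' L' \<alpha>' = \<Phi> (torus_class G L \<alpha>)}"
  have "form_correspondence G L G' L' T"
    unfolding form_correspondence_def
  proof (intro conjI allI impI ballI)
    fix \<alpha> assume \<alpha>: "one_form G L \<alpha>"
    then have "torus_class G L \<alpha> \<in> carrier (torus G L)" by (simp add: carrier_torus)
    then have "\<Phi> (torus_class G L \<alpha>) \<in> carrier (torus G' L')" unfolding bij[symmetric] by (rule imageI)
    then obtain \<alpha>' where "one_form G' L' \<alpha>'" "torus_class G' L' \<alpha>' = \<Phi> (torus_class G L \<alpha>)"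
      unfolding carrier_torus by auto
    then show "\<exists>\<alpha>'. (\<alpha>, \<alpha>') \<in> T" using \<alpha> unfolding T_def by blast
  next
    fix \<alpha>' assume \<alpha>': "one_form G' L' \<alpha>'"
    then have "torus_class G' L' \<alpha>' \<in> \<Phi> ` carrier (torus G L)" unfolding bij by (simp add: carrier_torus)
    then obtain \<alpha> where "one_form G L \<alpha>" "torus_class G' L' \<alpha>' = \<Phi> (torus_class G L \<alpha>)"
      unfolding carrier_torus by auto
    then show "\<exists>\<alpha>. (\<alpha>, \<alpha>') \<in> T" using \<alpha>' unfolding T_def by blast
  next
    fix x y assume xy: "x \<in> T" "y \<in> T"
    obtain \<alpha> \<alpha>' \<beta> \<beta>' where e: "x = (\<alpha>, \<alpha>')" "y = (\<beta>, \<beta>')" by (cases x, cases y)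
    have f: "one_form G L \<alpha>" "one_form G' L' \<alpha>'" "torus_class G' L' \<alpha>' = \<Phi> (torus_class G L \<alpha>)"
      "one_form G L \<beta>" "one_form G' L' \<beta>'" "torus_class G' L' \<beta>' = \<Phi> (torus_class G L \<beta>)"
      using xy unfolding e T_def by auto
    have "torus_class G L \<alpha> \<in> carrier (torus G L)" "torus_class G L \<beta> \<in> carrier (torus G L)"
      using f by (auto simp: carrier_torus)
    then show "x + y \<in> T"
      using f one_form_add[OF f(1,4)] one_form_add[OF f(2,5)]
      by (simp add: e T_def G.torus_class_add G'.torus_class_add hom)
  next
    fix \<alpha> \<alpha>' assume "(\<alpha>, \<alpha>') \<in> T"
    then have a: "one_form G L \<alpha>" "one_form G' L' \<alpha>'" "torus_class G' L' \<alpha>' = \<Phi> (torus_class G L \<alpha>)"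
      by (simp_all add: T_def)
    show "one_form G L \<alpha>" "one_form G' L' \<alpha>'" "Spec G L \<alpha> = Spec G' L' \<alpha>'"
      using a(1,2) spec[OF a] by simp_all
  qed
  then show ?thesis by blast
qed

lemma form_correspondence_sym:
  assumes "form_correspondence G L G' L' T"
  shows "form_correspondence G' L' G L (prod.swap ` T)"
proof -
  have sw: "(\<alpha>', \<alpha>) \<in> prod.swap ` T \<longleftrightarrow> (\<alpha>, \<alpha>') \<in> T" for \<alpha> \<alpha>' by force
  have "prod.swap x + prod.swap y \<in> prod.swap ` T" if "x \<in> T" "y \<in> T" for x y
  proof -
    have "prod.swap x + prod.swap y = prod.swap (x + y)" by (simp add: prod_eq_iff)
    moreover have "x + y \<in> T" using assms that unfolding form_correspondence_def by blast
    ultimately show ?thesis by (metis imageI)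
  qed
  then show ?thesis
    using assms unfolding form_correspondence_def sw by auto
qed

definition flow_match ::
    "('v, 'e) pre_digraph \<Rightarrow> ('e \<Rightarrow> real) \<Rightarrow> ('w, 'f) pre_digraph \<Rightarrow> ('f \<Rightarrow> real) \<Rightarrow>
     (('e \<Rightarrow> real \<Rightarrow> real) \<times> ('f \<Rightarrow> real \<Rightarrow> real)) set \<Rightarrow> ('e \<Rightarrow> int) \<Rightarrow> ('f \<Rightarrow> int) \<Rightarrow> bool" where
  "flow_match G L G' L' T h h' \<longleftrightarrow> h \<in> cycles G \<and> h' \<in> cycles G' \<and>
     (\<forall>\<alpha> \<alpha>'. (\<alpha>, \<alpha>') \<in> T \<longrightarrow> flow_char G (edge_flux L \<alpha>) h = flow_char G' (edge_flux L' \<alpha>') h')"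

lemma cycles_diff: "h \<in> cycles G \<Longrightarrow> h' \<in> cycles G \<Longrightarrow> h - h' \<in> cycles G"
  by (auto simp: cycles_def bdry_def left_diff_distrib sum_subtractf)

lemma flow_match_diff:
  "flow_match G L G' L' T h h' \<Longrightarrow> flow_match G L G' L' T k k' \<Longrightarrow> flow_match G L G' L' T (h - k) (h' - k')"
  unfolding flow_match_def by (simp add: flow_char_diff cycles_diff)

lemma flow_match_sym:
  "flow_match G L G' L' T h h' \<Longrightarrow> flow_match G' L' G L (prod.swap ` T) h' h"
  unfolding flow_match_def by (auto simp: image_iff)

lemma flow_match_inj:
  assumes G: "quantum_graph G L" and T: "form_correspondence G L G' L' T"
    and m: "flow_match G L G' L' T h h'" "flow_match G L G' L' T k h'"
  shows "h = k"
proof (rule ccontr)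
  interpret quantum_graph G L by fact
  assume "h \<noteq> k"
  moreover have "h \<in> cycles G" "k \<in> cycles G" using m by (auto simp: flow_match_def)
  ultimately obtain \<alpha> where \<alpha>: "one_form G L \<alpha>" "flow_char G (edge_flux L \<alpha>) h \<noteq> flow_char G (edge_flux L \<alpha>) k"
    using flow_chars_separate[where L = L, OF fin_digraph_axioms length_pos] by blast
  then obtain \<alpha>' where "(\<alpha>, \<alpha>') \<in> T" using T unfolding form_correspondence_def by blast
  then have "flow_char G (edge_flux L \<alpha>) h = flow_char G' (edge_flux L' \<alpha>') h'"
    "flow_char G (edge_flux L \<alpha>) k = flow_char G' (edge_flux L' \<alpha>') h'"
    using m unfolding flow_match_def by blast+
  then show False using \<alpha>(2) by simp
qed

lemma finite_nets: "finite (arcs G) \<Longrightarrow> finite (net ` Pow (bonds G))"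
  by (simp add: finite_bonds)

lemma amp_nonzero_cycles:
  assumes "finite (arcs G)" "amp G L h l \<noteq> 0"
  shows "h \<in> net ` Pow (bonds G) \<inter> cycles G"
proof -
  obtain X where "X \<subseteq> bonds G" "net X = h" "pcoeff G X \<noteq> 0" using amp_nonzeroD[OF assms(2)] by blast
  then show ?thesis using pcoeff_nonzero_cycles[OF assms(1), of X] by blast
qed

lemma amp_sum_cycles:
  assumes "finite (arcs G)"
  shows "(\<Sum>h\<in>net ` Pow (bonds G). amp G L h l * c h) = (\<Sum>h\<in>net ` Pow (bonds G) \<inter> cycles G. amp G L h l * c h)"
proof (rule sum.mono_neutral_right)
  show "\<forall>h\<in>net ` Pow (bonds G) - net ` Pow (bonds G) \<inter> cycles G. amp G L h l * c h = 0"
  proof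
    fix h assume h: "h \<in> net ` Pow (bonds G) - net ` Pow (bonds G) \<inter> cycles G"
    have "amp G L h l = 0"
      using h amp_nonzero_cycles[OF assms] by blast
    then show "amp G L h l * c h = 0" by simp
  qed
qed (use finite_nets[OF assms] in auto)

text \<open>
  For related forms the Fourier sums of the two graphs agree, and the characters of distinct flows are distinct. Independence of
  characters matches the terms one by one.
\<close>

lemma flow_match_exists:
  assumes G: "quantum_graph G L" and G': "quantum_graph G' L'" and T: "form_correspondence G L G' L' T"
    and nz: "amp G L h l \<noteq> 0"
  shows "\<exists>h'. flow_match G L G' L' T h h' \<and> amp G' L' h' l = amp G L h l"
proof -
  interpret G: quantum_graph G L by fact
  interpret G': quantum_graph G' L' by fact
  let ?I = "net ` Pow (bonds G) \<inter> cycles G" and ?J = "net ` Pow (bonds G') \<inter> cycles G'"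
  have fin: "finite (arcs G)" "finite (arcs G')" by simp_all
  have forms: "one_form G L (fst x) \<and> one_form G' L' (snd x)" if "x \<in> T" for x
  proof -
    have "(fst x, snd x) \<in> T" using that by simp
    then show ?thesis using T unfolding form_correspondence_def by blast
  qed
  have hI: "h \<in> ?I" by (rule amp_nonzero_cycles[OF fin(1) nz])
  have "\<exists>h'\<in>?J. (\<forall>x\<in>T. flow_char G' (edge_flux L' (snd x)) h' = flow_char G (edge_flux L (fst x)) h) \<and> amp G' L' h' l = amp G L h l"
  proof (rule characters_match[where I = ?I and J = ?J and X = T and i = h and c = "\<lambda>h. amp G L h l" and d = "\<lambda>h. amp G' L' h l"
        and \<kappa> = "\<lambda>h x. flow_char G (edge_flux L (fst x)) h" and \<psi> = "\<lambda>h x. flow_char G' (edge_flux L' (snd x)) h"])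
    show "finite ?I" "finite ?J" using finite_nets[OF fin(1)] finite_nets[OF fin(2)] by auto
    show "x + y \<in> T" if "x \<in> T" "y \<in> T" for x y using T that unfolding form_correspondence_def by blast
    show "T \<noteq> {}" using T one_form_0[of G L] unfolding form_correspondence_def by blast
    show "flow_char G (edge_flux L (fst (x + y))) i = flow_char G (edge_flux L (fst x)) i * flow_char G (edge_flux L (fst y)) i"
      if "x \<in> T" "y \<in> T" for i x y
      using forms[OF that(1)] forms[OF that(2)] unfolding fst_add by (intro flow_char_add_form) auto
    show "flow_char G' (edge_flux L' (snd (x + y))) i = flow_char G' (edge_flux L' (snd x)) i * flow_char G' (edge_flux L' (snd y)) i"
      if "x \<in> T" "y \<in> T" for i x y
      using forms[OF that(1)] forms[OF that(2)] unfolding snd_add by (intro flow_char_add_form) auto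
    show "\<exists>x\<in>T. flow_char G (edge_flux L (fst x)) i \<noteq> flow_char G (edge_flux L (fst x)) i'"
      if i: "i \<in> ?I" "i' \<in> ?I" "i \<noteq> i'" for i i'
    proof -
      obtain \<alpha> where \<alpha>: "one_form G L \<alpha>" "flow_char G (edge_flux L \<alpha>) i \<noteq> flow_char G (edge_flux L \<alpha>) i'"
        using flow_chars_separate[where L = L and h = i and h' = i', OF G.fin_digraph_axioms G.length_pos] i by blast
      then obtain \<alpha>' where "(\<alpha>, \<alpha>') \<in> T" using T unfolding form_correspondence_def by blast
      then show ?thesis using \<alpha>(2) by (intro bexI[of _ "(\<alpha>, \<alpha>')"]) auto
    qed
    show "\<exists>x\<in>T. flow_char G' (edge_flux L' (snd x)) i \<noteq> flow_char G' (edge_flux L' (snd x)) i'"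
      if i: "i \<in> ?J" "i' \<in> ?J" "i \<noteq> i'" for i i'
    proof -
      obtain \<alpha>' where \<alpha>': "one_form G' L' \<alpha>'" "flow_char G' (edge_flux L' \<alpha>') i \<noteq> flow_char G' (edge_flux L' \<alpha>') i'"
        using flow_chars_separate[where L = L' and h = i and h' = i', OF G'.fin_digraph_axioms G'.length_pos] i by blast
      then obtain \<alpha> where "(\<alpha>, \<alpha>') \<in> T" using T unfolding form_correspondence_def by blast
      then show ?thesis using \<alpha>'(2) by (intro bexI[of _ "(\<alpha>, \<alpha>')"]) auto
    qed
    show "(\<Sum>i\<in>?I. amp G L i l * flow_char G (edge_flux L (fst x)) i) = (\<Sum>j\<in>?J. amp G' L' j l * flow_char G' (edge_flux L' (snd x)) j)"
      if "x \<in> T" for x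
    proof -
      have "(fst x, snd x) \<in> T" using that by simp
      then have x: "one_form G L (fst x)" "one_form G' L' (snd x)" "Spec G L (fst x) = Spec G' L' (snd x)"
        using T unfolding form_correspondence_def by blast+
      show ?thesis
        unfolding amp_sum_cycles[OF fin(1), symmetric] amp_sum_cycles[OF fin(2), symmetric]
        by (rule Spec_determines_amplitudes[OF G x(1) G' x(2,3)])
    qed
  qed (use hI nz flow_char_nonzero in auto)
  then obtain h' where "h' \<in> cycles G'" "\<forall>x\<in>T. flow_char G' (edge_flux L' (snd x)) h' = flow_char G (edge_flux L (fst x)) h"
    "amp G' L' h' l = amp G L h l" by blast
  moreover from this have "flow_match G L G' L' T h h'" using hI unfolding flow_match_def by fastforce
  ultimately show ?thesis by blast
qed

section \<open>Simple cycles in a flow\<close>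

lemma bdry_add: "bdry G (h + k) v = bdry G h v + bdry G k v"
  by (simp add: bdry_def sum.distrib distrib_right)

lemma cycles_0: "0 \<in> cycles G"
  by (simp add: cycles_def bdry_def)

lemma cycles_add: "h \<in> cycles G \<Longrightarrow> k \<in> cycles G \<Longrightarrow> h + k \<in> cycles G"
  by (simp add: cycles_def bdry_add)

lemma (in wf_digraph) walk_ends: "walk G u w v \<Longrightarrow> u \<in> verts G \<and> v \<in> verts G"
  by (induction w arbitrary: u) (auto split: if_splits)

lemma walk_Cons_iff: "walk G u (b # w) v \<longleftrightarrow> b \<in> bonds G \<and> u = src G b \<and> walk G (dst G b) w v"
  by (cases b) (auto simp: bonds_def src_def dst_def)

lemma walk_append: "walk G u w v \<Longrightarrow> walk G v w' x \<Longrightarrow> walk G u (w @ w') x"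
  by (induction w arbitrary: u) auto

lemma walk_suffix: "walk G u (w @ b # w') v \<Longrightarrow> walk G (src G b) (b # w') v"
  by (induction w arbitrary: u) (auto simp: walk_Cons_iff simp del: walk.simps(2))

lemma walk_bonds: "walk G u w v \<Longrightarrow> set w \<subseteq> bonds G"
  by (induction w arbitrary: u) (auto simp: walk_Cons_iff simp del: walk.simps(2))

lemma walk_dst_eq_src: "walk G u w v \<Longrightarrow> u # map (dst G) w = map (src G) w @ [v]"
  by (induction w arbitrary: u) (auto simp: walk_Cons_iff simp del: walk.simps(2))

lemma walk_imp_path:
  assumes "wf_digraph G" "walk G u w v"
  shows "\<exists>w'. walk G u w' v \<and> set w' \<subseteq> set w \<and> distinct (map (src G) w' @ [v])"
  using assms(2)
proof (induction w arbitrary: u)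
  case Nil
  then show ?case by (intro exI[of _ "[]"]) auto
next
  case (Cons b w)
  then have b: "b \<in> bonds G" "u = src G b" "walk G (dst G b) w v" by (auto simp only: walk_Cons_iff)
  obtain w' where w': "walk G (dst G b) w' v" "set w' \<subseteq> set w" "distinct (map (src G) w' @ [v])"
    using Cons.IH[OF b(3)] by blast
  show ?case
  proof (cases "src G b \<in> set (map (src G) w' @ [v])")
    case False
    then show ?thesis using b w' by (intro exI[of _ "b # w'"]) (auto simp: walk_Cons_iff simp del: walk.simps(2))
  next
    case True
    show ?thesis
    proof (cases "src G b = v")
      case True
      then show ?thesis using b wf_digraph.walk_ends[OF assms(1) b(3)] by (intro exI[of _ "[]"]) auto
    next
      case False
      with True obtain c where "c \<in> set w'" "src G c = src G b" by auto
      then obtain xs ys where s: "w' = xs @ c # ys" by (auto dest: split_list)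
      have "walk G (src G c) (c # ys) v" using w'(1) unfolding s by (rule walk_suffix)
      then show ?thesis using b(2) w' \<open>src G c = src G b\<close> unfolding s
        by (intro exI[of _ "c # ys"]) (auto simp del: walk.simps(2))
    qed
  qed
qed

definition pos_bonds :: "('e \<Rightarrow> int) \<Rightarrow> ('e \<times> bool) set" where
  "pos_bonds h = {b. (if snd b then h (fst b) else - h (fst b)) > 0}"

lemma pos_bonds_subset: 
  assumes "h \<in> cycles G" shows "pos_bonds h \<subseteq> bonds G"
proof
  fix b assume "b \<in> pos_bonds h"
  then have "h (fst b) \<noteq> 0" by (simp add: pos_bonds_def split: if_splits)
  then have "fst b \<in> arcs G" using assms unfolding cycles_def by blast
  then show "b \<in> bonds G" by (cases b) (simp add: bonds_def)
qed

text \<open>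
  Let \<open>W\<close> be the set of vertices that can be reached from the end of \<open>b0\<close> in the direction of the flow. Nothing flows
  out of \<open>W\<close>, so by conservation nothing flows in, and the source of \<open>b0\<close> must lie in \<open>W\<close>.
\<close>

lemma return_walk:
  assumes G: "fin_digraph G" and h: "h \<in> cycles G" and b0: "b0 \<in> pos_bonds h"
  shows "\<exists>w. walk G (dst G b0) w (src G b0) \<and> set w \<subseteq> pos_bonds h"
proof -
  interpret fin_digraph G by fact
  have supp: "pos_bonds h \<subseteq> bonds G" by (rule pos_bonds_subset[OF h])
  define W where "W = {x \<in> verts G. \<exists>w. walk G (dst G b0) w x \<and> set w \<subseteq> pos_bonds h}"
  have dv: "dst G b \<in> verts G" "src G b \<in> verts G" if "b \<in> bonds G" for b
    using that by (auto simp: bonds_def dst_def src_def)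
  have finW: "finite W" by (simp add: W_def)
  have step: "dst G b \<in> W" if b: "b \<in> pos_bonds h" "src G b \<in> W" for b
  proof -
    obtain w where w: "walk G (dst G b0) w (src G b)" "set w \<subseteq> pos_bonds h" using b(2) by (auto simp: W_def)
    have bB: "b \<in> bonds G" using b(1) supp by (rule subsetD[rotated])
    have "walk G (src G b) [b] (dst G b)" by (simp add: walk_Cons_iff bB dv[OF bB] del: walk.simps(2))
    from walk_append[OF w(1) this] have "walk G (dst G b0) (w @ [b]) (dst G b)" .
    then show ?thesis using w(2) b(1) dv[OF bB] unfolding W_def by (intro CollectI conjI exI[of _ "w @ [b]"]) simp_all
  qed
  have nonneg: "0 \<le> h e * (of_bool (head G e \<in> W) - of_bool (tail G e \<in> W))" for e
  proof (cases "h e > 0")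
    case True
    then have "(e, True) \<in> pos_bonds h" by (simp add: pos_bonds_def)
    from step[OF this] True show ?thesis by (auto simp: src_def dst_def)
  next
    case False
    show ?thesis
    proof (cases "h e = 0")
      case nz: False
      then have "(e, False) \<in> pos_bonds h" using False by (simp add: pos_bonds_def)
      from step[OF this] False show ?thesis by (auto simp: src_def dst_def)
    qed simp
  qed
  have "0 = (\<Sum>x\<in>W. bdry G h x)" using h by (simp add: cycles_def)
  also have "\<dots> = (\<Sum>e\<in>arcs G. \<Sum>x\<in>W. h e * (of_bool (head G e = x) - of_bool (tail G e = x)))"
    unfolding bdry_def by (rule sum.swap)
  also have "\<dots> = (\<Sum>e\<in>arcs G. h e * (of_bool (head G e \<in> W) - of_bool (tail G e \<in> W)))"
    unfolding sum_distrib_left[symmetric] sum_subtractf using finW by (simp add: of_bool_def)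
  finally have "(\<Sum>e\<in>arcs G. h e * (of_bool (head G e \<in> W) - of_bool (tail G e \<in> W))) = 0" by simp
  then have zero: "h e * (of_bool (head G e \<in> W) - of_bool (tail G e \<in> W)) = 0" if "e \<in> arcs G" for e
    using sum_nonneg_eq_0_iff[OF finite_arcs, of "\<lambda>e. h e * (of_bool (head G e \<in> W) - of_bool (tail G e \<in> W))"] nonneg that by simp
  have b0B: "b0 \<in> bonds G" using b0 supp by blast
  have "dst G b0 \<in> W" unfolding W_def using dv[OF b0B] by (intro CollectI conjI exI[of _ "[]"]) auto
  moreover have "h (fst b0) \<noteq> 0" using b0 by (auto simp: pos_bonds_def split: if_splits)
  moreover have "fst b0 \<in> arcs G" using b0B by (auto simp: bonds_def)
  ultimately have "src G b0 \<in> W" using zero[of "fst b0"]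
    by (cases "snd b0") (simp_all add: src_def dst_def of_bool_def split: if_splits)
  then show ?thesis by (auto simp: W_def)
qed

text \<open>
  A vertex-disjoint union of directed circuits. Several circuits are allowed because a circuit together with a distant
  loop is of interest below.
\<close>

definition simple_cycle :: "('v, 'e) pre_digraph \<Rightarrow> ('e \<times> bool) set \<Rightarrow> bool" where
  "simple_cycle G X \<longleftrightarrow> X \<subseteq> bonds G \<and> inj_on (src G) X \<and> inj_on (dst G) X \<and> src G ` X = dst G ` X \<and>
     (\<forall>b\<in>X. flip b \<notin> X)"

lemma card_fibre_inj:
  assumes "inj_on f X" "finite X"
  shows "card {b \<in> X. f b = v} = of_bool (v \<in> f ` X)"
proof (cases "v \<in> f ` X")
  case True
  then obtain b where "b \<in> X" "v = f b" by blast
  then have e: "{c \<in> X. f c = v} = {b}" using assms(1) by (auto dest: inj_onD)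
  show ?thesis unfolding e using True by simp
next
  case False
  then have e: "{c \<in> X. f c = v} = {}" by blast
  show ?thesis unfolding e using False by simp
qed

lemma simple_cycle_net:
  assumes fin: "finite (arcs G)" and X: "simple_cycle G X"
  shows "net X \<in> cycles G"
proof -
  have XB: "X \<subseteq> bonds G" using X by (simp add: simple_cycle_def)
  have fX: "finite X" using finite_subset[OF XB finite_bonds[OF fin]] .
  have "bdry G (net X) v = 0" for v
    using sum_bond_ends[OF fin XB, of v] X fX by (simp add: simple_cycle_def card_fibre_inj)
  moreover have "net X e = 0" if "e \<notin> arcs G" for e using that XB by (auto simp: net_def bonds_def)
  ultimately show ?thesis by (simp add: cycles_def)
qed

lemma simple_cycle_amp:
  assumes fin: "finite (arcs G)" and L: "\<And>e. e \<in> arcs G \<Longrightarrow> L e > 0" and X: "simple_cycle G X"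
  shows "amp G L (net X) (flow_norm G L (net X)) \<noteq> 0"
proof -
  have "amp G L (net X) (flow_norm G L (net X)) = pcoeff G (flow_bonds (net X))"
    using amp_flow_norm[where L = L and h = "net X", OF fin L] simple_cycle_net[OF fin X]
    by (simp add: cycles_def) (simp add: net_def)
  also have "flow_bonds (net X) = X" using X by (intro net_no_flip_eq) (simp add: simple_cycle_def)
  also have "pcoeff G X \<noteq> 0" using X by (intro pcoeff_nonzeroI[OF fin]) (auto simp: simple_cycle_def)
  finally show ?thesis .
qed

text \<open>
  A return walk of the flow, shortened to a path, closes \<open>b0\<close> to a circuit.
\<close>

lemma simple_cycle_through:
  assumes G: "fin_digraph G" and h: "h \<in> cycles G" and b0: "b0 \<in> pos_bonds h"
  shows "\<exists>X. simple_cycle G X \<and> b0 \<in> X \<and> X \<subseteq> pos_bonds h"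
proof -
  interpret fin_digraph G by fact
  have supp: "pos_bonds h \<subseteq> bonds G" by (rule pos_bonds_subset[OF h])
  obtain w0 where w0: "walk G (dst G b0) w0 (src G b0)" "set w0 \<subseteq> pos_bonds h" using return_walk[OF assms] by blast
  obtain w where w: "walk G (dst G b0) w (src G b0)" "set w \<subseteq> set w0" "distinct (map (src G) w @ [src G b0])"
    using walk_imp_path[OF wf_digraph_axioms w0(1)] by blast
  let ?X = "set (b0 # w)"
  have d: "map (dst G) (b0 # w) = map (src G) w @ [src G b0]" using walk_dst_eq_src[OF w(1)] by simp
  have "distinct (map (src G) (b0 # w))" using w(3) by auto
  then have "inj_on (src G) ?X" unfolding distinct_map by blast
  moreover have "distinct (map (dst G) (b0 # w))" unfolding d by (rule w(3))
  then have "inj_on (dst G) ?X" unfolding distinct_map by blast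
  moreover have "src G ` ?X = dst G ` ?X"
  proof -
    have "dst G ` ?X = set (map (dst G) (b0 # w))" by simp
    also have "\<dots> = src G ` ?X" unfolding d by auto
    finally show ?thesis by simp
  qed
  moreover have X: "?X \<subseteq> pos_bonds h" using b0 w(2) w0(2) by auto
  moreover have "flip b \<notin> ?X" if "b \<in> ?X" for b
  proof
    assume "flip b \<in> ?X"
    then have "b \<in> pos_bonds h" "flip b \<in> pos_bonds h" using X that by blast+
    then show False by (auto simp: pos_bonds_def split: if_splits)
  qed
  ultimately show ?thesis using supp unfolding simple_cycle_def by (intro exI[of _ ?X] conjI) auto
qed

text \<open>
  As \<open>X\<close> runs along the flow, removing it lowers the modulus on each edge, with no change of sign.
\<close>

lemma conformal_abs:
  assumes "X \<subseteq> pos_bonds h"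
  shows "\<bar>h e - net X e\<bar> = \<bar>h e\<bar> - \<bar>net X e\<bar>"
  using assms by (auto simp: net_def pos_bonds_def)

lemma flow_norm_diff_conformal:
  assumes "X \<subseteq> pos_bonds h"
  shows "flow_norm G L (h - net X) = flow_norm G L h - flow_norm G L (net X)"
  unfolding flow_norm_def sum_subtractf[symmetric]
  by (intro sum.cong refl) (simp add: conformal_abs[OF assms] right_diff_distrib del: of_int_abs)

section \<open>The isometry of the lattices of flows\<close>

lemma flow_norm_triangle:
  assumes "\<And>e. e \<in> arcs G \<Longrightarrow> L e > 0"
  shows "flow_norm G L (h + k) \<le> flow_norm G L h + flow_norm G L k"
  unfolding flow_norm_def sum.distrib[symmetric]
proof (intro sum_mono)
  fix e assume "e \<in> arcs G"
  then have "L e \<ge> 0" using assms less_imp_le by blast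
  then have "L e * real_of_int \<bar>(h + k) e\<bar> \<le> L e * (real_of_int \<bar>h e\<bar> + real_of_int \<bar>k e\<bar>)"
    by (intro mult_left_mono) auto
  then show "L e * real_of_int \<bar>(h + k) e\<bar> \<le> L e * real_of_int \<bar>h e\<bar> + L e * real_of_int \<bar>k e\<bar>"
    by (simp add: distrib_left)
qed

lemma flow_match_0: "flow_match G L G' L' T 0 0"
  by (simp add: flow_match_def cycles_0 flow_char_def)

lemma flow_match_add:
  assumes "flow_match G L G' L' T h h'" "flow_match G L G' L' T k k'"
  shows "flow_match G L G' L' T (h + k) (h' + k')"
  using flow_match_diff[OF assms(1) flow_match_diff[OF flow_match_0 assms(2)]] by simp

text \<open>
  Induction on the total flow, splitting off a simple cycle in the direction of the flow, for which the norm is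
  additive. The amplitude of a simple cycle does not vanish at its length. The matching flow has the same amplitude there, so its
  norm is at most this length.
\<close>

lemma flow_match_contraction:
  assumes G: "quantum_graph G L" and G': "quantum_graph G' L'" and T: "form_correspondence G L G' L' T"
    and h: "h \<in> cycles G"
  shows "\<exists>h'. flow_match G L G' L' T h h' \<and> flow_norm G' L' h' \<le> flow_norm G L h"
  using h
proof (induction "\<Sum>e\<in>arcs G. nat \<bar>h e\<bar>" arbitrary: h rule: less_induct)
  case less
  interpret G: quantum_graph G L by fact
  interpret G': quantum_graph G' L' by fact
  show ?case
  proof (cases "h = 0")
    case True
    then show ?thesis using flow_match_0 by (intro exI[of _ 0]) (auto simp: flow_norm_def)
  next
    case False
    then obtain e where e: "h e \<noteq> 0" by (auto simp: fun_eq_iff)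
    define b0 where "b0 = (e, h e > 0)"
    have b0: "b0 \<in> pos_bonds h" using e by (auto simp: b0_def pos_bonds_def)
    obtain X where X: "simple_cycle G X" "b0 \<in> X" "X \<subseteq> pos_bonds h"
      using simple_cycle_through[OF G.fin_digraph_axioms less.prems b0] by blast
    have c: "net X \<in> cycles G" using simple_cycle_net[OF G.finite_arcs X(1)] .
    have "(\<Sum>e\<in>arcs G. nat \<bar>(h - net X) e\<bar>) < (\<Sum>e\<in>arcs G. nat \<bar>h e\<bar>)"
    proof (rule sum_strict_mono_ex1)
      show "\<forall>e\<in>arcs G. nat \<bar>(h - net X) e\<bar> \<le> nat \<bar>h e\<bar>"
      proof
        fix e
        have "\<bar>(h - net X) e\<bar> \<le> \<bar>h e\<bar>" using conformal_abs[OF X(3), of e] by simp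
        then show "nat \<bar>(h - net X) e\<bar> \<le> nat \<bar>h e\<bar>" by (rule nat_mono)
      qed
      have "flip b0 \<notin> X" using X by (simp add: simple_cycle_def)
      then have "net X e \<noteq> 0" using X(2) by (cases "h e > 0") (simp_all add: b0_def net_def flip_def)
      moreover have "e \<in> arcs G" using e less.prems by (auto simp: cycles_def)
      ultimately show "\<exists>e\<in>arcs G. nat \<bar>(h - net X) e\<bar> < nat \<bar>h e\<bar>"
        using conformal_abs[OF X(3), of e] e by (intro bexI[of _ e]) auto
    qed simp
    from less.hyps[OF this cycles_diff[OF less.prems c]]
    obtain h2 where h2: "flow_match G L G' L' T (h - net X) h2" "flow_norm G' L' h2 \<le> flow_norm G L (h - net X)" by blast
    have "amp G L (net X) (flow_norm G L (net X)) \<noteq> 0"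
      by (rule simple_cycle_amp[OF G.finite_arcs G.length_pos X(1)])
    from flow_match_exists[OF G G' T this] obtain h1
      where h1: "flow_match G L G' L' T (net X) h1" "amp G' L' h1 (flow_norm G L (net X)) \<noteq> 0"
      using \<open>amp G L (net X) (flow_norm G L (net X)) \<noteq> 0\<close> by auto
    obtain Y where "Y \<subseteq> bonds G'" "net Y = h1" "bond_length L' Y = flow_norm G L (net X)" using amp_nonzeroD[OF h1(2)] by blast
    then have "flow_norm G' L' h1 \<le> flow_norm G L (net X)"
      using flow_norm_le_bond_length(1)[of G' Y L', OF G'.finite_arcs _ G'.length_pos] by auto
    then have "flow_norm G' L' (h2 + h1) \<le> flow_norm G L h"
      using flow_norm_triangle[of G' L' h2 h1, OF G'.length_pos] h2(2) flow_norm_diff_conformal[OF X(3), of G L] by linarith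
    moreover have "flow_match G L G' L' T h (h2 + h1)" using flow_match_add[OF h2(1) h1(1)] by simp
    ultimately show ?thesis by blast
  qed
qed

text \<open>
  The contraction exists in both directions, and matching flows are unique because characters separate flows.
  So the two contractions are inverse to each other.
\<close>

theorem isospectral_imp_flow_isometry:
  assumes G: "quantum_graph G L" and G': "quantum_graph G' L'" and iso: "bloch_isospectral G L G' L'"
  shows "\<exists>\<phi>. bij_betw \<phi> (cycles G) (cycles G') \<and>
    (\<forall>h\<in>cycles G. \<forall>k\<in>cycles G. \<phi> (h - k) = \<phi> h - \<phi> k) \<and>
    (\<forall>h\<in>cycles G. flow_norm G' L' (\<phi> h) = flow_norm G L h) \<and>
    (\<forall>h\<in>cycles G. \<forall>l. amp G L h l \<noteq> 0 \<longrightarrow> amp G' L' (\<phi> h) l \<noteq> 0)"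
proof -
  obtain T where T: "form_correspondence G L G' L' T" using bloch_isospectral_imp_correspondence[OF assms] by blast
  let ?R = "flow_match G L G' L' T"
  note T' = form_correspondence_sym[OF T]
  have swap: "prod.swap ` prod.swap ` T = T" by (simp add: image_image)
  have uniq: "h' = k'" if "?R h h'" "?R h k'" for h h' k'
    by (rule flow_match_inj[OF G' T' flow_match_sym[OF that(1)] flow_match_sym[OF that(2)]])
  have inj: "h = k" if "?R h h'" "?R k h'" for h h' k using flow_match_inj[OF G T that] .
  define \<phi> where "\<phi> h = (THE h'. ?R h h')" for h
  have ex: "\<exists>h'. ?R h h' \<and> flow_norm G' L' h' \<le> flow_norm G L h" if "h \<in> cycles G" for h
    by (rule flow_match_contraction[OF G G' T that])
  have ex': "\<exists>h. ?R h h' \<and> flow_norm G L h \<le> flow_norm G' L' h'" if "h' \<in> cycles G'" for h'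
    using flow_match_contraction[OF G' G T' that] flow_match_sym[of G' L' G L "prod.swap ` T"] unfolding swap by blast
  have \<phi>I: "\<phi> h = h'" if "?R h h'" for h h' unfolding \<phi>_def using that uniq by blast
  have \<phi>: "?R h (\<phi> h)" if "h \<in> cycles G" for h using ex[OF that] \<phi>I by blast
  have cyc: "h \<in> cycles G \<and> h' \<in> cycles G'" if "?R h h'" for h h' using that by (simp add: flow_match_def)
  have "bij_betw \<phi> (cycles G) (cycles G')"
  proof (rule bij_betwI')
    fix h k assume "h \<in> cycles G" "k \<in> cycles G"
    then show "\<phi> h = \<phi> k \<longleftrightarrow> h = k" using \<phi>[of h] \<phi>[of k] inj by metis
  next
    fix h assume "h \<in> cycles G"
    then show "\<phi> h \<in> cycles G'" using \<phi> cyc by blast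
  next
    fix h' assume "h' \<in> cycles G'"
    then obtain h where "?R h h'" using ex' by blast
    then show "\<exists>h\<in>cycles G. h' = \<phi> h" using \<phi>I cyc by blast
  qed
  moreover have "\<phi> (h - k) = \<phi> h - \<phi> k" if "h \<in> cycles G" "k \<in> cycles G" for h k
    by (rule \<phi>I[OF flow_match_diff[OF \<phi>[OF that(1)] \<phi>[OF that(2)]]])
  moreover have "flow_norm G' L' (\<phi> h) = flow_norm G L h" if h: "h \<in> cycles G" for h
  proof (rule antisym)
    show "flow_norm G' L' (\<phi> h) \<le> flow_norm G L h" using ex[OF h] \<phi>I by blast
    obtain k where "?R k (\<phi> h)" "flow_norm G L k \<le> flow_norm G' L' (\<phi> h)" using ex' cyc[OF \<phi>[OF h]] by blast
    then show "flow_norm G L h \<le> flow_norm G' L' (\<phi> h)" using inj[OF _ \<phi>[OF h]] by blast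
  qed
  moreover have "amp G' L' (\<phi> h) l \<noteq> 0" if nz: "amp G L h l \<noteq> 0" for h l
  proof -
    obtain h' where "?R h h'" "amp G' L' h' l = amp G L h l" using flow_match_exists[OF G G' T nz] by blast
    then show ?thesis using \<phi>I nz by metis
  qed
  ultimately show ?thesis by blast
qed

section \<open>Three-connected graphs\<close>

text \<open>
  Being 3-connected, expressed by walks that ignore the auxiliary directions of the arcs.
\<close>

definition conn3 :: "('v, 'e) pre_digraph \<Rightarrow> bool" where
  "conn3 G \<longleftrightarrow> card (verts G) > 3 \<and>
     (\<forall>X \<subseteq> verts G. card X < 3 \<longrightarrow> (\<forall>a\<in>verts G - X. \<forall>b\<in>verts G - X.
        \<exists>w. walk G a w b \<and> (\<forall>s\<in>set w. src G s \<notin> X \<and> dst G s \<notin> X)))"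

lemma connected_imp_walk:
  assumes H: "wf_digraph H" and conn: "Digraph_Component.connected H" and uv: "u \<in> verts H" "v \<in> verts H"
  shows "\<exists>w. walk H u w v"
proof -
  interpret wf_digraph H by fact
  have "(u, v) \<in> rtrancl_on (verts H) (parcs (mk_symmetric H))"
    using conn uv by (auto simp: Digraph_Component.connected_def strongly_connected_def reachable_def)
  then show ?thesis
  proof (induction rule: rtrancl_on.induct)
    case (rtrancl_on_refl a)
    then show ?case by (intro exI[of _ "[]"]) auto
  next
    case (rtrancl_on_into_rtrancl_on a b c)
    then obtain w where w: "walk H a w b" by blast
    obtain e where e: "e \<in> arcs H" "(b, c) = (tail H e, head H e) \<or> (b, c) = (head H e, tail H e)"
      using rtrancl_on_into_rtrancl_on by (auto simp: parcs_mk_symmetric)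
    then have "\<exists>d. walk H b [(e, d)] c"
    proof (elim disjE)
      assume "(b, c) = (tail H e, head H e)"
      then show ?thesis using e(1) by (intro exI[of _ True]) auto
    next
      assume "(b, c) = (head H e, tail H e)"
      then show ?thesis using e(1) by (intro exI[of _ False]) auto
    qed
    then show ?case using walk_append[OF w] by blast
  qed
qed

lemma induce_subgraph_bonds:
  "b \<in> bonds (G \<restriction> V) \<longleftrightarrow> b \<in> bonds G \<and> src G b \<in> V \<and> dst G b \<in> V"
  "src (G \<restriction> V) b = src G b" "dst (G \<restriction> V) b = dst G b"
  by (cases b; auto simp: bonds_def src_def dst_def induce_subgraph_def)+

lemma walk_induce_subgraph:
  assumes "walk (G \<restriction> V) u w v" "V \<subseteq> verts G"
  shows "walk G u w v \<and> (\<forall>s\<in>set w. src G s \<in> V \<and> dst G s \<in> V)"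
  using assms(1)
proof (induction w arbitrary: u)
  case Nil
  then show ?case using assms(2) by (auto simp: induce_subgraph_def)
next
  case (Cons b w)
  then have "b \<in> bonds G" "src G b \<in> V" "dst G b \<in> V" "u = src G b" "walk (G \<restriction> V) (dst G b) w v"
    unfolding walk_Cons_iff induce_subgraph_bonds by simp_all
  with Cons.IH show ?case by (simp add: walk_Cons_iff del: walk.simps(2))
qed

lemma (in wf_digraph) bond_ends_in_verts: "b \<in> bonds G \<Longrightarrow> src G b \<in> verts G" "b \<in> bonds G \<Longrightarrow> dst G b \<in> verts G"
  by (auto simp: bonds_def src_def dst_def)

lemma k_connected_3_imp_conn3:
  assumes "fin_digraph G" "k_connected 3 G" shows "conn3 G"
  unfolding conn3_def
proof (intro conjI allI impI ballI)
  interpret fin_digraph G by fact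
  show "card (verts G) > 3" using assms by (simp add: k_connected_def)
  fix X a b assume X: "X \<subseteq> verts G" "card X < 3" and ab: "a \<in> verts G - X" "b \<in> verts G - X"
  let ?H = "G \<restriction> (verts G - X)"
  have "wf_digraph ?H" by (rule wellformed_induce_subgraph)
  moreover have "Digraph_Component.connected ?H" using assms(2) X by (simp add: k_connected_def)
  ultimately obtain w where "walk ?H a w b" using connected_imp_walk[of ?H a b] ab by auto
  then have "walk G a w b \<and> (\<forall>s\<in>set w. src G s \<in> verts G - X \<and> dst G s \<in> verts G - X)"
    by (intro walk_induce_subgraph) auto
  then show "\<exists>w. walk G a w b \<and> (\<forall>s\<in>set w. src G s \<notin> X \<and> dst G s \<notin> X)" by blast
qed

lemma walk_graph_iso:
  assumes iso: "graph_iso G H f g" and "walk G a w b"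
  shows "\<exists>w'. walk H (f a) w' (f b) \<and> (\<forall>s\<in>set w'. \<exists>t\<in>set w. src H s = f (src G t) \<and> dst H s = f (dst G t))"
  using assms(2)
proof (induction w arbitrary: a)
  case Nil
  then show ?case using iso by (intro exI[of _ "[]"]) (auto simp: graph_iso_def bij_betw_def)
next
  case (Cons t w)
  then have t: "t \<in> bonds G" "a = src G t" "walk G (dst G t) w b" by (auto simp only: walk_Cons_iff)
  obtain w' where w': "walk H (f (dst G t)) w' (f b)" "\<forall>s\<in>set w'. \<exists>t\<in>set w. src H s = f (src G t) \<and> dst H s = f (dst G t)"
    using Cons.IH[OF t(3)] by blast
  have e: "fst t \<in> arcs G" using t(1) by (auto simp: bonds_def)
  then have ge: "g (fst t) \<in> arcs H" "{tail H (g (fst t)), head H (g (fst t))} = {f (tail G (fst t)), f (head G (fst t))}"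
    using iso by (auto simp: graph_iso_def bij_betw_def)
  have "\<exists>d. src H (g (fst t), d) = f (src G t) \<and> dst H (g (fst t), d) = f (dst G t)"
    using ge(2) unfolding doubleton_eq_iff src_def dst_def by (cases "snd t") fastforce+
  then obtain d where d: "src H (g (fst t), d) = f (src G t)" "dst H (g (fst t), d) = f (dst G t)" by blast
  have "walk H (f a) ((g (fst t), d) # w') (f b)"
    using d w'(1) ge(1) t(2) unfolding walk_Cons_iff by (simp add: bonds_def)
  then show ?case using d w'(2) by (intro exI[of _ "(g (fst t), d) # w'"]) (auto simp del: walk.simps(2))
qed

lemma conn3_graph_iso:
  assumes iso: "graph_iso G H f g" and G: "conn3 G" and finG: "fin_digraph G"
  shows "conn3 H"
  unfolding conn3_def
proof (intro conjI allI impI ballI)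
  interpret fin_digraph G by fact
  have fin: "finite (verts G)" by simp
  have bij: "bij_betw f (verts G) (verts H)" using iso by (simp add: graph_iso_def)
  then show "card (verts H) > 3" using G bij_betw_same_card by (fastforce simp: conn3_def)
  fix Y a b assume Y: "Y \<subseteq> verts H" "card Y < 3" and ab: "a \<in> verts H - Y" "b \<in> verts H - Y"
  define X where "X = {x \<in> verts G. f x \<in> Y}"
  have "inj_on f X" using bij by (auto simp: X_def bij_betw_def intro: inj_on_subset)
  moreover have "f ` X \<subseteq> Y" by (auto simp: X_def)
  moreover have "finite Y" using Y(1) bij fin bij_betw_finite finite_subset by blast
  ultimately have "card X < 3" using card_inj_on_le[of f X Y] Y(2) by linarith
  moreover have "a \<in> f ` verts G" "b \<in> f ` verts G" using ab bij by (simp_all add: bij_betw_def)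
  then obtain a' b' where a': "a' \<in> verts G" "f a' = a" and b': "b' \<in> verts G" "f b' = b" by blast
  moreover have "X \<subseteq> verts G" by (auto simp: X_def)
  moreover have "a' \<in> verts G - X" "b' \<in> verts G - X" using a' b' ab by (auto simp: X_def)
  ultimately obtain w where w: "walk G a' w b'" "\<forall>s\<in>set w. src G s \<notin> X \<and> dst G s \<notin> X"
    using G unfolding conn3_def by blast
  obtain w' where w': "walk H a w' b" "\<And>s. s \<in> set w' \<Longrightarrow> \<exists>t\<in>set w. src H s = f (src G t) \<and> dst H s = f (dst G t)"
    using walk_graph_iso[OF iso w(1)] a' b' by auto
  have inv: "src G t \<in> verts G \<and> dst G t \<in> verts G" if "t \<in> set w" for t
    using bond_ends_in_verts walk_bonds[OF w(1)] that by blast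
  have "src H s \<notin> Y \<and> dst H s \<notin> Y" if "s \<in> set w'" for s
    using w'(2)[OF that] w(2) inv unfolding X_def by fastforce
  then show "\<exists>w. walk H a w b \<and> (\<forall>s\<in>set w. src H s \<notin> Y \<and> dst H s \<notin> Y)" using w'(1) by blast
qed

section \<open>Flows along walks\<close>

definition unit_flow :: "'e \<times> bool \<Rightarrow> 'e \<Rightarrow> int" where
  "unit_flow b e = of_bool (b = (e, True)) - of_bool (b = (e, False))"

fun walk_flow :: "('e \<times> bool) list \<Rightarrow> 'e \<Rightarrow> int" where
  "walk_flow [] = 0"
| "walk_flow (b # w) = unit_flow b + walk_flow w"

lemma bdry_unit_flow:
  assumes "finite (arcs G)" "b \<in> bonds G"
  shows "bdry G (unit_flow b) x = of_bool (dst G b = x) - of_bool (src G b = x)"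
proof -
  have e: "fst b \<in> arcs G" using assms(2) by (auto simp: bonds_def)
  have "bdry G (unit_flow b) x = (\<Sum>e\<in>arcs G. if e = fst b then
      (if snd b then 1 else - 1) * (of_bool (head G e = x) - of_bool (tail G e = x)) else 0)"
    unfolding bdry_def by (intro sum.cong refl) (cases b; auto simp: unit_flow_def)
  also have "\<dots> = of_bool (dst G b = x) - of_bool (src G b = x)"
    using assms(1) e by (simp add: dst_def src_def)
  finally show ?thesis .
qed

lemma bdry_walk_flow:
  assumes "finite (arcs G)" "walk G u w v"
  shows "bdry G (walk_flow w) x = of_bool (v = x) - of_bool (u = x)"
  using assms(2)
proof (induction w arbitrary: u)
  case Nil
  then show ?case by (simp add: bdry_def)
next
  case (Cons b w)
  then have b: "b \<in> bonds G" "u = src G b" "walk G (dst G b) w v" by (auto simp only: walk_Cons_iff)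
  have "walk_flow (b # w) = unit_flow b + walk_flow w" by (simp add: fun_eq_iff)
  then show ?case using Cons.IH[OF b(3)] bdry_unit_flow[OF assms(1) b(1), of x] b(2) by (simp only: bdry_add)
qed

lemma walk_flow_outside: "(\<And>s. s \<in> set w \<Longrightarrow> fst s \<noteq> e) \<Longrightarrow> walk_flow w e = 0"
proof (induction w)
  case (Cons b w)
  have "unit_flow b e = 0" using Cons.prems[of b] by (auto simp: unit_flow_def)
  then show ?case using Cons by simp
qed simp

lemma closing_walk_cycle:
  assumes fin: "finite (arcs G)" and b: "b \<in> bonds G" and w: "walk G (dst G b) w (src G b)"
  shows "unit_flow b + walk_flow w \<in> cycles G"
proof -
  have "bdry G (unit_flow b + walk_flow w) x = 0" for x
    unfolding bdry_add bdry_unit_flow[OF fin b] bdry_walk_flow[OF fin w] by simp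
  moreover have "(unit_flow b + walk_flow w) e = 0" if e: "e \<notin> arcs G" for e
  proof -
    have ne: "fst s \<noteq> e" if "s \<in> bonds G" for s using that e by (cases s) (auto simp: bonds_def)
    have "walk_flow w e = 0" using walk_bonds[OF w] ne by (intro walk_flow_outside) blast
    moreover have "unit_flow b e = 0" using ne[OF b] by (auto simp: unit_flow_def)
    ultimately show ?thesis by simp
  qed
  ultimately show ?thesis by (simp add: cycles_def)
qed

lemma conn3_walk:
  assumes "conn3 G" "X \<subseteq> verts G" "card X < 3" "a \<in> verts G" "a \<notin> X" "b \<in> verts G" "b \<notin> X"
  shows "\<exists>w. walk G a w b \<and> (\<forall>s\<in>set w. src G s \<notin> X \<and> dst G s \<notin> X)"
proof -
  have "\<forall>X \<subseteq> verts G. card X < 3 \<longrightarrow> (\<forall>a\<in>verts G - X. \<forall>b\<in>verts G - X.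
        \<exists>w. walk G a w b \<and> (\<forall>s\<in>set w. src G s \<notin> X \<and> dst G s \<notin> X))"
    using assms(1) unfolding conn3_def by (rule conjunct2)
  from this[rule_format, of X a b] assms(2-7) show ?thesis by auto
qed

text \<open>
  The walk goes through a vertex \<open>w\<close>. Its first part avoids \<open>a\<close> and an element \<open>p\<close> of \<open>{c, d}\<close>, its second part avoids \<open>b\<close> and
  an element \<open>q\<close> of \<open>{c, d}\<close>, so no step uses one of the two pairs. If the pairs meet, a vertex outside both serves as
  \<open>w\<close>; if they are disjoint, \<open>c\<close> or \<open>d\<close> itself may be taken.
\<close>

lemma conn3_avoid_pairs:
  assumes G: "fin_digraph G" and conn: "conn3 G"
    and ab: "a \<in> verts G" "b \<in> verts G" "a \<noteq> b" and cd: "c \<in> verts G" "d \<in> verts G" "c \<noteq> d"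
  shows "\<exists>w. walk G b w a \<and> (\<forall>s\<in>set w. {src G s, dst G s} \<noteq> {a, b} \<and> {src G s, dst G s} \<noteq> {c, d})"
proof -
  interpret fin_digraph G by fact
  have "\<exists>w p q. w \<in> verts G \<and> w \<noteq> a \<and> w \<noteq> b \<and> p \<in> {c, d} \<and> p \<noteq> b \<and> p \<noteq> w \<and> q \<in> {c, d} \<and> q \<noteq> a \<and> q \<noteq> w"
  proof (cases "{a, b} \<inter> {c, d} = {}")
    case True
    then show ?thesis using cd by (intro exI[of _ c] exI[of _ d]) auto
  next
    case False
    then have "card {a, b, c, d} \<le> 3" by (auto simp: card_insert_if)
    then have "\<not> verts G \<subseteq> {a, b, c, d}" using conn card_mono[of "{a, b, c, d}" "verts G"] by (auto simp: conn3_def)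
    then obtain w where w: "w \<in> verts G" "w \<notin> {a, b, c, d}" by blast
    moreover obtain p where "p \<in> {c, d}" "p \<noteq> b" using cd by (cases "c = b") auto
    moreover obtain q where "q \<in> {c, d}" "q \<noteq> a" using cd by (cases "c = a") auto
    ultimately show ?thesis by blast
  qed
  then obtain w p q where w: "w \<in> verts G" "w \<noteq> a" "w \<noteq> b" and p: "p \<in> {c, d}" "p \<noteq> b" "p \<noteq> w"
    and q: "q \<in> {c, d}" "q \<noteq> a" "q \<noteq> w" by blast
  have pv: "p \<in> verts G" "q \<in> verts G" using p q cd by auto
  have c2: "card {x, y} < 3" for x y :: 'a by (simp add: card_insert_if)
  have "\<exists>v. walk G b v w \<and> (\<forall>s\<in>set v. src G s \<notin> {a, p} \<and> dst G s \<notin> {a, p})"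
    by (rule conn3_walk[OF conn _ c2]) (use ab w p pv in auto)
  then obtain w1 where w1: "walk G b w1 w" "\<And>s. s \<in> set w1 \<Longrightarrow> src G s \<notin> {a, p} \<and> dst G s \<notin> {a, p}" by blast
  have "\<exists>v. walk G w v a \<and> (\<forall>s\<in>set v. src G s \<notin> {b, q} \<and> dst G s \<notin> {b, q})"
    by (rule conn3_walk[OF conn _ c2]) (use ab w q pv in auto)
  then obtain w2 where w2: "walk G w w2 a" "\<And>s. s \<in> set w2 \<Longrightarrow> src G s \<notin> {b, q} \<and> dst G s \<notin> {b, q}" by blast
  have "walk G b (w1 @ w2) a" by (rule walk_append[OF w1(1) w2(1)])
  moreover have "{src G s, dst G s} \<noteq> {a, b} \<and> {src G s, dst G s} \<noteq> {c, d}" if "s \<in> set (w1 @ w2)" for s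
  proof (cases "s \<in> set w1")
    case True
    from w1(2)[OF this] have "a \<notin> {src G s, dst G s}" "p \<notin> {src G s, dst G s}" by auto
    then show ?thesis using p(1) by (intro conjI) (metis insertI1, metis)
  next
    case False
    then have "s \<in> set w2" using that by simp
    from w2(2)[OF this] have "b \<notin> {src G s, dst G s}" "q \<notin> {src G s, dst G s}" by auto
    then show ?thesis using q(1) by (intro conjI) (metis insertI1 insertI2, metis)
  qed
  ultimately show ?thesis by (intro exI[of _ "w1 @ w2"] conjI ballI) auto
qed

lemma unit_loop_cycle:
  assumes "fin_digraph G" "e \<in> arcs G" "tail G e = head G e"
  shows "unit_flow (e, True) \<in> cycles G"
proof -
  interpret fin_digraph G by fact
  show ?thesis
    using closing_walk_cycle[OF finite_arcs, of "(e, True)" "[]"] assms(2,3)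
    by (simp add: bonds_def src_def dst_def)
qed

lemma cycles_scale: "h \<in> cycles G \<Longrightarrow> (\<lambda>e. n * h e) \<in> cycles G"
  by (auto simp: cycles_def bdry_def mult.assoc simp flip: sum_distrib_left)

text \<open>
  The edge \<open>f\<close> is closed up by a walk that avoids all edges parallel to \<open>f\<close> or to \<open>e\<close>. If \<open>e\<close> is a loop, then a
  multiple of its own flow is subtracted.
\<close>

lemma flow_through_avoiding:
  assumes G: "fin_digraph G" and conn: "conn3 G" and f: "f \<in> arcs G"
  shows "\<exists>x\<in>cycles G. x f = 1 \<and> (e \<noteq> f \<longrightarrow> x e = 0)"
proof (cases "tail G f = head G f")
  interpret fin_digraph G by fact
  case True
  then show ?thesis using unit_loop_cycle[OF G f True]
    by (intro bexI[of _ "unit_flow (f, True)"]) (auto simp: unit_flow_def)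
next
  interpret fin_digraph G by fact
  case False
  define c where "c = (if e \<in> arcs G \<and> tail G e \<noteq> head G e then tail G e else tail G f)"
  define d where "d = (if e \<in> arcs G \<and> tail G e \<noteq> head G e then head G e else head G f)"
  have "c \<in> verts G" "d \<in> verts G" "c \<noteq> d" using f False by (auto simp: c_def d_def)
  from conn3_avoid_pairs[OF G conn _ _ False this] f
  have "\<exists>w. walk G (head G f) w (tail G f) \<and>
     (\<forall>s\<in>set w. {src G s, dst G s} \<noteq> {tail G f, head G f} \<and> {src G s, dst G s} \<noteq> {c, d})" by simp
  then obtain w where w: "walk G (head G f) w (tail G f)"
    "\<And>s. s \<in> set w \<Longrightarrow> {src G s, dst G s} \<noteq> {tail G f, head G f} \<and> {src G s, dst G s} \<noteq> {c, d}" by blast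
  have ends: "{src G s, dst G s} = {tail G (fst s), head G (fst s)}" for s by (auto simp: src_def dst_def)
  have wf: "walk_flow w f = 0" using w(2) ends by (intro walk_flow_outside) blast
  have we: "walk_flow w e = 0" if "e \<in> arcs G" "tail G e \<noteq> head G e"
  proof (rule walk_flow_outside)
    fix s assume "s \<in> set w"
    then show "fst s \<noteq> e" using w(2)[of s] ends[of s] that by (auto simp: c_def d_def)
  qed
  define x where "x = unit_flow (f, True) + walk_flow w"
  have x: "x \<in> cycles G" unfolding x_def
    using f w(1) by (intro closing_walk_cycle finite_arcs) (auto simp: bonds_def src_def dst_def)
  have xf: "x f = 1" by (simp add: x_def wf unit_flow_def)
  show ?thesis
  proof (cases "e \<in> arcs G \<and> tail G e = head G e \<and> e \<noteq> f")
    case True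
    let ?x = "x - (\<lambda>i. x e * unit_flow (e, True) i)"
    have "?x \<in> cycles G" using True by (intro cycles_diff x cycles_scale unit_loop_cycle G) auto
    moreover have "?x f = 1" "?x e = 0" using True xf by (auto simp: unit_flow_def)
    ultimately show ?thesis by blast
  next
    case False
    have "x e = 0" if "e \<noteq> f"
    proof (cases "e \<in> arcs G")
      case True
      then have "walk_flow w e = 0" using we False that by blast
      then show ?thesis using that by (simp add: x_def unit_flow_def)
    next
      case False
      then show ?thesis using x by (simp add: cycles_def)
    qed
    then show ?thesis using x xf by blast
  qed
qed

section \<open>Edges and lengths from the norm of flows\<close>

text \<open>
  If \<open>x\<close> works for all functionals but the last and \<open>y\<close> for the last, then \<open>y - n x\<close> works for all but finitely
  many \<open>n\<close>.
\<close>

lemma common_nonvanishing: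
  fixes Z :: "'a::ab_group_add set" and p :: "'i \<Rightarrow> 'a \<Rightarrow> int"
  assumes "finite I" and diff: "\<And>x y. x \<in> Z \<Longrightarrow> y \<in> Z \<Longrightarrow> x - y \<in> Z" and Z0: "0 \<in> Z"
    and p: "\<And>i x y. i \<in> I \<Longrightarrow> x \<in> Z \<Longrightarrow> y \<in> Z \<Longrightarrow> p i (x - y) = p i x - p i y"
    and ne: "\<And>i. i \<in> I \<Longrightarrow> \<exists>x\<in>Z. p i x \<noteq> 0"
  shows "\<exists>x\<in>Z. \<forall>i\<in>I. p i x \<noteq> 0"
  using \<open>finite I\<close> p ne
proof (induction I rule: finite_induct)
  case empty
  then show ?case using Z0 by blast
next
  case (insert j I)
  obtain x where x: "x \<in> Z" "\<And>i. i \<in> I \<Longrightarrow> p i x \<noteq> 0" using insert.IH insert.prems by auto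
  obtain y where y: "y \<in> Z" "p j y \<noteq> 0" using insert.prems(2) by blast
  \<comment> \<open>In a group without scalars the candidate \<open>y - n x\<close> is written as an iterated difference.\<close>
  define m where "m n = ((\<lambda>z. z - x) ^^ n) y" for n :: nat
  have m: "m n \<in> Z \<and> (\<forall>i\<in>insert j I. p i (m n) = p i y - int n * p i x)" for n
  proof (induction n)
    case 0
    then show ?case using y by (simp add: m_def)
  next
    case (Suc n)
    have eq: "m (Suc n) = m n - x" by (simp add: m_def)
    have mn: "m n \<in> Z" using Suc by blast
    have "p i (m n - x) = p i y - int (Suc n) * p i x" if i: "i \<in> insert j I" for i
    proof -
      have "p i (m n) = p i y - int n * p i x" using Suc i by blast
      then show ?thesis unfolding insert.prems(1)[OF i mn x(1)] by (simp add: algebra_simps)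
    qed
    then show ?case unfolding eq using diff[OF mn x(1)] by blast
  qed
  have "finite {n. p i y - int n * p i x = 0}" if i: "i \<in> insert j I" for i
  proof (cases "p i x = 0")
    case True
    then have "i = j" using x(2)[of i] i by auto
    then show ?thesis using True y(2) by simp
  next
    case False
    have "{n. p i y - int n * p i x = 0} \<subseteq> {nat (p i y div p i x)}" using False by auto
    then show ?thesis by (rule finite_subset) simp
  qed
  then have "finite (\<Union>i\<in>insert j I. {n. p i y - int n * p i x = 0})" using insert.hyps(1) by blast
  from ex_new_if_finite[OF infinite_UNIV_nat this]
  obtain n where n: "n \<notin> (\<Union>i\<in>insert j I. {n. p i y - int n * p i x = 0})" by (elim exE)
  have "p i (m n) \<noteq> 0" if i: "i \<in> insert j I" for i
  proof -
    have "p i (m n) = p i y - int n * p i x" using m[of n] i by blast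
    moreover have "p i y - int n * p i x \<noteq> 0" using n i by (simp only: UN_iff mem_Collect_eq) blast
    ultimately show ?thesis by simp
  qed
  then show ?case using m[of n] by (intro bexI[of _ "m n"]) auto
qed

lemma abs_second_difference:
  fixes a b :: int
  assumes "M > \<bar>b\<bar>"
  shows "\<bar>M * a + b\<bar> + \<bar>M * a - b\<bar> - 2 * \<bar>M * a\<bar> = (if a = 0 then 2 * \<bar>b\<bar> else 0)"
proof (cases "a = 0")
  case False
  then have "1 \<le> \<bar>a\<bar>" by simp
  then have "\<bar>M\<bar> * 1 \<le> \<bar>M\<bar> * \<bar>a\<bar>" by (intro mult_left_mono) auto
  then have "\<bar>b\<bar> \<le> \<bar>M * a\<bar>" using assms by (simp add: abs_mult)
  moreover have "\<bar>c + b\<bar> + \<bar>c - b\<bar> - 2 * \<bar>c\<bar> = 0" if "\<bar>b\<bar> \<le> \<bar>c\<bar>" for c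
    using that by (simp add: abs_if split: if_splits)
  ultimately show ?thesis using False by simp
qed simp

text \<open>
  Far from the hyperplanes \<open>x f = 0\<close> the norm is linear, so its second difference at \<open>M x\<close> collects only the kinks from the
  edges on which \<open>x\<close> vanishes.
\<close>

lemma flow_norm_second_difference:
  assumes fin: "finite (arcs G)" and M: "\<And>f. f \<in> arcs G \<Longrightarrow> M > \<bar>y f\<bar>"
  shows "flow_norm G L (\<lambda>f. M * x f + y f) + flow_norm G L (\<lambda>f. M * x f - y f) - 2 * flow_norm G L (\<lambda>f. M * x f) =
    2 * (\<Sum>f\<in>{f\<in>arcs G. x f = 0}. L f * real_of_int \<bar>y f\<bar>)"
proof -
  have "flow_norm G L (\<lambda>f. M * x f + y f) + flow_norm G L (\<lambda>f. M * x f - y f) - 2 * flow_norm G L (\<lambda>f. M * x f) =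
     (\<Sum>f\<in>arcs G. L f * real_of_int (\<bar>M * x f + y f\<bar> + \<bar>M * x f - y f\<bar> - 2 * \<bar>M * x f\<bar>))"
    by (simp add: flow_norm_def sum.distrib sum_subtractf sum_distrib_left algebra_simps)
  also have "\<dots> = (\<Sum>f\<in>arcs G. if x f = 0 then 2 * (L f * real_of_int \<bar>y f\<bar>) else 0)"
  proof (rule sum.cong[OF refl])
    fix f assume "f \<in> arcs G"
    show "L f * real_of_int (\<bar>M * x f + y f\<bar> + \<bar>M * x f - y f\<bar> - 2 * \<bar>M * x f\<bar>) =
        (if x f = 0 then 2 * (L f * real_of_int \<bar>y f\<bar>) else 0)"
      unfolding abs_second_difference[OF M[OF \<open>f \<in> arcs G\<close>]] by simp
  qed
  also have "\<dots> = (\<Sum>f\<in>{f\<in>arcs G. x f = 0}. 2 * (L f * real_of_int \<bar>y f\<bar>))"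
    by (rule sum.inter_filter[OF fin, symmetric])
  finally show ?thesis by (simp add: sum_distrib_left)
qed

text \<open>
  Take a flow \<open>x\<close> that vanishes on \<open>e\<close> and is generic otherwise. The kink of the norm at \<open>x\<close> in the
  direction \<open>y\<close> is \<open>2 * L e * \<bar>y e\<bar>\<close>. The isometry carries it to a sum over the edges \<open>f\<close> on which \<open>\<phi> x\<close> vanishes. Because
  \<open>x\<close> is generic, the coordinate at such an \<open>f\<close> vanishes on the image of every flow that vanishes on \<open>e\<close>, so it is a
  multiple of the coordinate at \<open>e\<close>. Flows of \<open>G'\<close> separate edges and take the value 1 on each edge. Hence there is at most one \<open>f\<close>,
  with factor 1 or \<open>- 1\<close>, and there is one because the kink is not 0.
\<close>

theorem flow_isometry_edge_bijection:
  assumes G: "quantum_graph G L" "conn3 G" and G': "quantum_graph G' L'" "conn3 G'"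
    and bij: "bij_betw \<phi> (cycles G) (cycles G')"
    and diff: "\<And>h k. h \<in> cycles G \<Longrightarrow> k \<in> cycles G \<Longrightarrow> \<phi> (h - k) = \<phi> h - \<phi> k"
    and norm: "\<And>h. h \<in> cycles G \<Longrightarrow> flow_norm G' L' (\<phi> h) = flow_norm G L h"
    and e: "e \<in> arcs G"
  shows "\<exists>f\<in>arcs G'. L' f = L e \<and> (\<exists>\<epsilon>. \<bar>\<epsilon>\<bar> = 1 \<and> (\<forall>h\<in>cycles G. \<phi> h f = \<epsilon> * h e))"
proof -
  interpret G: quantum_graph G L by fact
  interpret G': quantum_graph G' L' by fact
  have \<phi>c: "\<phi> h \<in> cycles G'" if "h \<in> cycles G" for h using bij that bij_betwE by blast
  have \<phi>0: "\<phi> 0 = 0" using diff[OF cycles_0 cycles_0] by simp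
  have \<phi>add: "\<phi> (h + k) = \<phi> h + \<phi> k" if "h \<in> cycles G" "k \<in> cycles G" for h k
    using diff[OF cycles_0 that(2)] diff[OF that(1) cycles_diff[OF cycles_0 that(2)]] \<phi>0 by simp
  have scale: "\<phi> (\<lambda>i. int n * h i) = (\<lambda>i. int n * \<phi> h i)" if h: "h \<in> cycles G" for n h
  proof (induction n)
    case 0
    show ?case using \<phi>0 by (simp add: zero_fun_def)
  next
    case (Suc n)
    have "(\<lambda>i. int (Suc n) * h i) = h + (\<lambda>i. int n * h i)" by (auto simp: algebra_simps)
    then show ?case using \<phi>add[OF h cycles_scale[OF h, of "int n"]] Suc by (auto simp: algebra_simps)
  qed
  let ?Z = "{h \<in> cycles G. h e = 0}"
  \<comment> \<open>The flow \<open>x\<close> is generic among those that vanish on \<open>e\<close>: no edge coordinate, on either graph, vanishes at \<open>x\<close> unless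
    it vanishes on all these flows.\<close>
  define I where "I = Inl ` (arcs G - {e}) \<union> Inr ` {f \<in> arcs G'. \<exists>h\<in>?Z. \<phi> h f \<noteq> 0}"
  define p where "p i h = (case i of Inl f \<Rightarrow> h f | Inr f \<Rightarrow> \<phi> h f)" for i h
  have "\<exists>x\<in>?Z. \<forall>i\<in>I. p i x \<noteq> 0"
  proof (rule common_nonvanishing)
    show "finite I" by (simp add: I_def)
    show "\<exists>x\<in>?Z. p i x \<noteq> 0" if i: "i \<in> I" for i
    proof (cases i)
      case (Inl f)
      then have f: "f \<in> arcs G" "e \<noteq> f" using i by (auto simp: I_def)
      obtain x where "x \<in> cycles G" "x f = 1" "x e = 0"
        using flow_through_avoiding[OF G.fin_digraph_axioms G(2) f(1), of e] f(2) by blast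
      then show ?thesis using Inl by (intro bexI[of _ x]) (auto simp: p_def)
    next
      case (Inr f)
      then have "\<exists>h\<in>?Z. \<phi> h f \<noteq> 0" using i by (auto simp: I_def)
      then show ?thesis using Inr by (simp add: p_def)
    qed
    show "p i (x - y) = p i x - p i y" if "x \<in> ?Z" "y \<in> ?Z" for i x y
      using that diff by (cases i) (auto simp: p_def)
  qed (auto simp: cycles_diff cycles_0)
  then obtain x where x: "x \<in> cycles G" "x e = 0" and xI: "\<And>i. i \<in> I \<Longrightarrow> p i x \<noteq> 0" by blast
  have xG: "{f \<in> arcs G. x f = 0} = {e}"
  proof -
    have "x f \<noteq> 0" if "f \<in> arcs G" "f \<noteq> e" for f using xI[of "Inl f"] that by (auto simp: I_def p_def)
    then show ?thesis using e x(2) by blast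
  qed
  have xG': "\<phi> h f = 0" if "f \<in> arcs G'" "\<phi> x f = 0" "h \<in> ?Z" for f h
    using xI[of "Inr f"] that by (auto simp: I_def p_def)
  obtain y where y: "y \<in> cycles G" "y e = 1"
    using flow_through_avoiding[OF G.fin_digraph_axioms G(2) e, of e] by blast
  have along: "\<phi> h f = \<phi> y f * h e" if f: "f \<in> arcs G'" "\<phi> x f = 0" and h: "h \<in> cycles G" for f h
  proof -
    have ye: "(\<lambda>i. h e * y i) \<in> cycles G" by (rule cycles_scale[OF y(1)])
    have "h - (\<lambda>i. h e * y i) \<in> ?Z" using cycles_diff[OF h ye] y(2) by simp
    from xG'[OF f this] have "\<phi> h f = \<phi> (\<lambda>i. h e * y i) f" using diff[OF h ye] by simp
    also have "\<dots> = h e * \<phi> y f"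
    proof (cases "h e \<ge> 0")
      case True
      then show ?thesis using fun_cong[OF scale[OF y(1), of "nat (h e)"], of f] by simp
    next
      case False
      let ?n = "nat (- h e)"
      have "(\<lambda>i. h e * y i) = 0 - (\<lambda>i. int ?n * y i)" using False by auto
      then have "\<phi> (\<lambda>i. h e * y i) = \<phi> 0 - \<phi> (\<lambda>i. int ?n * y i)"
        using diff[OF cycles_0 cycles_scale[OF y(1), of "int ?n"]] by simp
      then show ?thesis using fun_cong[OF scale[OF y(1), of ?n], of f] \<phi>0 False by simp
    qed
    finally show ?thesis by (simp add: mult.commute)
  qed
  let ?F = "{f \<in> arcs G'. \<phi> x f = 0}"
  obtain n :: nat where n: "\<And>f. f \<in> arcs G \<Longrightarrow> int n > \<bar>y f\<bar>" "\<And>f. f \<in> arcs G' \<Longrightarrow> int n > \<bar>\<phi> y f\<bar>"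
  proof -
    define N where "N = (\<Sum>f\<in>arcs G. nat \<bar>y f\<bar>) + (\<Sum>f\<in>arcs G'. nat \<bar>\<phi> y f\<bar>) + 1"
    have "nat \<bar>y f\<bar> < N" if "f \<in> arcs G" for f
      using member_le_sum[OF that, of "\<lambda>f. nat \<bar>y f\<bar>"] by (simp add: N_def)
    moreover have "nat \<bar>\<phi> y f\<bar> < N" if "f \<in> arcs G'" for f
      using member_le_sum[OF that, of "\<lambda>f. nat \<bar>\<phi> y f\<bar>"] by (simp add: N_def)
    ultimately show ?thesis by (intro that[of N]) (auto simp: nat_less_iff)
  qed
  have nx: "(\<lambda>i. int n * x i) \<in> cycles G" by (rule cycles_scale[OF x(1)])
  have plus: "(\<lambda>f. int n * x f + y f) = (\<lambda>i. int n * x i) + y" "(\<lambda>f. int n * x f - y f) = (\<lambda>i. int n * x i) - y" by auto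
  have plus': "(\<lambda>f. int n * \<phi> x f + \<phi> y f) = \<phi> ((\<lambda>i. int n * x i) + y)" "(\<lambda>f. int n * \<phi> x f - \<phi> y f) = \<phi> ((\<lambda>i. int n * x i) - y)"
    using \<phi>add[OF nx y(1)] diff[OF nx y(1)] scale[OF x(1), of n] by auto
  note dG = flow_norm_second_difference[where G = G and L = L and M = "int n" and x = x and y = y, OF G.finite_arcs n(1)]
  note dG' = flow_norm_second_difference[where G = G' and L = L' and M = "int n" and x = "\<phi> x" and y = "\<phi> y",
      OF G'.finite_arcs n(2)]
  have "2 * (\<Sum>f\<in>?F. L' f * real_of_int \<bar>\<phi> y f\<bar>) =
      flow_norm G' L' (\<phi> ((\<lambda>i. int n * x i) + y)) + flow_norm G' L' (\<phi> ((\<lambda>i. int n * x i) - y)) -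
      2 * flow_norm G' L' (\<phi> (\<lambda>i. int n * x i))"
    using dG' unfolding plus' scale[OF x(1)] by linarith
  also have "\<dots> = flow_norm G L ((\<lambda>i. int n * x i) + y) + flow_norm G L ((\<lambda>i. int n * x i) - y) -
      2 * flow_norm G L (\<lambda>i. int n * x i)"
    by (simp only: norm[OF nx] norm[OF cycles_add[OF nx y(1)]] norm[OF cycles_diff[OF nx y(1)]])
  also have "\<dots> = 2 * (\<Sum>f\<in>{f \<in> arcs G. x f = 0}. L f * real_of_int \<bar>y f\<bar>)"
    using dG unfolding plus by linarith
  also have "\<dots> = 2 * L e" unfolding xG using y(2) by simp
  finally have eq: "(\<Sum>f\<in>?F. L' f * real_of_int \<bar>\<phi> y f\<bar>) = L e" by linarith
  have pm: "\<bar>\<phi> y f\<bar> = 1" if f: "f \<in> ?F" for f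
  proof -
    obtain z where z: "z \<in> cycles G'" "z f = 1"
      using flow_through_avoiding[OF G'.fin_digraph_axioms G'(2), of f f] f by blast
    then obtain h where h: "h \<in> cycles G" "z = \<phi> h" using bij by (auto simp: bij_betw_def)
    then have "1 = \<phi> y f * h e" using along[of f h] f z(2) by simp
    then show ?thesis by (metis abs_zmult_eq_1 abs_1)
  qed
  have uniq: "f1 = f2" if f: "f1 \<in> ?F" "f2 \<in> ?F" for f1 f2
  proof (rule ccontr)
    assume "f1 \<noteq> f2"
    then obtain z where z: "z \<in> cycles G'" "z f2 = 1" "z f1 = 0"
      using flow_through_avoiding[OF G'.fin_digraph_axioms G'(2), of f2 f1] f by blast
    then obtain h where h: "h \<in> cycles G" "z = \<phi> h" using bij by (auto simp: bij_betw_def)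
    have "\<phi> y f1 * h e = 0" "\<phi> y f2 * h e = 1" using along[of f1 h] along[of f2 h] f z h by auto
    then show False using pm[OF f(1)] by auto
  qed
  have "?F \<noteq> {}"
  proof
    assume "?F = {}"
    then have "L e = 0" using eq by (metis sum.empty)
    then show False using G.length_pos[OF e] by simp
  qed
  then obtain f where f: "f \<in> ?F" by blast
  then have "?F = {f}" using uniq by blast
  then have "L' f = L e" using eq pm[OF f] by simp
  moreover have "\<forall>h\<in>cycles G. \<phi> h f = \<phi> y f * h e" using along f by blast
  ultimately show ?thesis using f pm[OF f] by blast
qed

section \<open>Vertices from the supports of flows\<close>

definition star :: "('v, 'e) pre_digraph \<Rightarrow> 'v \<Rightarrow> 'e set" where
  "star G v = {e \<in> arcs G. tail G e \<noteq> head G e \<and> (tail G e = v \<or> head G e = v)}"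

text \<open>
  A flow cannot enter a vertex without leaving it.
\<close>

lemma cycles_star_single:
  assumes fin: "finite (arcs G)" and h: "h \<in> cycles G" and e: "e \<in> star G v"
    and z: "\<And>f. f \<in> star G v \<Longrightarrow> f \<noteq> e \<Longrightarrow> h f = 0"
  shows "h e = 0"
proof -
  have "0 = bdry G h v" using h by (simp add: cycles_def)
  also have "\<dots> = (\<Sum>f\<in>arcs G. if f = e then h f * (of_bool (head G f = v) - of_bool (tail G f = v)) else 0)"
    unfolding bdry_def
  proof (rule sum.cong[OF refl])
    fix f assume "f \<in> arcs G"
    then show "h f * (of_bool (head G f = v) - of_bool (tail G f = v)) =
        (if f = e then h f * (of_bool (head G f = v) - of_bool (tail G f = v)) else 0)"
      using z[of f] by (cases "f \<in> star G v") (auto simp: star_def)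
  qed
  also have "\<dots> = h e * (of_bool (head G e = v) - of_bool (tail G e = v))"
    using e by (simp add: sum.delta'[OF fin] sum.delta[OF fin] star_def)
  finally show ?thesis using e by (auto simp: star_def split: if_splits)
qed

lemma star_into:
  assumes "e \<in> star G u" shows "\<exists>b\<in>bonds G. fst b = e \<and> dst G b = u \<and> src G b \<noteq> u"
  using assms by (intro bexI[of _ "(e, head G e = u)"]) (auto simp: star_def src_def dst_def bonds_def)

lemma star_out:
  assumes "e \<in> star G u" shows "\<exists>b\<in>bonds G. fst b = e \<and> src G b = u \<and> dst G b \<noteq> u"
  using assms by (intro bexI[of _ "(e, tail G e = u)"]) (auto simp: star_def src_def dst_def bonds_def)

lemma bond_in_star:
  assumes "b \<in> bonds G" "src G b \<noteq> dst G b" shows "fst b \<in> star G (src G b)" "fst b \<in> star G (dst G b)"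
  using assms by (cases b; cases "snd b"; simp add: star_def src_def dst_def bonds_def)+

lemma walk_leaves:
  assumes "walk G u w x" "u \<noteq> x"
  shows "\<exists>s\<in>set w. src G s = u \<and> dst G s \<noteq> u"
  using assms
proof (induction w arbitrary: u)
  case (Cons s w)
  then have s: "u = src G s" "walk G (dst G s) w x" by (simp_all only: walk_Cons_iff)
  show ?case
  proof (cases "dst G s = u")
    case True
    then show ?thesis using Cons.IH[of u] s Cons.prems(2) by auto
  qed (use s in auto)
qed simp

lemma (in wf_digraph) walk_reverse:
  "walk G u w x \<Longrightarrow> walk G x (rev (map flip w)) u"
proof (induction w arbitrary: u)
  case (Cons s w)
  from Cons.prems have s: "s \<in> bonds G" "u = src G s" "walk G (dst G s) w x" by (simp_all only: walk_Cons_iff)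
  have "walk G (dst G s) [flip s] u"
    using s(1,2) bond_ends_in_verts[OF s(1)] by (simp add: walk_Cons_iff flip_simps del: walk.simps(2))
  from walk_append[OF Cons.IH[OF s(3)] this] show ?case by simp
qed simp

lemma conn3_leaves:
  assumes G: "wf_digraph G" "conn3 G" and X: "X \<subseteq> verts G" "card X < 3" and u: "u \<in> verts G" "u \<notin> X"
  shows "\<exists>s\<in>bonds G. src G s = u \<and> dst G s \<noteq> u \<and> dst G s \<notin> X"
proof -
  have card: "card (verts G) > 3" using G(2) by (simp add: conn3_def)
  then have "finite (verts G)" using card.infinite by fastforce
  then have "finite X" using X(1) finite_subset by blast
  have "card (insert u X) \<le> 3" using X(2) \<open>finite X\<close> by (simp add: card_insert_if)
  then have "\<not> verts G \<subseteq> insert u X"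
    using card card_mono[of "insert u X" "verts G"] \<open>finite X\<close> by auto
  then obtain z where z: "z \<in> verts G" "z \<noteq> u" "z \<notin> X" by auto
  obtain w where w: "walk G u w z" "\<forall>s\<in>set w. src G s \<notin> X \<and> dst G s \<notin> X"
    using conn3_walk[OF G(2) X u z(1,3)] by blast
  obtain s where "s \<in> set w" "src G s = u" "dst G s \<noteq> u" using walk_leaves[OF w(1)] z(2) by blast
  then show ?thesis using w(2) walk_bonds[OF w(1)] by blast
qed

text \<open>
  The path from the start of \<open>b\<close> over \<open>c\<close> is closed up outside \<open>X\<close>.
\<close>

lemma two_edge_flow:
  assumes G: "fin_digraph G" "conn3 G" and bc: "b \<in> bonds G" "c \<in> bonds G" "dst G b = src G c" "fst b \<noteq> fst c"
    and X: "X \<subseteq> verts G" "card X < 3" "src G c \<in> X" "src G b \<notin> X" "dst G c \<notin> X"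
  shows "\<exists>x\<in>cycles G. x (fst b) \<noteq> 0 \<and> x (fst c) \<noteq> 0 \<and>
    (\<forall>e. e \<noteq> fst b \<longrightarrow> e \<noteq> fst c \<longrightarrow> tail G e \<in> X \<or> head G e \<in> X \<longrightarrow> x e = 0)"
proof -
  interpret fin_digraph G by fact
  obtain w where w: "walk G (dst G c) w (src G b)" "\<forall>s\<in>set w. src G s \<notin> X \<and> dst G s \<notin> X"
    using conn3_walk[OF G(2) X(1,2) bond_ends_in_verts(2)[OF bc(2)] X(5) bond_ends_in_verts(1)[OF bc(1)] X(4)] by blast
  have wX: "walk_flow w e = 0" if "tail G e \<in> X \<or> head G e \<in> X" for e
  proof (rule walk_flow_outside)
    fix s assume "s \<in> set w"
    with w(2) have "src G s \<notin> X" "dst G s \<notin> X" by blast+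
    then show "fst s \<noteq> e" using that by (cases "snd s") (auto simp: src_def dst_def)
  qed
  let ?x = "unit_flow b + walk_flow (c # w)"
  have xc: "?x \<in> cycles G"
    using w(1) bc by (intro closing_walk_cycle finite_arcs) (simp_all add: walk_Cons_iff del: walk.simps(2))
  have ends: "tail G (fst b) \<in> X \<or> head G (fst b) \<in> X" "tail G (fst c) \<in> X \<or> head G (fst c) \<in> X"
    using X(3) bc(3) by (auto simp: src_def dst_def split: if_splits)
  have x: "?x e = unit_flow b e + unit_flow c e" if "tail G e \<in> X \<or> head G e \<in> X" for e
    using wX[OF that] by simp
  have nz: "unit_flow s e = 0 \<longleftrightarrow> fst s \<noteq> e" for s :: "'b \<times> bool" and e
    by (cases s; cases "snd s") (auto simp: unit_flow_def)
  have "?x (fst b) \<noteq> 0" unfolding x[OF ends(1)] using bc(4) nz[of b "fst b"] nz[of c "fst b"] by simp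
  moreover have "?x (fst c) \<noteq> 0" unfolding x[OF ends(2)] using bc(4) nz[of b "fst c"] nz[of c "fst c"] by simp
  moreover have "?x e = 0" if "e \<noteq> fst b" "e \<noteq> fst c" "tail G e \<in> X \<or> head G e \<in> X" for e
    unfolding x[OF that(3)] using that(1,2) nz[of b e] nz[of c e] by simp
  ultimately show ?thesis using xc by (intro bexI[of _ ?x]) blast+
qed

text \<open>
  A vertex of a 3-connected graph has at least three neighbours.
\<close>

lemma two_edges_avoiding:
  assumes G: "wf_digraph G" "conn3 G" and uv: "u \<in> verts G" "v \<in> verts G" "u \<noteq> v"
  shows "\<exists>b\<in>bonds G. \<exists>c\<in>bonds G. dst G b = u \<and> src G c = u \<and> fst b \<noteq> fst c \<and> src G b \<notin> {u, v} \<and> dst G c \<notin> {u, v}"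
proof -
  interpret wf_digraph G by fact
  obtain s where s: "s \<in> bonds G" "src G s = u" "dst G s \<noteq> u" "dst G s \<noteq> v"
    using conn3_leaves[OF G, of "{v}" u] uv by auto
  have "card {v, dst G s} < 3" by (simp add: card_insert_if)
  then obtain c where c: "c \<in> bonds G" "src G c = u" "dst G c \<noteq> u" "dst G c \<noteq> v" "dst G c \<noteq> dst G s"
    using conn3_leaves[OF G, of "{v, dst G s}" u] uv s bond_ends_in_verts(2)[OF s(1)] by auto
  have "fst (flip s) \<noteq> fst c"
  proof
    assume "fst (flip s) = fst c"
    then show False using s c by (cases "snd s"; cases "snd c") (auto simp: flip_def src_def dst_def)
  qed
  then show ?thesis using s c by (intro bexI[of _ "flip s"] bexI[of _ c]) (auto simp: flip_def src_def dst_def bonds_def)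
qed

text \<open>
  A bijection of edges under which the supports of flows correspond, that is, an isomorphism of the cycle matroids. For
  3-connected graphs Whitney's theorem says that it is induced by an isomorphism of graphs, up to the positions of
  loops.
\<close>

locale cycle_support_iso = G: fin_digraph G + G': fin_digraph G'
  for G :: "('v, 'e) pre_digraph" and G' :: "('w, 'f) pre_digraph" +
  fixes g :: "'e \<Rightarrow> 'f"
  assumes conn: "conn3 G" and conn': "conn3 G'"
    and bij_g: "bij_betw g (arcs G) (arcs G')"
    and push: "h \<in> cycles G \<Longrightarrow> \<exists>h'\<in>cycles G'. \<forall>e\<in>arcs G. h' (g e) = 0 \<longleftrightarrow> h e = 0"
    and pull: "h' \<in> cycles G' \<Longrightarrow> \<exists>h\<in>cycles G. \<forall>e\<in>arcs G. h' (g e) = 0 \<longleftrightarrow> h e = 0"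
begin

lemma g_arcs: "e \<in> arcs G \<Longrightarrow> g e \<in> arcs G'"
  using bij_g by (auto simp: bij_betw_def)

lemma g_eq_iff: "e \<in> arcs G \<Longrightarrow> f \<in> arcs G \<Longrightarrow> g e = g f \<longleftrightarrow> e = f"
  using bij_g by (auto simp: bij_betw_def inj_on_def)

lemma g_surj: "e' \<in> arcs G' \<Longrightarrow> \<exists>e\<in>arcs G. e' = g e"
  using bij_g by (auto simp: bij_betw_def)

lemma star_arcs: "e \<in> star G v \<Longrightarrow> e \<in> arcs G" "e' \<in> star G' w \<Longrightarrow> e' \<in> arcs G'"
  by (simp_all add: star_def)

lemma loop_iff:
  assumes e: "e \<in> arcs G"
  shows "tail G' (g e) = head G' (g e) \<longleftrightarrow> tail G e = head G e"
proof
  assume l: "tail G e = head G e"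
  obtain h' where h': "h' \<in> cycles G'" "\<forall>f\<in>arcs G. h' (g f) = 0 \<longleftrightarrow> unit_flow (e, True) f = 0"
    using push[OF unit_loop_cycle[OF G.fin_digraph_axioms e l]] by blast
  show "tail G' (g e) = head G' (g e)"
  proof (rule ccontr)
    assume "tail G' (g e) \<noteq> head G' (g e)"
    then have "g e \<in> star G' (tail G' (g e))" using g_arcs[OF e] by (simp add: star_def)
    moreover have "h' f = 0" if f: "f \<in> star G' (tail G' (g e))" "f \<noteq> g e" for f
    proof -
      obtain f0 where f0: "f0 \<in> arcs G" "f = g f0" using g_surj star_arcs(2)[OF f(1)] by blast
      then show ?thesis using h'(2) f(2) by (auto simp: unit_flow_def)
    qed
    ultimately have "h' (g e) = 0" by (rule cycles_star_single[OF G'.finite_arcs h'(1)])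
    then show False using h'(2) e by (simp add: unit_flow_def)
  qed
next
  assume l: "tail G' (g e) = head G' (g e)"
  obtain h where h: "h \<in> cycles G" "\<forall>f\<in>arcs G. unit_flow (g e, True) (g f) = 0 \<longleftrightarrow> h f = 0"
    using pull[OF unit_loop_cycle[OF G'.fin_digraph_axioms g_arcs[OF e] l]] by blast
  show "tail G e = head G e"
  proof (rule ccontr)
    assume "tail G e \<noteq> head G e"
    then have "e \<in> star G (tail G e)" using e by (simp add: star_def)
    moreover have "h f = 0" if f: "f \<in> star G (tail G e)" "f \<noteq> e" for f
      using h(2) f(2) g_eq_iff[OF e star_arcs(1)[OF f(1)]] star_arcs(1)[OF f(1)] by (simp add: unit_flow_def)
    ultimately have "h e = 0" by (rule cycles_star_single[OF G.finite_arcs h(1)])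
    then show False using h(2) e by (auto simp: unit_flow_def)
  qed
qed

text \<open>
  The image of a star behaves like a cut: otherwise an edge of the image could be closed up to a flow that uses no other edge of the
  image, and its preimage would be a flow that uses a single edge of the star.
\<close>

lemma star_image_no_bypass:
  assumes v: "v \<in> verts G" and b: "b \<in> bonds G'" "fst b \<in> g ` star G v"
    and w: "walk G' (dst G' b) w (src G' b)"
  shows "\<exists>s\<in>set w. fst s \<in> g ` star G v"
proof (rule ccontr)
  assume no: "\<not> ?thesis"
  let ?x = "unit_flow b + walk_flow w"
  have x: "?x f = (if f = fst b then if snd b then 1 else - 1 else 0)" if "f \<in> g ` star G v" for f
  proof -
    have "walk_flow w f = 0" using no that by (intro walk_flow_outside) auto
    then show ?thesis by (cases b) (auto simp: unit_flow_def)
  qed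
  obtain h where h: "h \<in> cycles G" "\<forall>f\<in>arcs G. ?x (g f) = 0 \<longleftrightarrow> h f = 0"
    using pull[OF closing_walk_cycle[OF G'.finite_arcs b(1) w]] by blast
  obtain e where e: "e \<in> star G v" "fst b = g e" using b(2) by blast
  have "h f = 0" if "f \<in> star G v" "f \<noteq> e" for f
    using h(2) x[of "g f"] that e star_arcs(1) g_eq_iff by auto
  then have "h e = 0" by (rule cycles_star_single[OF G.finite_arcs h(1) e(1)])
  then have "?x (g e) = 0" using h(2) star_arcs(1)[OF e(1)] by blast
  then show False using x[of "g e"] e by (auto split: if_splits)
qed

text \<open>
  Here \<open>W\<close> is a union of components of what is left of \<open>G'\<close> when the image of the star of \<open>v\<close> is removed. Some flow of \<open>G\<close> misses \<open>v\<close> and uses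
  exactly \<open>e\<close> and \<open>f\<close> at \<open>u\<close>. If \<open>W\<close> separated the images of \<open>e\<close> and \<open>f\<close>, then the part of the image flow inside \<open>W\<close> would be
  a flow by itself, and its preimage would use only \<open>e\<close> at \<open>u\<close>.
\<close>

lemma component_adjacent:
  assumes uv: "u \<in> verts G" "v \<in> verts G"
    and W: "\<And>i. i \<in> arcs G' \<Longrightarrow> i \<notin> g ` star G v \<Longrightarrow> tail G' i \<in> W \<longleftrightarrow> head G' i \<in> W"
    and e: "e \<in> star G u" "e \<notin> star G v" and f: "f \<in> star G u" "f \<notin> star G v"
    and eW: "tail G' (g e) \<in> W"
  shows "tail G' (g f) \<in> W"
proof (rule ccontr)
  assume fW: "tail G' (g f) \<notin> W"
  obtain b where b: "b \<in> bonds G" "fst b = e" "dst G b = u" "src G b \<noteq> u" using star_into[OF e(1)] by blast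
  obtain c where c: "c \<in> bonds G" "fst c = f" "src G c = u" "dst G c \<noteq> u" using star_out[OF f(1)] by blast
  have bv: "src G b \<noteq> v" using bond_in_star(1)[OF b(1)] b e(2) by metis
  have cv: "dst G c \<noteq> v" using bond_in_star(2)[OF c(1)] c f(2) by metis
  have "\<exists>x\<in>cycles G. x (fst b) \<noteq> 0 \<and> x (fst c) \<noteq> 0 \<and>
    (\<forall>i. i \<noteq> fst b \<longrightarrow> i \<noteq> fst c \<longrightarrow> tail G i \<in> {u, v} \<or> head G i \<in> {u, v} \<longrightarrow> x i = 0)"
    using uv b c bv cv fW eW by (intro two_edge_flow[OF G.fin_digraph_axioms conn]) (auto simp: card_insert_if)
  then obtain x where x: "x \<in> cycles G" "x e \<noteq> 0" "x f \<noteq> 0"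
    and x0: "\<And>i. i \<noteq> e \<Longrightarrow> i \<noteq> f \<Longrightarrow> tail G i \<in> {u, v} \<or> head G i \<in> {u, v} \<Longrightarrow> x i = 0"
    unfolding b(2) c(2) by blast
  obtain x' where x': "x' \<in> cycles G'" "\<forall>i\<in>arcs G. x' (g i) = 0 \<longleftrightarrow> x i = 0" using push[OF x(1)] by blast
  \<comment> \<open>The part of the image flow inside \<open>W\<close>.\<close>
  define y' where "y' i = (if tail G' i \<in> W then x' i else 0)" for i
  have xB: "x' i = 0" if i: "i \<in> g ` star G v" for i
  proof -
    obtain j where j: "j \<in> star G v" "i = g j" using i by blast
    then have "x j = 0" using e(2) f(2) by (intro x0) (auto simp: star_def)
    then show ?thesis using x'(2) j star_arcs(1) by blast
  qed
  have "bdry G' y' z = (if z \<in> W then bdry G' x' z else 0)" for z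
  proof -
    have "y' i * (of_bool (head G' i = z) - of_bool (tail G' i = z)) =
        (if z \<in> W then x' i * (of_bool (head G' i = z) - of_bool (tail G' i = z)) else 0)" if i: "i \<in> arcs G'" for i
    proof (cases "i \<in> g ` star G v")
      case True
      then show ?thesis using xB by (simp add: y'_def)
    next
      case False
      then show ?thesis using W[OF i False] by (auto simp: y'_def)
    qed
    then show ?thesis by (simp add: bdry_def)
  qed
  then have "y' \<in> cycles G'" using x'(1) by (simp add: cycles_def y'_def)
  from pull[OF this] obtain y where y: "y \<in> cycles G" "\<forall>i\<in>arcs G. y' (g i) = 0 \<longleftrightarrow> y i = 0" by blast
  have yx: "y j = 0 \<longleftrightarrow> tail G' (g j) \<notin> W \<or> x j = 0" if j: "j \<in> arcs G" for j
    using y(2)[rule_format, OF j] x'(2)[rule_format, OF j] unfolding y'_def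
    by (cases "tail G' (g j) \<in> W") simp_all
  have "y i = 0" if i: "i \<in> star G u" "i \<noteq> e" for i
  proof (cases "i = f")
    case True
    then show ?thesis using yx[OF star_arcs(1)[OF i(1)]] fW by simp
  next
    case False
    then have "x i = 0" using i by (intro x0) (auto simp: star_def)
    then show ?thesis using yx[OF star_arcs(1)[OF i(1)]] by simp
  qed
  then have "y e = 0" by (rule cycles_star_single[OF G.finite_arcs y(1) e(1)])
  then show False using yx[OF star_arcs(1)[OF e(1)]] x(2) eW by simp
qed

lemma component_along_walk:
  assumes v: "v \<in> verts G"
    and W: "\<And>i. i \<in> arcs G' \<Longrightarrow> i \<notin> g ` star G v \<Longrightarrow> tail G' i \<in> W \<longleftrightarrow> head G' i \<in> W"
    and f: "f \<in> star G b" "f \<notin> star G v"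
    and "walk G a w b" "\<forall>s\<in>set w. src G s \<noteq> v \<and> dst G s \<noteq> v"
    and "e \<in> star G a" "e \<notin> star G v" "tail G' (g e) \<in> W"
  shows "tail G' (g f) \<in> W"
  using assms(5-9)
proof (induction w arbitrary: a e)
  case Nil
  then show ?case using component_adjacent[OF _ v W Nil(3,4) _ f(2)] f(1) by auto
next
  case (Cons s w)
  from Cons.prems(1) have s: "s \<in> bonds G" "a = src G s" "walk G (dst G s) w b" by (simp_all only: walk_Cons_iff)
  have sv: "src G s \<noteq> v" "dst G s \<noteq> v" and w: "\<forall>s\<in>set w. src G s \<noteq> v \<and> dst G s \<noteq> v" using Cons.prems(2) by auto
  show ?case
  proof (cases "src G s = dst G s")
    case True
    then show ?thesis using Cons.IH[OF s(3) w] Cons.prems(3-5) s(2) by simp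
  next
    case False
    note st = bond_in_star[OF s(1) False]
    have nv: "fst s \<notin> star G v" using sv by (auto simp: star_def src_def dst_def split: if_splits)
    have "tail G' (g (fst s)) \<in> W"
      using component_adjacent[OF G.bond_ends_in_verts(1)[OF s(1)] v W _ Cons.prems(4) st(1) nv Cons.prems(5)]
        Cons.prems(3) s(2) by blast
    from Cons.IH[OF s(3) w st(2) nv this] show ?thesis .
  qed
qed

text \<open>
  After removal of the image \<open>B\<close> of the star, the other edges that are not loops lie in one component \<open>W\<close> of \<open>G'\<close>,
  because they can be joined in \<open>G\<close> by walks that avoid \<open>v\<close>. An edge of \<open>B\<close> joins different components, so it has an end
  \<open>w\<close> outside \<open>W\<close>, and the star of \<open>w\<close> is contained in \<open>B\<close>. It is all of \<open>B\<close>, because \<open>G\<close> has flows that use any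
  two prescribed edges of the star of \<open>v\<close> and no other edge of it.
\<close>

lemma star_image:
  assumes v: "v \<in> verts G"
  shows "\<exists>w\<in>verts G'. star G' w = g ` star G v"
proof -
  let ?B = "g ` star G v"
  obtain W where W: "\<And>i. i \<in> arcs G' \<Longrightarrow> i \<notin> ?B \<Longrightarrow> tail G' i \<in> W \<longleftrightarrow> head G' i \<in> W"
    and WB: "\<And>i. i \<in> ?B \<Longrightarrow> \<not> (tail G' i \<in> W \<and> head G' i \<in> W)"
    and Wall: "\<And>e. e \<in> arcs G \<Longrightarrow> tail G e \<noteq> head G e \<Longrightarrow> e \<notin> star G v \<Longrightarrow> tail G' (g e) \<in> W"
  proof (cases "\<exists>e\<in>arcs G. tail G e \<noteq> head G e \<and> e \<notin> star G v")
    case False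
    then show ?thesis by (intro that[of "{}"]) auto
  next
    case True
    then obtain e where e: "e \<in> arcs G" "tail G e \<noteq> head G e" "e \<notin> star G v" by blast
    define z where "z = tail G' (g e)"
    define W where "W = {y. \<exists>w. walk G' z w y \<and> (\<forall>s\<in>set w. fst s \<notin> ?B)}"
    have step: "dst G' s \<in> W" if s: "s \<in> bonds G'" "fst s \<notin> ?B" "src G' s \<in> W" for s
    proof -
      obtain w where w: "walk G' z w (src G' s)" "\<forall>s\<in>set w. fst s \<notin> ?B" using s(3) by (auto simp: W_def)
      have "walk G' (src G' s) [s] (dst G' s)"
        using s(1) G'.bond_ends_in_verts(2)[OF s(1)] by (simp add: walk_Cons_iff del: walk.simps(2))
      from walk_append[OF w(1) this] show ?thesis using w(2) s(2) unfolding W_def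
        by (intro CollectI exI[of _ "w @ [s]"]) auto
    qed
    have closed: "tail G' i \<in> W \<longleftrightarrow> head G' i \<in> W" if "i \<in> arcs G'" "i \<notin> ?B" for i
      using step[of "(i, True)"] step[of "(i, False)"] that by (auto simp: bonds_def src_def dst_def)
    have zW: "z \<in> W" using g_arcs[OF e(1)] by (simp add: W_def z_def) (intro exI[of _ "[]"], simp)
    show ?thesis
    proof (rule that[of W])
      show "tail G' i \<in> W \<longleftrightarrow> head G' i \<in> W" if "i \<in> arcs G'" "i \<notin> ?B" for i by (rule closed[OF that])
      show "tail G' (g f) \<in> W" if f: "f \<in> arcs G" "tail G f \<noteq> head G f" "f \<notin> star G v" for f
      proof -
        have te: "tail G e \<in> verts G" "tail G e \<notin> {v}" "tail G f \<in> verts G" "tail G f \<notin> {v}"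
          using e f by (auto simp: star_def)
        have "\<exists>w. walk G (tail G e) w (tail G f) \<and> (\<forall>s\<in>set w. src G s \<notin> {v} \<and> dst G s \<notin> {v})"
          using v te by (intro conn3_walk[OF conn]) auto
        then obtain w where w: "walk G (tail G e) w (tail G f)" "\<forall>s\<in>set w. src G s \<noteq> v \<and> dst G s \<noteq> v" by auto
        show ?thesis
          by (rule component_along_walk[OF v closed _ f(3) w _ e(3)]) (use e f zW in \<open>auto simp: star_def z_def\<close>)
      qed
      show "\<not> (tail G' i \<in> W \<and> head G' i \<in> W)" if i: "i \<in> ?B" for i
      proof
        assume "tail G' i \<in> W \<and> head G' i \<in> W"
        then have "tail G' i \<in> W" "head G' i \<in> W" by blast+
        then obtain p q where p: "walk G' z p (tail G' i)" "\<forall>s\<in>set p. fst s \<notin> ?B"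
          and q: "walk G' z q (head G' i)" "\<forall>s\<in>set q. fst s \<notin> ?B" unfolding W_def by blast
        have i': "i \<in> arcs G'" using i g_arcs star_arcs(1) by blast
        have "walk G' (head G' i) (rev (map flip q) @ p) (tail G' i)"
          by (rule walk_append[OF G'.walk_reverse[OF q(1)] p(1)])
        then have "\<exists>s\<in>set (rev (map flip q) @ p). fst s \<in> ?B"
          using i i' by (intro star_image_no_bypass[OF v, of "(i, True)"]) (simp_all add: bonds_def src_def dst_def)
        then obtain s where "s \<in> set (rev (map flip q) @ p)" "fst s \<in> ?B" by blast
        then show False using q(2) p(2) by (auto simp: flip_def)
      qed
    qed
  qed
  obtain s where "s \<in> bonds G" "src G s = v" "dst G s \<noteq> v"
    using conn3_leaves[OF G.wf_digraph_axioms conn, of "{}" v] v by auto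
  then obtain e where e: "e \<in> star G v" using bond_in_star(1)[of s G] by auto
  have ge: "g e \<in> arcs G'" using e star_arcs(1) g_arcs by blast
  obtain w where w: "w \<in> verts G'" "w \<notin> W" using WB[OF imageI[OF e]] G'.tail_in_verts[OF ge] G'.head_in_verts[OF ge] by blast
  have sub: "star G' w \<subseteq> ?B"
  proof
    fix f' assume f': "f' \<in> star G' w"
    obtain f where f: "f \<in> arcs G" "f' = g f" using g_surj star_arcs(2)[OF f'] by blast
    show "f' \<in> ?B"
    proof (rule ccontr)
      assume n: "f' \<notin> ?B"
      have "tail G f \<noteq> head G f" using loop_iff[OF f(1)] f' f(2) by (simp add: star_def)
      then have "tail G' f' \<in> W" using Wall[OF f(1)] n f(2) by blast
      moreover from this have "head G' f' \<in> W" using W[OF star_arcs(2)[OF f'] n] by blast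
      ultimately show False using f' w(2) by (auto simp: star_def)
    qed
  qed
  obtain s' where "s' \<in> bonds G'" "src G' s' = w" "dst G' s' \<noteq> w"
    using conn3_leaves[OF G'.wf_digraph_axioms conn', of "{}" w] w(1) by auto
  then obtain e0 where e0: "e0 \<in> star G v" "g e0 \<in> star G' w" using bond_in_star(1)[of s' G'] sub by auto
  have "g f \<in> star G' w" if f: "f \<in> star G v" for f
  proof (rule ccontr)
    assume n: "g f \<notin> star G' w"
    obtain b where b: "b \<in> bonds G" "fst b = e0" "dst G b = v" "src G b \<noteq> v" using star_into[OF e0(1)] by blast
    obtain c where c: "c \<in> bonds G" "fst c = f" "src G c = v" "dst G c \<noteq> v" using star_out[OF f] by blast
    have "\<exists>x\<in>cycles G. x (fst b) \<noteq> 0 \<and> x (fst c) \<noteq> 0 \<and>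
      (\<forall>i. i \<noteq> fst b \<longrightarrow> i \<noteq> fst c \<longrightarrow> tail G i \<in> {v} \<or> head G i \<in> {v} \<longrightarrow> x i = 0)"
      using v b c n e0(2) by (intro two_edge_flow[OF G.fin_digraph_axioms conn]) auto
    then obtain x where x: "x \<in> cycles G" "x e0 \<noteq> 0"
      and x0: "\<And>i. i \<noteq> e0 \<Longrightarrow> i \<noteq> f \<Longrightarrow> tail G i = v \<or> head G i = v \<Longrightarrow> x i = 0"
      unfolding b(2) c(2) by blast
    obtain x' where x': "x' \<in> cycles G'" "\<forall>i\<in>arcs G. x' (g i) = 0 \<longleftrightarrow> x i = 0" using push[OF x(1)] by blast
    have "x' i = 0" if i: "i \<in> star G' w" "i \<noteq> g e0" for i
    proof -
      obtain j where j: "j \<in> star G v" "i = g j" using sub i(1) by blast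
      then have "x j = 0" using i n by (intro x0) (auto simp: star_def)
      then show ?thesis using x'(2) j star_arcs(1) by blast
    qed
    then have "x' (g e0) = 0" by (rule cycles_star_single[OF G'.finite_arcs x'(1) e0(2)])
    then show False using x'(2) x(2) star_arcs(1)[OF e0(1)] by blast
  qed
  then show ?thesis using sub w(1) by blast
qed

text \<open>
  In a 3-connected graph distinct vertices have distinct stars, so the vertex map is injective. An edge joins the two
  vertices whose stars contain it.
\<close>

theorem vertex_bijection:
  assumes card: "card (verts G) = card (verts G')"
  shows "\<exists>F. bij_betw F (verts G) (verts G') \<and> (\<forall>v\<in>verts G. star G' (F v) = g ` star G v) \<and>
    (\<forall>e\<in>arcs G. tail G e \<noteq> head G e \<longrightarrow> {tail G' (g e), head G' (g e)} = {F (tail G e), F (head G e)})"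
proof -
  obtain F where F: "\<And>v. v \<in> verts G \<Longrightarrow> F v \<in> verts G'" "\<And>v. v \<in> verts G \<Longrightarrow> star G' (F v) = g ` star G v"
    using star_image by metis
  have inj: "inj_on F (verts G)"
  proof (rule inj_onI, rule ccontr)
    fix u v assume uv: "u \<in> verts G" "v \<in> verts G" "F u = F v" "u \<noteq> v"
    then have img: "g ` star G u = g ` star G v" using F(2) by metis
    have eq: "e \<in> star G v" if e: "e \<in> star G u" for e
    proof -
      obtain f where "f \<in> star G v" "g e = g f" using e img by blast
      then show ?thesis using g_eq_iff star_arcs(1) e by metis
    qed
    obtain s where s: "s \<in> bonds G" "src G s = u" "dst G s \<noteq> u" "dst G s \<noteq> v"
      using conn3_leaves[OF G.wf_digraph_axioms conn, of "{v}" u] uv by auto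
    then have "fst s \<in> star G v" using bond_in_star(1)[of s G] eq by auto
    then show False using s uv(4) by (auto simp: star_def src_def dst_def split: if_splits)
  qed
  have "F ` verts G = verts G'"
    using F(1) card card_image[OF inj] by (intro card_subset_eq) auto
  then have "bij_betw F (verts G) (verts G')" using inj by (simp add: bij_betw_def)
  moreover have "{tail G' (g e), head G' (g e)} = {F (tail G e), F (head G e)}"
    if e: "e \<in> arcs G" "tail G e \<noteq> head G e" for e
  proof -
    have v: "tail G e \<in> verts G" "head G e \<in> verts G" using e by auto
    have "e \<in> star G (tail G e)" "e \<in> star G (head G e)" using e by (auto simp: star_def)
    then have "g e \<in> star G' (F (tail G e))" "g e \<in> star G' (F (head G e))" using F(2)[OF v(1)] F(2)[OF v(2)] by auto
    moreover have "F (tail G e) \<noteq> F (head G e)" using inj e(2) v by (auto dest: inj_onD)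
    ultimately show ?thesis by (auto simp: star_def)
  qed
  ultimately show ?thesis using F(2) by blast
qed

end

section \<open>Loops and the reconstruction\<close>

text \<open>
  What flows into a vertex also flows out of it.
\<close>

lemma pos_flow_leaves:
  assumes G: "fin_digraph G" and k: "k \<in> cycles G" and e: "e \<in> star G u" "k e \<noteq> 0"
  shows "\<exists>s\<in>pos_bonds k. src G s = u \<and> dst G s \<noteq> u"
proof -
  define b where "b = (e, k e > 0)"
  have b: "b \<in> pos_bonds k" using e(2) by (simp add: b_def pos_bonds_def)
  have end1: "src G b \<noteq> dst G b" "src G b = u \<or> dst G b = u"
    using e(1) by (auto simp: b_def star_def src_def dst_def)
  show ?thesis
  proof (cases "src G b = u")
    case True
    then show ?thesis using b end1 by auto
  next
    case False
    then have d: "dst G b = u" using end1(2) by simp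
    obtain w where w: "walk G u w (src G b)" "set w \<subseteq> pos_bonds k" using return_walk[OF G k b] d by blast
    then show ?thesis using walk_leaves[OF w(1)] False by blast
  qed
qed

text \<open>
  By 3-connectedness some circuit passes through \<open>u\<close> and misses \<open>v\<close>, and the loop is added to it.
\<close>

lemma loop_beside_cycle:
  assumes G: "fin_digraph G" "conn3 G" and a: "a \<in> arcs G" "tail G a = v" "head G a = v"
    and u: "u \<in> verts G" "u \<noteq> v"
  shows "\<exists>X. simple_cycle G X \<and> (a, True) \<in> X \<and> (\<exists>b\<in>X. fst b \<in> star G u)"
proof -
  interpret fin_digraph G by fact
  have v: "v \<in> verts G" using a by auto
  obtain b c where b: "b \<in> bonds G" "dst G b = u" "src G b \<notin> {u, v}"
    and c: "c \<in> bonds G" "src G c = u" "dst G c \<notin> {u, v}" and bc: "fst b \<noteq> fst c"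
    using two_edges_avoiding[OF wf_digraph_axioms G(2) u(1) v u(2)] by blast
  have "\<exists>x\<in>cycles G. x (fst b) \<noteq> 0 \<and> x (fst c) \<noteq> 0 \<and>
    (\<forall>e. e \<noteq> fst b \<longrightarrow> e \<noteq> fst c \<longrightarrow> tail G e \<in> {u, v} \<or> head G e \<in> {u, v} \<longrightarrow> x e = 0)"
    using u v b c bc by (intro two_edge_flow[OF G]) (auto simp: card_insert_if)
  then obtain x where x: "x \<in> cycles G" "x (fst b) \<noteq> 0"
    and x0: "\<And>e. e \<noteq> fst b \<Longrightarrow> e \<noteq> fst c \<Longrightarrow> tail G e \<in> {u, v} \<or> head G e \<in> {u, v} \<Longrightarrow> x e = 0" by blast
  have bu: "fst b \<in> star G u" using bond_in_star(2)[OF b(1)] b by auto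
  obtain s where s: "s \<in> pos_bonds x" "src G s = u" "dst G s \<noteq> u" using pos_flow_leaves[OF G(1) x(1) bu x(2)] by blast
  obtain Y where Y: "simple_cycle G Y" "s \<in> Y" "Y \<subseteq> pos_bonds x" using simple_cycle_through[OF G(1) x(1) s(1)] by blast
  have nv: "src G t \<noteq> v \<and> dst G t \<noteq> v" if t: "t \<in> Y" for t
  proof (rule ccontr)
    assume "\<not> ?thesis"
    then have tv: "tail G (fst t) = v \<or> head G (fst t) = v" by (auto simp: src_def dst_def split: if_splits)
    have "x (fst t) \<noteq> 0" using t Y(3) by (auto simp: pos_bonds_def split: if_splits)
    then have "fst t = fst b \<or> fst t = fst c" using x0[of "fst t"] tv by auto
    then show False using tv b c u(2) by (auto simp: src_def dst_def split: if_splits)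
  qed
  have av: "src G (a, d) = v" "dst G (a, d) = v" for d using a by (simp_all add: src_def dst_def)
  have notin: "(a, d) \<notin> Y" for d using nv av by blast
  let ?X = "insert (a, True) Y"
  have "simple_cycle G ?X"
    unfolding simple_cycle_def
  proof (intro conjI ballI)
    show "?X \<subseteq> bonds G" using Y(1) a(1) by (simp add: simple_cycle_def bonds_def)
    have "v \<notin> src G ` Y" "v \<notin> dst G ` Y" using nv by auto
    then show "inj_on (src G) ?X" "inj_on (dst G) ?X" using Y(1) notin by (simp_all add: simple_cycle_def av)
    show "src G ` ?X = dst G ` ?X" using Y(1) by (simp add: simple_cycle_def av)
  next
    fix t assume t: "t \<in> ?X"
    show "flip t \<notin> ?X"
    proof (cases "t = (a, True)")
      case True
      then show ?thesis using notin by (simp add: flip_def)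
    next
      case False
      then have tY: "t \<in> Y" using t by simp
      then have "fst t \<noteq> a" using notin by (metis prod.collapse)
      then show ?thesis using tY Y(1) by (auto simp: simple_cycle_def flip_def)
    qed
  qed
  moreover have "fst s \<in> star G u" using bond_in_star(1)[of s G] s Y(2) Y(1) by (auto simp: simple_cycle_def)
  ultimately show ?thesis using Y(2) by blast
qed

text \<open>
  This is how the amplitudes detect at which vertex a loop sits.
\<close>

lemma amp_nonzero_imp_inj_pos_bonds:
  assumes fin: "finite (arcs G)" and L: "\<And>e. e \<in> arcs G \<Longrightarrow> L e > 0"
    and k: "k \<in> cycles G" and nz: "amp G L k (flow_norm G L k) \<noteq> 0"
  shows "inj_on (src G) (pos_bonds k)"
proof -
  have supp: "\<And>e. e \<notin> arcs G \<Longrightarrow> k e = 0" using k by (simp add: cycles_def)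
  have eq: "amp G L k (flow_norm G L k) = (if \<forall>e. \<bar>k e\<bar> \<le> 1 then pcoeff G (flow_bonds k) else 0)"
    by (rule amp_flow_norm) (fact fin, erule L, erule supp)
  have all: "\<forall>e. \<bar>k e\<bar> \<le> 1"
  proof (rule ccontr)
    assume "\<not> ?thesis"
    then show False using nz unfolding eq by (simp only: if_False)
  qed
  have le: "\<bar>k e\<bar> \<le> 1" for e using all by (rule spec)
  have pc: "pcoeff G (flow_bonds k) \<noteq> 0" using nz unfolding eq if_P[OF all] .
  have pf: "pos_bonds k \<subseteq> flow_bonds k"
  proof
    fix b assume "b \<in> pos_bonds k"
    then show "b \<in> flow_bonds k" using le[of "fst b"] by (cases "snd b") (simp_all add: pos_bonds_def flow_bonds_def)
  qed
  have "flow_bonds k \<subseteq> bonds G"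
  proof
    fix b assume "b \<in> flow_bonds k"
    then have "k (fst b) \<noteq> 0" by (simp add: flow_bonds_def split: if_splits)
    then have "fst b \<in> arcs G" using supp by blast
    then show "b \<in> bonds G" by (cases b) (simp add: bonds_def)
  qed
  then have "finite (flow_bonds k)" using finite_bonds[OF fin] finite_subset by blast
  moreover have "flip b \<notin> flow_bonds k" if "b \<in> flow_bonds k" for b
    using that by (cases "snd b") (simp_all add: flow_bonds_def)
  ultimately have "inj_on (src G) (flow_bonds k)" by (rule pcoeff_nonzero_imp_inj[OF _ pc])
  then show ?thesis using pf by (rule inj_on_subset)
qed

theorem theorem9p1:
  fixes G0 :: "('v0, 'e0) pre_digraph"
    and G :: "('v, 'e) pre_digraph" and L :: "'e \<Rightarrow> real"
    and G' :: "('w, 'f) pre_digraph" and L' :: "'f \<Rightarrow> real"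
  assumes "fin_digraph G0" and "k_connected 3 G0"
    and "quantum_graph G L" and "graph_isomorphic G0 G"
    and "quantum_graph G' L'" and "graph_isomorphic G0 G'"
    and "bloch_isospectral G L G' L'"
  shows "\<exists>f g. graph_iso G G' f g \<and> (\<forall>e\<in>arcs G. L' (g e) = L e)"
proof -
  interpret G: quantum_graph G L by fact
  interpret G': quantum_graph G' L' by fact
  have conn0: "conn3 G0" by (rule k_connected_3_imp_conn3[OF assms(1,2)])
  obtain f1 g1 where iso: "graph_iso G0 G f1 g1" using assms(4) by (auto simp: graph_isomorphic_def)
  obtain f2 g2 where iso': "graph_iso G0 G' f2 g2" using assms(6) by (auto simp: graph_isomorphic_def)
  have conn: "conn3 G" by (rule conn3_graph_iso[OF iso conn0 assms(1)])
  have conn': "conn3 G'" by (rule conn3_graph_iso[OF iso' conn0 assms(1)])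
  have cards: "card (verts G) = card (verts G')" "card (arcs G) = card (arcs G')"
    using iso iso' bij_betw_same_card by (metis graph_iso_def)+
  obtain \<phi> where bij: "bij_betw \<phi> (cycles G) (cycles G')"
    and diff: "\<And>h k. h \<in> cycles G \<Longrightarrow> k \<in> cycles G \<Longrightarrow> \<phi> (h - k) = \<phi> h - \<phi> k"
    and norm: "\<And>h. h \<in> cycles G \<Longrightarrow> flow_norm G' L' (\<phi> h) = flow_norm G L h"
    and amp: "\<And>h l. h \<in> cycles G \<Longrightarrow> amp G L h l \<noteq> 0 \<Longrightarrow> amp G' L' (\<phi> h) l \<noteq> 0"
    using isospectral_imp_flow_isometry[OF assms(3,5,7)] by blast
  have "\<forall>e\<in>arcs G. \<exists>f\<in>arcs G'. L' f = L e \<and> (\<exists>\<epsilon>. \<bar>\<epsilon>\<bar> = 1 \<and> (\<forall>h\<in>cycles G. \<phi> h f = \<epsilon> * h e))"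
    using flow_isometry_edge_bijection[OF assms(3) conn assms(5) conn' bij diff norm] by blast
  then obtain g where g: "\<And>e. e \<in> arcs G \<Longrightarrow> g e \<in> arcs G'" "\<And>e. e \<in> arcs G \<Longrightarrow> L' (g e) = L e"
    and ex: "\<And>e. e \<in> arcs G \<Longrightarrow> \<exists>\<epsilon>. \<bar>\<epsilon>\<bar> = 1 \<and> (\<forall>h\<in>cycles G. \<phi> h (g e) = \<epsilon> * h e)"
    by metis
  have zero_iff: "\<phi> h (g e) = 0 \<longleftrightarrow> h e = 0" if "e \<in> arcs G" "h \<in> cycles G" for e h
    using ex[OF that(1)] that(2) by auto
  have inj: "inj_on g (arcs G)"
  proof (rule inj_onI, rule ccontr)
    fix e f assume ef: "e \<in> arcs G" "f \<in> arcs G" "g e = g f" "e \<noteq> f"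
    obtain x where "x \<in> cycles G" "x f = 1" "x e = 0"
      using flow_through_avoiding[OF G.fin_digraph_axioms conn ef(2), of e] ef(4) by blast
    then show False using zero_iff[OF ef(1), of x] zero_iff[OF ef(2), of x] ef(3) by simp
  qed
  have "g ` arcs G = arcs G'"
    using g(1) cards(2) card_image[OF inj] by (intro card_subset_eq) auto
  then have bij_g: "bij_betw g (arcs G) (arcs G')" using inj by (simp add: bij_betw_def)
  have \<phi>c: "\<phi> h \<in> cycles G'" if "h \<in> cycles G" for h using bij that bij_betwE by blast
  have push: "\<exists>h'\<in>cycles G'. \<forall>e\<in>arcs G. h' (g e) = 0 \<longleftrightarrow> h e = 0" if "h \<in> cycles G" for h
    using zero_iff[OF _ that] by (intro bexI[of _ "\<phi> h"] \<phi>c[OF that] ballI) simp_all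
  have pull: "\<exists>h\<in>cycles G. \<forall>e\<in>arcs G. h' (g e) = 0 \<longleftrightarrow> h e = 0" if h': "h' \<in> cycles G'" for h'
  proof -
    obtain h where "h \<in> cycles G" "h' = \<phi> h" using bij h' by (auto simp: bij_betw_def)
    then show ?thesis using zero_iff[OF _ \<open>h \<in> cycles G\<close>] by (intro bexI[of _ h] ballI) simp_all
  qed
  have cycle_support_iso: "cycle_support_iso G G' g"
  proof (rule cycle_support_iso.intro)
    show "fin_digraph G" "fin_digraph G'" by (rule G.fin_digraph_axioms G'.fin_digraph_axioms)+
    show "cycle_support_iso_axioms G G' g"
      unfolding cycle_support_iso_axioms_def using conn conn' bij_g push pull by (intro conjI allI impI) assumption+
  qed
  obtain F where F_all: "bij_betw F (verts G) (verts G') \<and> (\<forall>v\<in>verts G. star G' (F v) = g ` star G v) \<and>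
      (\<forall>e\<in>arcs G. tail G e \<noteq> head G e \<longrightarrow> {tail G' (g e), head G' (g e)} = {F (tail G e), F (head G e)})"
    using cycle_support_iso.vertex_bijection[OF cycle_support_iso cards(1)] by (elim exE)
  then have F: "bij_betw F (verts G) (verts G')" and Fstar: "\<And>v. v \<in> verts G \<Longrightarrow> star G' (F v) = g ` star G v"
    by (elim conjE; simp)+
  have Fe: "{tail G' (g e), head G' (g e)} = {F (tail G e), F (head G e)}"
    if "e \<in> arcs G" "tail G e \<noteq> head G e" for e
    using F_all[THEN conjunct2, THEN conjunct2, rule_format, OF that] .
  \<comment> \<open>If the image of a loop sat at the image \<open>F u\<close> of another vertex, then a circuit through \<open>u\<close> together with the loop
    would map to a flow that leaves \<open>F u\<close> twice, and its amplitude would vanish.\<close>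
  have loop: "tail G' (g a) = F (tail G a)" if a: "a \<in> arcs G" "tail G a = head G a" for a
  proof (rule ccontr)
    assume ne: "tail G' (g a) \<noteq> F (tail G a)"
    have la: "head G' (g a) = tail G' (g a)" using cycle_support_iso.loop_iff[OF cycle_support_iso a(1)] a(2) by simp
    have "tail G' (g a) \<in> verts G'" using g(1)[OF a(1)] by auto
    then obtain u where u: "u \<in> verts G" "tail G' (g a) = F u" using F by (auto simp: bij_betw_def)
    have "u \<noteq> tail G a" using ne u(2) by auto
    then obtain X b where X: "simple_cycle G X" "(a, True) \<in> X" "b \<in> X" "fst b \<in> star G u"
      using loop_beside_cycle[OF G.fin_digraph_axioms conn a(1) refl a(2)[symmetric] u(1)] by blast
    have nX: "net X \<in> cycles G" by (rule simple_cycle_net[OF G.finite_arcs X(1)])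
    have used: "net X (fst t) \<noteq> 0" if t: "t \<in> X" for t
    proof -
      have "flip t \<notin> X" using X(1) t by (simp add: simple_cycle_def)
      then show ?thesis using t by (cases t; cases "snd t") (auto simp: net_def flip_def)
    qed
    let ?k = "\<phi> (net X)"
    have nz: "amp G' L' ?k (flow_norm G' L' ?k) \<noteq> 0"
      unfolding norm[OF nX] using simple_cycle_amp[OF G.finite_arcs G.length_pos X(1)] by (intro amp[OF nX])
    have injk: "inj_on (src G') (pos_bonds ?k)"
      by (rule amp_nonzero_imp_inj_pos_bonds[OF G'.finite_arcs _ \<phi>c[OF nX] nz]) (rule G'.length_pos)
    have "fst b \<in> arcs G" using X(4) by (simp add: star_def)
    then have kb: "?k (g (fst b)) \<noteq> 0" using zero_iff[OF _ nX] used[OF X(3)] by simp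
    have gb: "g (fst b) \<in> star G' (F u)" unfolding Fstar[OF u(1)] by (rule imageI[OF X(4)])
    obtain s where s: "s \<in> pos_bonds ?k" "src G' s = F u" "dst G' s \<noteq> F u"
      using pos_flow_leaves[OF G'.fin_digraph_axioms \<phi>c[OF nX] gb kb] by (elim bexE conjE)
    have "?k (g a) \<noteq> 0" using zero_iff[OF a(1) nX] used[OF X(2)] by simp
    then have ka: "(g a, ?k (g a) > 0) \<in> pos_bonds ?k" by (simp add: pos_bonds_def)
    have sd: "src G' (g a, d) = F u" "dst G' (g a, d) = F u" for d
      using la u(2) by (simp_all add: src_def dst_def)
    have "s = (g a, ?k (g a) > 0)" by (rule inj_onD[OF injk _ s(1) ka]) (simp only: s(2) sd(1))
    then show False using s(3) sd(2) by simp
  qed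
  have "graph_iso G G' F g"
    unfolding graph_iso_def
  proof (intro conjI ballI F bij_g)
    fix e assume e: "e \<in> arcs G"
    show "{tail G' (g e), head G' (g e)} = {F (tail G e), F (head G e)}"
    proof (cases "tail G e = head G e")
      case True
      then show ?thesis using loop[OF e True] cycle_support_iso.loop_iff[OF cycle_support_iso e] by simp
    qed (rule Fe[OF e])
  qed
  then show ?thesis using g(2) by blast
qed

end
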